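(* Let $\mu_0\in\mathcal P(\mathbb R^{d_0})$, $\mu_1\in\mathcal P(\mathbb R^{d_1})$ be compactly supported, let $\varepsilon>0$, and let $\Phi(A)=32\|A\|_F^2+\mathrm{OT}_{A,\varepsilon}(\mu_0,\mu_1)$. The following hold for any $A\in\mathbb R^{d_0\times d_1}$: (i) The minimal eigenvalue of $D^2\Phi_{[A]}$ satisfies \[\lambda_{\min}\left(D^2\Phi_{[A]}\right)=64+\varepsilon^{-1}\inf_{\|C\|_F=1}\int\left[\left(h_0^{A,C}(x)+h_1^{A,C}(y)\right)^2-32^2(x^{\intercal}Cy)^2\right]d\pi_A(x,y)\ \ge\ 64-32^2\varepsilon^{-1}\sup_{\|C\|_F=1}\mathrm{Var}_{\pi_A}(X^{\intercal}CY),\] where the variance term admits the uniform bound $\sup_{\|C\|_F=1}\mathrm{Var}_{\pi_A}(X^{\intercal}CY)\le\sqrt{M_4(\mu_0)M_4(\mu_1)}$. (ii) The maximal eigenvalue of $D^2\Phi_{[A]}$ satisfies $\lambda_{\max}\left(D^2\Phi_{[A]}\right)\le 64$.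
   Context: $\Pi(\mu_0,\mu_1)$ is the set of couplings; $\mathsf D_{\mathsf{KL}}$ is the Kullback–Leibler divergence; $\|\cdot\|_F$ is the Frobenius norm; $M_p(\mu)=\int\|x\|^p d\mu(x)$. For $A\in\mathbb R^{d_0\times d_1}$, $c_A(x,y)=-4\|x\|^2\|y\|^2-32x^{\intercal}Ay$, \[\mathrm{OT}_{A,\varepsilon}(\mu_0,\mu_1)=\inf_{\pi\in\Pi(\mu_0,\mu_1)}\int c_A\,d\pi+\varepsilon\,\mathsf D_{\mathsf{KL}}(\pi\|\mu_0\otimes\mu_1),\] and $\pi_A$ is its unique optimal coupling. $\mathrm{Var}_{\pi_A}(X^{\intercal}CY)$ is the variance of $X^{\intercal}CY$ for $(X,Y)\sim\pi_A$. For $C\in\mathbb R^{d_0\times d_1}$, $(h_0^{A,C},h_1^{A,C})\in\mathcal C(\mathrm{spt}(\mu_0))\times\mathcal C(\mathrm{spt}(\mu_1))$ is the pair of functions, unique up to additive constants ($(h_0+a,h_1-a)$, $a\in\mathbb R$), with \[\int\left(h_0^{A,C}(x)+h_1^{A,C}(y)-32x^{\intercal}Cy\right)\rho_A(x,y)\,d\mu_1(y)=0\ \ \forall x\in\mathrm{spt}(\mu_0),\] \[\int\left(h_0^{A,C}(x)+h_1^{A,C}(y)-32x^{\intercal}Cy\right)\rho_A(x,y)\,d\mu_0(x)=0\ \ \forall y\in\mathrm{spt}(\mu_1),\] where $\rho_A(x,y)=\frac{d\pi_A}{d\mu_0\otimes\mu_1}(x,y)=e^{(\varphi_0^A(x)+\varphi_1^A(y)-c_A(x,y))/\varepsilon}$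 and $(\varphi_0^A,\varphi_1^A)$ are EOT potentials, i.e. continuous functions such that $\int\rho_A(x,y)\,d\mu_1(y)=1$ for all $x\in\mathbb R^{d_0}$ and $\int\rho_A(x,y)\,d\mu_0(x)=1$ for all $y\in\mathbb R^{d_1}$. The second Fréchet derivative $D^2\Phi_{[A]}$ is a symmetric bilinear form on $\mathbb R^{d_0\times d_1}$ (with Frobenius inner product); its eigenvalues are those of the corresponding $d_0d_1\times d_0d_1$ symmetric matrix. *)

theory Defs
  imports "HOL-Probability.Probability"
begin

definition spt :: "'a::topological_space measure \<Rightarrow> 'a set" where
  "spt M = {x. \<forall>U. open U \<longrightarrow> x \<in> U \<longrightarrow> emeasure M U > 0}"

definition borel_prob :: "'a::topological_space measure \<Rightarrow> bool" where
  "borel_prob M \<longleftrightarrow> prob_space M \<and> sets M = sets borel"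

definition moment :: "nat \<Rightarrow> 'a::real_normed_vector measure \<Rightarrow> real" where
  "moment p M = (\<integral>x. norm x ^ p \<partial>M)"

definition couplings ::
  "'a::topological_space measure \<Rightarrow> 'b::topological_space measure \<Rightarrow> ('a \<times> 'b) measure set" where
  "couplings \<mu>0 \<mu>1 =
     {\<pi>. borel_prob \<pi> \<and> distr \<pi> borel fst = \<mu>0 \<and> distr \<pi> borel snd = \<mu>1}"

text \<open>
  The library constant \<^const>\<open>KL_divergence\<close> is real-valued and takes the reference measure as its
  first measure argument. For probability measures with \<open>P \<ll> Q\<close> the negative part of the log-density
  is always \<open>P\<close>-integrable, so failure of integrability means exactly that the divergence is \<open>\<infinity>\<close>.
\<close>
definition KL :: "'a measure \<Rightarrow> 'a measure \<Rightarrow> ereal" where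
  "KL P Q =
     (if absolutely_continuous Q P \<and> integrable P (entropy_density (exp 1) Q P)
      then ereal (KL_divergence (exp 1) Q P) else \<infinity>)"

text \<open>
  A \<open>d\<^sub>0 \<times> d\<^sub>1\<close> matrix has type \<^typ>\<open>real^'n^'m\<close> with \<open>d\<^sub>0 = CARD('m)\<close> and \<open>d\<^sub>1 = CARD('n)\<close>; the
  norm and inner product of this type are the Frobenius ones.
\<close>
definition bilin :: "real^'n^'m \<Rightarrow> real^'m \<Rightarrow> real^'n \<Rightarrow> real" where
  "bilin C x y = x \<bullet> (C *v y)"

definition cost :: "real^'n^'m \<Rightarrow> real^'m \<Rightarrow> real^'n \<Rightarrow> real" where
  "cost A x y = - 4 * (norm x)^2 * (norm y)^2 - 32 * bilin A x y"

definition eot_objective ::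
  "(real^'m) measure \<Rightarrow> (real^'n) measure \<Rightarrow> real \<Rightarrow> real^'n^'m \<Rightarrow> ((real^'m) \<times> (real^'n)) measure \<Rightarrow> ereal"
  where
  "eot_objective \<mu>0 \<mu>1 \<epsilon> A \<pi> =
     ereal (\<integral>(x, y). cost A x y \<partial>\<pi>) + ereal \<epsilon> * KL \<pi> (\<mu>0 \<Otimes>\<^sub>M \<mu>1)"

definition OT :: "(real^'m) measure \<Rightarrow> (real^'n) measure \<Rightarrow> real \<Rightarrow> real^'n^'m \<Rightarrow> ereal" where
  "OT \<mu>0 \<mu>1 \<epsilon> A = (INF \<pi>\<in>couplings \<mu>0 \<mu>1. eot_objective \<mu>0 \<mu>1 \<epsilon> A \<pi>)"

definition opt_coupling ::
  "(real^'m) measure \<Rightarrow> (real^'n) measure \<Rightarrow> real \<Rightarrow> real^'n^'m \<Rightarrow> ((real^'m) \<times> (real^'n)) measure" where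
  "opt_coupling \<mu>0 \<mu>1 \<epsilon> A =
     (THE \<pi>. \<pi> \<in> couplings \<mu>0 \<mu>1 \<and> eot_objective \<mu>0 \<mu>1 \<epsilon> A \<pi> = OT \<mu>0 \<mu>1 \<epsilon> A)"

text \<open>For compactly supported marginals \<^const>\<open>OT\<close> is finite, so \<^const>\<open>real_of_ereal\<close> loses nothing.\<close>
definition Phi :: "(real^'m) measure \<Rightarrow> (real^'n) measure \<Rightarrow> real \<Rightarrow> real^'n^'m \<Rightarrow> real" where
  "Phi \<mu>0 \<mu>1 \<epsilon> A = 32 * (norm A)^2 + real_of_ereal (OT \<mu>0 \<mu>1 \<epsilon> A)"

definition eot_dens ::
  "real \<Rightarrow> real^'n^'m \<Rightarrow> (real^'m \<Rightarrow> real) \<times> (real^'n \<Rightarrow> real) \<Rightarrow> real^'m \<Rightarrow> real^'n \<Rightarrow> real" where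
  "eot_dens \<epsilon> A \<phi> x y = exp ((fst \<phi> x + snd \<phi> y - cost A x y) / \<epsilon>)"

definition eot_potentials ::
  "(real^'m) measure \<Rightarrow> (real^'n) measure \<Rightarrow> real \<Rightarrow> real^'n^'m
    \<Rightarrow> (real^'m \<Rightarrow> real) \<times> (real^'n \<Rightarrow> real) \<Rightarrow> bool" where
  "eot_potentials \<mu>0 \<mu>1 \<epsilon> A \<phi> \<longleftrightarrow>
     continuous_on UNIV (fst \<phi>) \<and> continuous_on UNIV (snd \<phi>) \<and>
     (\<forall>x. (\<integral>y. eot_dens \<epsilon> A \<phi> x y \<partial>\<mu>1) = 1) \<and>
     (\<forall>y. (\<integral>x. eot_dens \<epsilon> A \<phi> x y \<partial>\<mu>0) = 1)"

text \<open>
  The potentials are unique up to \<open>(\<phi>\<^sub>0 + a, \<phi>\<^sub>1 - a)\<close>, which does not change the density, so the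
  choice below is immaterial.
\<close>
definition rho ::
  "(real^'m) measure \<Rightarrow> (real^'n) measure \<Rightarrow> real \<Rightarrow> real^'n^'m \<Rightarrow> real^'m \<Rightarrow> real^'n \<Rightarrow> real" where
  "rho \<mu>0 \<mu>1 \<epsilon> A = eot_dens \<epsilon> A (SOME \<phi>. eot_potentials \<mu>0 \<mu>1 \<epsilon> A \<phi>)"

text \<open>
  Continuous functions on \<open>S\<close>. Being extensional fixes them to a constant off \<open>S\<close>; for closed \<open>S\<close>
  this makes them Borel measurable on the whole space. Otherwise a non-measurable extension
  would make the Bochner integrals below vanish by convention.
\<close>
definition cont_funs :: "'a::topological_space set \<Rightarrow> ('a \<Rightarrow> real) set" where
  "cont_funs S = {f \<in> extensional S. continuous_on S f}"

definition h_system ::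
  "(real^'m) measure \<Rightarrow> (real^'n) measure \<Rightarrow> real \<Rightarrow> real^'n^'m \<Rightarrow> real^'n^'m
    \<Rightarrow> (real^'m \<Rightarrow> real) \<times> (real^'n \<Rightarrow> real) \<Rightarrow> bool" where
  "h_system \<mu>0 \<mu>1 \<epsilon> A C h \<longleftrightarrow>
     fst h \<in> cont_funs (spt \<mu>0) \<and> snd h \<in> cont_funs (spt \<mu>1) \<and>
     (\<forall>x\<in>spt \<mu>0. (\<integral>y. (fst h x + snd h y - 32 * bilin C x y) * rho \<mu>0 \<mu>1 \<epsilon> A x y \<partial>\<mu>1) = 0) \<and>
     (\<forall>y\<in>spt \<mu>1. (\<integral>x. (fst h x + snd h y - 32 * bilin C x y) * rho \<mu>0 \<mu>1 \<epsilon> A x y \<partial>\<mu>0) = 0)"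

text \<open>
  Solutions are unique up to \<open>(h\<^sub>0 + a, h\<^sub>1 - a)\<close>; only \<open>h\<^sub>0(x) + h\<^sub>1(y)\<close> is ever used.
\<close>
definition h_pair ::
  "(real^'m) measure \<Rightarrow> (real^'n) measure \<Rightarrow> real \<Rightarrow> real^'n^'m \<Rightarrow> real^'n^'m
    \<Rightarrow> (real^'m \<Rightarrow> real) \<times> (real^'n \<Rightarrow> real)" where
  "h_pair \<mu>0 \<mu>1 \<epsilon> A C = (SOME h. h_system \<mu>0 \<mu>1 \<epsilon> A C h)"

definition h0 ::
  "(real^'m) measure \<Rightarrow> (real^'n) measure \<Rightarrow> real \<Rightarrow> real^'n^'m \<Rightarrow> real^'n^'m \<Rightarrow> real^'m \<Rightarrow> real" where
  "h0 \<mu>0 \<mu>1 \<epsilon> A C = fst (h_pair \<mu>0 \<mu>1 \<epsilon> A C)"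

definition h1 ::
  "(real^'m) measure \<Rightarrow> (real^'n) measure \<Rightarrow> real \<Rightarrow> real^'n^'m \<Rightarrow> real^'n^'m \<Rightarrow> real^'n \<Rightarrow> real" where
  "h1 \<mu>0 \<mu>1 \<epsilon> A C = snd (h_pair \<mu>0 \<mu>1 \<epsilon> A C)"

definition D1 :: "('a::real_normed_vector \<Rightarrow> real) \<Rightarrow> 'a \<Rightarrow> 'a \<Rightarrow>\<^sub>L real" where
  "D1 f A = Blinfun (frechet_derivative f (at A))"

definition D2 :: "('a::real_normed_vector \<Rightarrow> real) \<Rightarrow> 'a \<Rightarrow> 'a \<Rightarrow> 'a \<Rightarrow> real" where
  "D2 f A B C = blinfun_apply (frechet_derivative (D1 f) (at A) B) C"

definition unit_mat :: "'m \<times> 'n \<Rightarrow> real^'n^'m" where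
  "unit_mat p = axis (fst p) (axis (snd p) 1)"

text \<open>The basis \<^const>\<open>unit_mat\<close> is orthonormal for the Frobenius inner product.\<close>
definition form_matrix ::
  "(real^'n^'m \<Rightarrow> real^'n^'m \<Rightarrow> real) \<Rightarrow> real^('m \<times> 'n)^('m \<times> 'n)" where
  "form_matrix Q = (\<chi> p q. Q (unit_mat p) (unit_mat q))"

definition eigenvalues :: "real^'k^'k \<Rightarrow> real set" where
  "eigenvalues H = {l. \<exists>v. v \<noteq> 0 \<and> H *v v = l *\<^sub>R v}"

definition lambda_min :: "(real^'n^'m \<Rightarrow> real^'n^'m \<Rightarrow> real) \<Rightarrow> real" where
  "lambda_min Q = Min (eigenvalues (form_matrix Q))"

definition lambda_max :: "(real^'n^'m \<Rightarrow> real^'n^'m \<Rightarrow> real) \<Rightarrow> real" where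
  "lambda_max Q = Max (eigenvalues (form_matrix Q))"

end

(*
With q the density of an optimal plan, f |-> (integral of f q) averages functions on one marginal to
functions on the other. On compact supports q(x, y) >= d q(x', y) for some d > 0, so this averaging
shrinks the oscillation sup f - inf f by the factor 1 - d, and so does f |-> ln (integral of exp f q).
This one estimate replaces the implicit function theorem: it gives existence of the EOT potentials and
of the functions h as fixed points, Lipschitz dependence of the density on A, and, inserting the linear
system into the nonlinear one, a density expansion in A with a quadratic remainder. Writing
k_C(x, y) = h0(x) + h1(y) - 32 x.Cy, which is orthogonal in L2(pi_A) to all sums u0(x) + u1(y), the
result is D^2 Phi(B, C) = 64 <B, C> - (1/eps) int k_B k_C dpi_A. Orthogonality turns int k_C^2 into
int (32^2 (x.Cy)^2 - (h0 + h1)^2), and bounds it by the squared L2-distance of 32 x.Cy to constants.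
*)
theory Submission
  imports Defs
begin

text \<open>Potentials and h-functions are determined only up to moving a constant from one function
  to the other. Oscillations do not see this freedom, so all contraction is measured in that
  seminorm; the constant left open by a fixed point is then forced by integrating over both
  variables in the two orders, and the sum u0(x) + u1(y), which alone enters the density, is
  controlled in sup norm at the end. The first derivative of OT comes from a sandwich: the plan for
  one matrix tests the problem for the other, which encloses the increment up to 32 C.(M(A + C) -
  M(A)), M(A) being the mean of x y^T under pi_A; this is quadratically small once M is Lipschitz at
  A. The second derivative is then that of M. The obstacle there is that h0 and h1 are chosen
  separately for every C, so linearity of C |-> k_C is not visible; orthogonality gives int k_B k_C
  dpi_A = -32 int (x.By) k_C dpi_A, which is linear in B, and symmetry transfers this to C.\<close>

section \<open>Bounded Borel functions and the support\<close>

text \<open>Measurability is global but boundedness local to \<open>S\<close>: a potential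
  continuous on the whole space may be unbounded off \<open>S\<close>, and a probability measure
  carried by \<open>S\<close> still integrates it. The extensional functions of
  \<open>cont_funs\<close> belong to this class too.\<close>

definition bounded_borel :: "'a::topological_space set \<Rightarrow> ('a \<Rightarrow> real) \<Rightarrow> bool" where
  "bounded_borel S f \<longleftrightarrow> f \<in> borel_measurable borel \<and> (\<exists>B. \<forall>x\<in>S. \<bar>f x\<bar> \<le> B)"

lemma bounded_borelI:
  "f \<in> borel_measurable borel \<Longrightarrow> (\<And>x. x \<in> S \<Longrightarrow> \<bar>f x\<bar> \<le> B) \<Longrightarrow> bounded_borel S f"
  unfolding bounded_borel_def by blast

lemma bounded_borel_measurable: "bounded_borel S f \<Longrightarrow> f \<in> borel_measurable borel"
  unfolding bounded_borel_def by blast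

lemma bounded_borel_bound:
  assumes "bounded_borel S f"
  obtains B where "0 \<le> B" "\<And>x. x \<in> S \<Longrightarrow> \<bar>f x\<bar> \<le> B"
proof -
  obtain B where "\<forall>x\<in>S. \<bar>f x\<bar> \<le> B"
    using assms unfolding bounded_borel_def by blast
  then show thesis by (intro that[of "\<bar>B\<bar>"]) force+
qed

lemma bounded_borel_const [intro, simp]: "bounded_borel S (\<lambda>x. c)"
  unfolding bounded_borel_def by auto

lemma bounded_borel_continuous:
  assumes "compact S" "continuous_on UNIV f"
  shows "bounded_borel S f"
proof -
  have "compact (f ` S)"
    using assms by (meson compact_continuous_image continuous_on_subset top_greatest)
  then obtain B where "\<And>x. x \<in> f ` S \<Longrightarrow> norm x \<le> B"
    using compact_imp_bounded bounded_iff by metis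
  then show ?thesis
    using assms(2) by (intro bounded_borelI[of _ _ B] borel_measurable_continuous_onI) auto
qed

text \<open>An extensional function is the constant \<open>undefined\<close> off \<open>S\<close>,
  and compact \<open>S\<close> is closed, hence Borel; gluing a continuous function on
  \<open>S\<close> to a constant keeps it Borel.\<close>

lemma bounded_borel_cont_funs:
  fixes S :: "'a::t2_space set"
  assumes "compact S" "f \<in> cont_funs S"
  shows "bounded_borel S f"
proof -
  have c: "continuous_on S f" and e: "f \<in> extensional S"
    using assms(2) by (auto simp: cont_funs_def)
  have "(\<lambda>x. if x \<in> S then f x else undefined) \<in> borel_measurable borel"
    using assms(1) c by (intro borel_measurable_continuous_on_if) (auto intro: borel_closed compact_imp_closed)
  also have "(\<lambda>x. if x \<in> S then f x else undefined) = f"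
    using e by (auto simp: extensional_def)
  finally have m: "f \<in> borel_measurable borel" .
  obtain B where "\<And>x. x \<in> f ` S \<Longrightarrow> norm x \<le> B"
    using compact_continuous_image[OF c assms(1)] compact_imp_bounded bounded_iff by metis
  then show ?thesis
    using m by (intro bounded_borelI[of _ _ B]) auto
qed

lemma bounded_borel_add [intro]:
  assumes "bounded_borel S f" "bounded_borel S g"
  shows "bounded_borel S (\<lambda>x. f x + g x)"
proof -
  obtain B where B: "\<And>x. x \<in> S \<Longrightarrow> \<bar>f x\<bar> \<le> B" using assms(1) by (elim bounded_borel_bound) blast
  obtain B' where B': "\<And>x. x \<in> S \<Longrightarrow> \<bar>g x\<bar> \<le> B'" using assms(2) by (elim bounded_borel_bound) blast
  have "\<bar>f x + g x\<bar> \<le> B + B'" if "x \<in> S" for x using B[OF that] B'[OF that] by linarith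
  then show ?thesis
    using assms by (intro bounded_borelI[of _ _ "B + B'"]) (auto simp: bounded_borel_def)
qed

lemma bounded_borel_mult [intro]:
  assumes "bounded_borel S f" "bounded_borel S g"
  shows "bounded_borel S (\<lambda>x. f x * g x)"
proof -
  obtain B where B: "\<And>x. x \<in> S \<Longrightarrow> \<bar>f x\<bar> \<le> B" using assms(1) by (elim bounded_borel_bound) blast
  obtain B' where B': "0 \<le> B'" "\<And>x. x \<in> S \<Longrightarrow> \<bar>g x\<bar> \<le> B'" using assms(2) by (elim bounded_borel_bound) blast
  have "\<bar>f x * g x\<bar> \<le> B * B'" if "x \<in> S" for x
    unfolding abs_mult using B[OF that] B'(2)[OF that] by (intro mult_mono) auto
  then show ?thesis
    using assms by (intro bounded_borelI[of _ _ "B * B'"]) (auto simp: bounded_borel_def)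
qed

lemma bounded_borel_minus [intro]: "bounded_borel S f \<Longrightarrow> bounded_borel S (\<lambda>x. - f x)"
  using bounded_borel_mult[of S "\<lambda>x. - 1" f] by simp

lemma bounded_borel_diff [intro]:
  "bounded_borel S f \<Longrightarrow> bounded_borel S g \<Longrightarrow> bounded_borel S (\<lambda>x. f x - g x)"
  using bounded_borel_add[of S f "\<lambda>x. - g x"] by auto

lemma bounded_borel_divide [intro]: "bounded_borel S f \<Longrightarrow> bounded_borel S (\<lambda>x. f x / c)"
  using bounded_borel_mult[of S f "\<lambda>x. inverse c"] by (simp add: divide_inverse)

lemma bounded_borel_exp [intro]:
  assumes "bounded_borel S f" shows "bounded_borel S (\<lambda>x. exp (f x))"
proof -
  obtain B where B: "\<And>x. x \<in> S \<Longrightarrow> \<bar>f x\<bar> \<le> B" using assms(1) by (elim bounded_borel_bound) blast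
  have "\<bar>exp (f x)\<bar> \<le> exp B" if "x \<in> S" for x using B[OF that] by simp
  then show ?thesis
    using assms by (intro bounded_borelI[of _ _ "exp B"]) (auto simp: bounded_borel_def)
qed

lemma bounded_borel_power2 [intro]: "bounded_borel S f \<Longrightarrow> bounded_borel S (\<lambda>x. (f x)\<^sup>2)"
  unfolding power2_eq_square by blast

lemmas bounded_borel_intros = bounded_borel_const bounded_borel_add bounded_borel_mult
  bounded_borel_minus bounded_borel_diff bounded_borel_divide bounded_borel_exp bounded_borel_power2

lemma bounded_borel_fst:
  fixes f :: "'a::euclidean_space \<Rightarrow> real" and T :: "'b::euclidean_space set"
  assumes "bounded_borel S f" shows "bounded_borel (S \<times> T) (\<lambda>z. f (fst z))"
proof -
  have "(\<lambda>z::'a \<times> 'b. f (fst z)) \<in> borel_measurable (borel \<Otimes>\<^sub>M borel)"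
    using bounded_borel_measurable[OF assms] by measurable
  then show ?thesis
    using assms unfolding bounded_borel_def borel_prod by auto
qed

lemma bounded_borel_snd:
  fixes f :: "'b::euclidean_space \<Rightarrow> real" and S :: "'a::euclidean_space set"
  assumes "bounded_borel T f" shows "bounded_borel (S \<times> T) (\<lambda>z. f (snd z))"
proof -
  have "(\<lambda>z::'a \<times> 'b. f (snd z)) \<in> borel_measurable (borel \<Otimes>\<^sub>M borel)"
    using bounded_borel_measurable[OF assms] by measurable
  then show ?thesis
    using assms unfolding bounded_borel_def borel_prod by auto
qed

lemma continuous_on_slices:
  assumes "continuous_on UNIV (\<lambda>(x, y). K x y)"
  shows "continuous_on UNIV (\<lambda>x. K x y)" "continuous_on UNIV (\<lambda>y. K x y)"
proof -
  have "continuous_on UNIV (\<lambda>x. case (x, y) of (x, y) \<Rightarrow> K x y)"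
    by (rule continuous_on_compose2[OF assms]) (auto intro!: continuous_intros)
  then show "continuous_on UNIV (\<lambda>x. K x y)" by simp
  have "continuous_on UNIV (\<lambda>y. case (x, y) of (x, y) \<Rightarrow> K x y)"
    by (rule continuous_on_compose2[OF assms]) (auto intro!: continuous_intros)
  then show "continuous_on UNIV (\<lambda>y. K x y)" by simp
qed

text \<open>A point off the support has a null basic open neighbourhood, and a countable basis has
  only countably many of these, so their union is null.\<close>

lemma AE_spt:
  fixes M :: "'a::second_countable_topology measure"
  assumes "sets M = sets borel"
  shows "AE x in M. x \<in> spt M"
proof -
  obtain B :: "'a set set" where B: "countable B" "topological_basis B"
    using ex_countable_basis by blast
  define N where "N = {U \<in> B. emeasure M U = 0}"
  have "(\<Union>U\<in>N. U) \<in> null_sets M"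
  proof (rule null_sets_UN')
    show "countable N" using B(1) by (simp add: N_def)
    show "U \<in> null_sets M" if "U \<in> N" for U
      using that topological_basis_open[OF B(2), of U] assms by (auto simp: N_def null_sets_def)
  qed
  moreover have "- spt M \<subseteq> (\<Union>U\<in>N. U)"
  proof
    fix x assume "x \<in> - spt M"
    then obtain U where U: "open U" "x \<in> U" "emeasure M U = 0"
      by (auto simp: spt_def zero_less_iff_neq_zero)
    obtain V where V: "V \<in> B" "x \<in> V" "V \<subseteq> U"
      using topological_basisE[OF B(2) U(1,2)] by blast
    have "emeasure M V \<le> emeasure M U"
      using V(3) U(1) assms by (intro emeasure_mono) auto
    then show "x \<in> (\<Union>U\<in>N. U)" using V U(3) by (auto simp: N_def)
  qed
  ultimately show ?thesis
    by (intro AE_I'[of "\<Union>U\<in>N. U"]) auto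
qed

text \<open>\<open>S\<close> is any compact set of full measure, not necessarily the support. A
  coupling is thus carried by the product of the two marginal carriers, whatever its own support
  is.\<close>

locale carried = prob_space M
  for M :: "'a::euclidean_space measure" and S :: "'a set" +
  assumes sets_eq: "sets M = sets borel"
    and compact_carrier: "compact S"
    and AE_carrier: "AE x in M. x \<in> S"
begin

lemma measurable_eq: "borel_measurable M = borel_measurable borel"
  using sets_eq by (rule measurable_cong_sets) simp

lemma nonempty: "S \<noteq> {}"
  using AE_carrier AE_False by auto

lemma integrableI: "bounded_borel S f \<Longrightarrow> integrable M f"
proof -
  assume f: "bounded_borel S f"
  then obtain B where "\<And>x. x \<in> S \<Longrightarrow> \<bar>f x\<bar> \<le> B" by (elim bounded_borel_bound) blast
  then have "AE x in M. norm (f x) \<le> B" using AE_carrier by auto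
  then show ?thesis
    using f by (intro integrable_const_bound) (auto simp: measurable_eq bounded_borel_def)
qed

lemma integral_cong_carrier:
  assumes "\<And>x. x \<in> S \<Longrightarrow> f x = g x" "f \<in> borel_measurable borel" "g \<in> borel_measurable borel"
  shows "(\<integral>x. f x \<partial>M) = (\<integral>x. g x \<partial>M :: real)"
  using assms AE_carrier by (intro integral_cong_AE) (auto simp: measurable_eq)

lemma integral_mono_carrier:
  assumes "\<And>x. x \<in> S \<Longrightarrow> f x \<le> g x" "bounded_borel S f" "bounded_borel S g"
  shows "(\<integral>x. f x \<partial>M) \<le> (\<integral>x. g x \<partial>M)"
  using assms AE_carrier by (intro integral_mono_AE integrableI) auto

lemma integral_abs_le:
  fixes f :: "'a \<Rightarrow> real"
  assumes "\<And>x. x \<in> S \<Longrightarrow> \<bar>f x\<bar> \<le> B" "f \<in> borel_measurable borel"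
  shows "\<bar>\<integral>x. f x \<partial>M\<bar> \<le> B"
proof -
  have f: "bounded_borel S f" using assms by (intro bounded_borelI)
  have "(\<integral>x. f x \<partial>M) \<le> (\<integral>x. B \<partial>M)"
    using assms f by (intro integral_mono_carrier) force+
  moreover have "(\<integral>x. - B \<partial>M) \<le> (\<integral>x. f x \<partial>M)"
    using assms f by (intro integral_mono_carrier) force+
  ultimately show ?thesis by (simp add: prob_space)
qed

lemma integral_pos_carrier:
  assumes "bounded_borel S f" "0 < m" "\<And>x. x \<in> S \<Longrightarrow> m \<le> f x"
  shows "0 < (\<integral>x. f x \<partial>M)"
proof -
  have "(\<integral>x. m \<partial>M) \<le> (\<integral>x. f x \<partial>M)"
    using assms by (intro integral_mono_carrier) auto
  then show ?thesis using assms(2) by (simp add: prob_space)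
qed

text \<open>A convergent sequence stays in some ball, the kernel is bounded on \<open>S\<close>
  times that ball, and dominated convergence applies. Integration against a continuous kernel thus
  turns a merely bounded Borel \<open>f\<close> into a function continuous on the whole
  space.\<close>

lemma continuous_integral:
  fixes K :: "'a \<Rightarrow> 'b::euclidean_space \<Rightarrow> real"
  assumes f: "bounded_borel S f" and K: "continuous_on UNIV (\<lambda>(x, y). K x y)"
  shows "continuous_on UNIV (\<lambda>y. \<integral>x. f x * K x y \<partial>M)"
  unfolding continuous_on_sequentially
proof (intro allI ballI impI, elim conjE)
  fix y :: "nat \<Rightarrow> 'b" and y0 assume y: "y \<longlonglongrightarrow> y0"
  note Kx = continuous_on_slices(1)[OF K] and Ky = continuous_on_slices(2)[OF K]
  obtain R where R: "\<And>n. norm (y n) \<le> R"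
    using y by (meson Bseq_def convergentI convergent_imp_Bseq)
  obtain B where B: "0 \<le> B" "\<And>x. x \<in> S \<Longrightarrow> \<bar>f x\<bar> \<le> B"
    using f by (elim bounded_borel_bound) blast
  have "bounded_borel (S \<times> cball 0 R) (\<lambda>(x, y). K x y)"
    using compact_carrier K by (intro bounded_borel_continuous compact_Times) auto
  then obtain L where L: "\<And>z. z \<in> S \<times> cball 0 R \<Longrightarrow> \<bar>case z of (x, y) \<Rightarrow> K x y\<bar> \<le> L"
    by (elim bounded_borel_bound) blast
  have "(\<lambda>n. \<integral>x. f x * K x (y n) \<partial>M) \<longlonglongrightarrow> (\<integral>x. f x * K x y0 \<partial>M)"
  proof (rule integral_dominated_convergence[where w = "\<lambda>_. B * L"])
    show "AE x in M. (\<lambda>n. f x * K x (y n)) \<longlonglongrightarrow> f x * K x y0"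
      using Ky y by (intro AE_I2 tendsto_mult_left) (auto simp: continuous_on_sequentially comp_def)
    show "AE x in M. norm (f x * K x (y n)) \<le> B * L" for n
      using AE_carrier
    proof eventually_elim
      fix x assume x: "x \<in> S"
      have "\<bar>K x (y n)\<bar> \<le> L" using L[of "(x, y n)"] R[of n] x by auto
      then show "norm (f x * K x (y n)) \<le> B * L"
        using B(2)[OF x] B(1) by (auto simp: abs_mult intro!: mult_mono)
    qed
    show "(\<lambda>x. f x * K x y0) \<in> borel_measurable M" "(\<lambda>x. f x * K x (y n)) \<in> borel_measurable M" for n
      unfolding measurable_eq
      by (intro borel_measurable_times bounded_borel_measurable[OF f] borel_measurable_continuous_onI[OF Kx])+
  qed simp
  then show "((\<lambda>y. \<integral>x. f x * K x y \<partial>M) \<circ> y) \<longlonglongrightarrow> (\<integral>x. f x * K x y0 \<partial>M)"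
    by (simp add: comp_def)
qed

end

section \<open>Oscillation and averaging\<close>

text \<open>A seminorm bound that ignores additive constants. Stating it as a relation with
  \<open>r\<close>, instead of through a supremum, spares boundedness conditions when estimates are
  chained.\<close>

definition osc_le :: "'a set \<Rightarrow> ('a \<Rightarrow> real) \<Rightarrow> real \<Rightarrow> bool" where
  "osc_le S u r \<longleftrightarrow> (\<forall>x\<in>S. \<forall>x'\<in>S. u x - u x' \<le> r)"

lemma osc_leI: "(\<And>x x'. x \<in> S \<Longrightarrow> x' \<in> S \<Longrightarrow> u x - u x' \<le> r) \<Longrightarrow> osc_le S u r"
  by (auto simp: osc_le_def)

lemma osc_leD: "osc_le S u r \<Longrightarrow> x \<in> S \<Longrightarrow> x' \<in> S \<Longrightarrow> u x - u x' \<le> r"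
  by (auto simp: osc_le_def)

lemma osc_le_abs: "osc_le S u r \<Longrightarrow> x \<in> S \<Longrightarrow> x' \<in> S \<Longrightarrow> \<bar>u x - u x'\<bar> \<le> r"
  using osc_leD[of S u r x x'] osc_leD[of S u r x' x] by linarith

lemma osc_le_nonneg: "osc_le S u r \<Longrightarrow> S \<noteq> {} \<Longrightarrow> 0 \<le> r"
  unfolding osc_le_def by force

lemma osc_le_lower_bound:
  assumes "osc_le S u r" "S \<noteq> {}"
  obtains a where "\<And>x. x \<in> S \<Longrightarrow> a \<le> u x" "\<And>x. x \<in> S \<Longrightarrow> u x \<le> a + r"
proof
  obtain x0 where x0: "x0 \<in> S" using assms(2) by blast
  have bdd: "bdd_below (u ` S)"
    by (intro bdd_belowI2[of _ "u x0 - r"]) (use osc_leD[OF assms(1) x0] in force)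
  show "(INF x\<in>S. u x) \<le> u x" if "x \<in> S" for x
    using bdd that by (rule cINF_lower)
  show "u x \<le> (INF x\<in>S. u x) + r" if "x \<in> S" for x
  proof -
    have "u x - r \<le> (INF x\<in>S. u x)"
      using assms(2) by (intro cINF_greatest) (use osc_leD[OF assms(1) that] in force)+
    then show ?thesis by simp
  qed
qed

context carried
begin

text \<open>Minorisation of Doeblin type: split \<open>q'\<close> into \<open>\<delta> * q\<close>
  and the nonnegative rest \<open>q' - \<delta> * q\<close>, which has mass
  \<open>1 - \<delta>\<close>, and use \<open>a \<le> u\<close> on the rest.\<close>

lemma average_lower:
  assumes q: "bounded_borel S q" "(\<integral>x. q x \<partial>M) = 1"
    and q': "bounded_borel S q'" "(\<integral>x. q' x \<partial>M) = 1"
    and \<delta>: "\<And>x. x \<in> S \<Longrightarrow> \<delta> * q x \<le> q' x"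
    and u: "bounded_borel S u" "\<And>x. x \<in> S \<Longrightarrow> a \<le> u x"
  shows "\<delta> * (\<integral>x. u x * q x \<partial>M) + (1 - \<delta>) * a \<le> (\<integral>x. u x * q' x \<partial>M)"
proof -
  have "(\<integral>x. \<delta> * (u x * q x) + a * (q' x - \<delta> * q x) \<partial>M) \<le> (\<integral>x. u x * q' x \<partial>M)"
  proof (rule integral_mono_carrier)
    fix x assume x: "x \<in> S"
    have "a * (q' x - \<delta> * q x) \<le> u x * (q' x - \<delta> * q x)"
      using u(2)[OF x] \<delta>[OF x] by (intro mult_right_mono) auto
    then show "\<delta> * (u x * q x) + a * (q' x - \<delta> * q x) \<le> u x * q' x"
      by (simp add: algebra_simps)
  qed (use q q' u in \<open>auto intro!: bounded_borel_add bounded_borel_mult bounded_borel_diff\<close>)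
  also have "(\<integral>x. \<delta> * (u x * q x) + a * (q' x - \<delta> * q x) \<partial>M)
      = \<delta> * (\<integral>x. u x * q x \<partial>M) + a * (1 - \<delta>)"
    using integrableI[OF q(1)] integrableI[OF q'(1)] integrableI[OF bounded_borel_mult[OF u(1) q(1)]]
    by (simp add: q q')
  finally show ?thesis by (simp add: mult.commute)
qed

lemma average_upper:
  assumes q: "bounded_borel S q" "(\<integral>x. q x \<partial>M) = 1" "\<And>x. x \<in> S \<Longrightarrow> 0 \<le> q x"
    and u: "bounded_borel S u" "\<And>x. x \<in> S \<Longrightarrow> u x \<le> b"
  shows "(\<integral>x. u x * q x \<partial>M) \<le> b"
proof -
  have "(\<integral>x. u x * q x \<partial>M) \<le> (\<integral>x. b * q x \<partial>M)"
    using assms by (intro integral_mono_carrier bounded_borel_mult mult_right_mono) auto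
  then show ?thesis using q(2) by simp
qed

text \<open>The common part \<open>\<delta> * q\<close> cancels from the two averages; only mass
  \<open>1 - \<delta>\<close> contributes to their difference, and there \<open>u\<close> varies by
  at most \<open>r\<close>.\<close>

lemma average_contraction:
  assumes q: "bounded_borel S q" "(\<integral>x. q x \<partial>M) = 1" "\<And>x. x \<in> S \<Longrightarrow> 0 \<le> q x"
    and q': "bounded_borel S q'" "(\<integral>x. q' x \<partial>M) = 1"
    and \<delta>: "\<And>x. x \<in> S \<Longrightarrow> \<delta> * q x \<le> q' x" "\<delta> \<le> 1"
    and u: "bounded_borel S u" "osc_le S u r"
  shows "(\<integral>x. u x * q x \<partial>M) - (\<integral>x. u x * q' x \<partial>M) \<le> (1 - \<delta>) * r"
proof -
  obtain a where a: "\<And>x. x \<in> S \<Longrightarrow> a \<le> u x" "\<And>x. x \<in> S \<Longrightarrow> u x \<le> a + r"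
    using osc_le_lower_bound[OF u(2) nonempty] by blast
  have "(1 - \<delta>) * (\<integral>x. u x * q x \<partial>M) \<le> (1 - \<delta>) * (a + r)"
    using average_upper[OF q u(1) a(2)] \<delta>(2) by (intro mult_left_mono) auto
  then show ?thesis
    using average_lower[OF q(1,2) q' \<delta>(1) u(1) a(1)] by (simp add: algebra_simps)
qed


end

text \<open>Minorisation for \<open>exp u\<close> gives
  \<open>I' \<ge> (1 - \<delta>) * exp a + \<delta> * I\<close>. Convexity of \<open>exp\<close>
  bounds this below by \<open>exp ((1 - \<delta>) * a + \<delta> * ln I)\<close>, so logarithmic
  averages obey the same estimate as ordinary ones.\<close>

lemma (in carried) ln_average_contraction:
  assumes q: "bounded_borel S q" "(\<integral>x. q x \<partial>M) = 1" "\<And>x. x \<in> S \<Longrightarrow> 0 \<le> q x"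
    and q': "bounded_borel S q'" "(\<integral>x. q' x \<partial>M) = 1"
    and \<delta>: "\<And>x. x \<in> S \<Longrightarrow> \<delta> * q x \<le> q' x" "0 \<le> \<delta>" "\<delta> \<le> 1"
    and u: "bounded_borel S u" "osc_le S u r"
  shows "ln (\<integral>x. exp (u x) * q x \<partial>M) - ln (\<integral>x. exp (u x) * q' x \<partial>M) \<le> (1 - \<delta>) * r"
proof -
  obtain a where a: "\<And>x. x \<in> S \<Longrightarrow> a \<le> u x" "\<And>x. x \<in> S \<Longrightarrow> u x \<le> a + r"
    using osc_le_lower_bound[OF u(2) nonempty] by blast
  define I where "I = (\<integral>x. exp (u x) * q x \<partial>M)"
  define I' where "I' = (\<integral>x. exp (u x) * q' x \<partial>M)"
  note eu = bounded_borel_exp[OF u(1)]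
  have ea: "exp a \<le> exp (u x)" if "x \<in> S" for x using a(1)[OF that] by simp
  \<comment> \<open>Minorisation with \<open>q' = q\<close> and \<delta> = 0 is the monotonicity of
    a single average; the unsimplified form is the one that \<open>average_lower\<close>
    produces.\<close>
  have "0 * I + (1 - 0) * exp a \<le> I"
    unfolding I_def using q by (intro average_lower[OF q(1,2) q(1,2) _ eu ea]) auto
  then have I: "exp a \<le> I" by simp
  then have I0: "0 < I" using exp_gt_zero[of a] by linarith
  have "exp (u x) \<le> exp (a + r)" if "x \<in> S" for x using a(2)[OF that] by simp
  then have "I \<le> exp (a + r)"
    unfolding I_def by (intro average_upper[OF q eu])
  then have lnI: "ln I \<le> a + r" using I0 by (metis exp_gt_zero ln_exp ln_le_cancel_iff)
  have "exp ((1 - \<delta>) *\<^sub>R a + \<delta> *\<^sub>R ln I) \<le> (1 - \<delta>) * exp a + \<delta> * exp (ln I)"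
    using \<delta> by (intro convex_onD[OF exp_convex]) auto
  also have "\<dots> \<le> I'"
    unfolding I'_def using average_lower[OF q(1,2) q' \<delta>(1) eu ea] I0 by (simp add: I_def)
  finally have *: "exp ((1 - \<delta>) * a + \<delta> * ln I) \<le> I'" by simp
  then have "0 < I'" using exp_gt_zero less_le_trans by blast
  with * have "(1 - \<delta>) * a + \<delta> * ln I \<le> ln I'" by (metis exp_gt_zero ln_exp ln_le_cancel_iff)
  moreover have "(1 - \<delta>) * ln I \<le> (1 - \<delta>) * (a + r)"
    using lnI \<delta> by (intro mult_left_mono) auto
  ultimately show ?thesis
    unfolding I_def[symmetric] I'_def[symmetric] by (simp add: algebra_simps)
qed

text \<open>Tilting by \<open>g\<close> reduces this to averages: with \<open>q y\<close> the
  probability density proportional to \<open>exp g * K\<close>, the difference of logarithms is the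
  logarithm of the \<open>q y\<close>-average of \<open>exp (f - g)\<close>. The densities for
  \<open>y\<close> and \<open>y'\<close> are comparable with constant \<open>(m / L)^2\<close>: one
  factor \<open>m / L\<close> compares the kernels, the other the normalisers
  \<open>Z\<close>.\<close>

lemma (in carried) ln_integral_kernel_contraction:
  assumes K: "\<And>y. y \<in> T \<Longrightarrow> bounded_borel S (\<lambda>x. K x y)"
    and m: "0 < m" "\<And>x y. x \<in> S \<Longrightarrow> y \<in> T \<Longrightarrow> m \<le> K x y" "\<And>x y. x \<in> S \<Longrightarrow> y \<in> T \<Longrightarrow> K x y \<le> L"
    and f: "bounded_borel S f" and g: "bounded_borel S g"
    and r: "osc_le S (\<lambda>x. f x - g x) r"
  shows "osc_le T (\<lambda>y. ln (\<integral>x. exp (f x) * K x y \<partial>M) - ln (\<integral>x. exp (g x) * K x y \<partial>M)) ((1 - (m / L)\<^sup>2) * r)"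
proof (rule osc_leI)
  fix y y' assume y: "y \<in> T" "y' \<in> T"
  obtain x0 where x0: "x0 \<in> S" using nonempty by blast
  have mL: "m \<le> L" "0 < L" using m(2,3)[OF x0 y(1)] m(1) by linarith+
  define Z where "Z h y = (\<integral>x. exp (h x) * K x y \<partial>M)" for h y
  have bb: "bounded_borel S (\<lambda>x. exp (h x) * K x y)" if "bounded_borel S h" "y \<in> T" for h y
    by (intro bounded_borel_intros that K)
  have Zpos: "0 < Z h y" if h: "bounded_borel S h" and "y \<in> T" for h y
  proof -
    obtain B where B: "\<And>x. x \<in> S \<Longrightarrow> \<bar>h x\<bar> \<le> B" using h by (elim bounded_borel_bound) blast
    have "exp (- B) * m \<le> exp (h x) * K x y" if "x \<in> S" for x
      using B[OF that] m(1) m(2)[of x y] that \<open>y \<in> T\<close> by (intro mult_mono) (auto simp: abs_le_iff)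
    then show ?thesis
      unfolding Z_def using m(1) by (intro integral_pos_carrier[of _ "exp (- B) * m"] bb that) auto
  qed
  define q where "q y x = exp (g x) * K x y / Z g y" for y x
  have q: "bounded_borel S (q y)" "(\<integral>x. q y x \<partial>M) = 1" "\<And>x. x \<in> S \<Longrightarrow> 0 \<le> q y x"
    if "y \<in> T" for y
  proof -
    show "bounded_borel S (q y)" unfolding q_def by (intro bounded_borel_divide bb[OF g that])
    show "(\<integral>x. q y x \<partial>M) = 1"
      using Zpos[OF g that] unfolding q_def Z_def by simp
    show "0 \<le> q y x" if "x \<in> S" for x
      using Zpos[OF g \<open>y \<in> T\<close>] m(1) m(2)[OF that \<open>y \<in> T\<close>] by (auto simp: q_def)
  qed
  have ratio: "m / L * K x y \<le> K x y'" if "x \<in> S" "y \<in> T" "y' \<in> T" for x y y'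
  proof -
    have "m / L * K x y \<le> m / L * L"
      using m(1) mL m(3)[OF that(1,2)] by (intro mult_left_mono) auto
    also have "\<dots> \<le> K x y'" using m(2)[OF that(1,3)] mL by simp
    finally show ?thesis .
  qed
  have Zratio: "m / L * Z g y' \<le> Z g y" if "y \<in> T" "y' \<in> T" for y y'
  proof -
    have "(\<integral>x. m / L * (exp (g x) * K x y') \<partial>M) \<le> Z g y"
      unfolding Z_def
    proof (rule integral_mono_carrier)
      show "m / L * (exp (g x) * K x y') \<le> exp (g x) * K x y" if "x \<in> S" for x
        using mult_left_mono[OF ratio[OF that \<open>y' \<in> T\<close> \<open>y \<in> T\<close>], of "exp (g x)"] by (simp add: mult.left_commute)
    qed (intro bounded_borel_mult bounded_borel_const bounded_borel_exp bb g K that)+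
    then show ?thesis by (simp add: Z_def)
  qed
  have \<delta>: "(m / L)\<^sup>2 * q y x \<le> q y' x" if "x \<in> S" for x
  proof -
    have "(m / L)\<^sup>2 * K x y * Z g y' = (m / L * K x y) * (m / L * Z g y')"
      by (simp add: power2_eq_square)
    also have "\<dots> \<le> K x y' * Z g y"
      using ratio[OF that y] Zratio[OF y] m(1) m(2)[OF that y(2)] mL Zpos[OF g y(2)]
      by (intro mult_mono) auto
    finally have "exp (g x) * ((m / L)\<^sup>2 * K x y * Z g y') / (Z g y * Z g y')
        \<le> exp (g x) * (K x y' * Z g y) / (Z g y * Z g y')"
      using Zpos[OF g y(1)] Zpos[OF g y(2)] by (intro divide_right_mono mult_left_mono) auto
    then show ?thesis
      using Zpos[OF g y(1)] Zpos[OF g y(2)] by (simp add: q_def mult.commute mult.left_commute)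
  qed
  have eq: "ln (Z f y) - ln (Z g y) = ln (\<integral>x. exp (f x - g x) * q y x \<partial>M)" if "y \<in> T" for y
  proof -
    have "exp (f x - g x) * q y x = exp (f x) * K x y / Z g y" for x
      by (simp add: q_def exp_diff)
    then have "(\<integral>x. exp (f x - g x) * q y x \<partial>M) = Z f y / Z g y"
      by (simp add: Z_def)
    then show ?thesis using Zpos[OF f that] Zpos[OF g that] by (simp add: ln_div)
  qed
  have "0 \<le> (m / L)\<^sup>2" "(m / L)\<^sup>2 \<le> 1" using m(1) mL by (auto simp: power_le_one)
  then have "ln (\<integral>x. exp (f x - g x) * q y x \<partial>M) - ln (\<integral>x. exp (f x - g x) * q y' x \<partial>M) \<le> (1 - (m / L)\<^sup>2) * r"
    by (intro ln_average_contraction[OF q[OF y(1)] q(1,2)[OF y(2)] \<delta>] bounded_borel_diff f g r)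
  then show "ln (\<integral>x. exp (f x) * K x y \<partial>M) - ln (\<integral>x. exp (g x) * K x y \<partial>M)
      - (ln (\<integral>x. exp (f x) * K x y' \<partial>M) - ln (\<integral>x. exp (g x) * K x y' \<partial>M)) \<le> (1 - (m / L)\<^sup>2) * r"
    using eq[OF y(1)] eq[OF y(2)] by (simp add: Z_def)
qed

text \<open>Banach iteration in a seminorm that vanishes on constants, whence the free constant
  \<open>c\<close>. Subtracting the value at \<open>x0\<close> turns the iterates into partial sums
  of a geometrically dominated series, whose uniform limit is continuous.\<close>

lemma osc_fixpoint:
  fixes F :: "('a::metric_space \<Rightarrow> real) \<Rightarrow> 'a \<Rightarrow> real"
  assumes S: "compact S" "S \<noteq> {}" and \<kappa>: "0 \<le> \<kappa>" "\<kappa> < 1"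
    and F: "\<And>f. f \<in> cont_funs S \<Longrightarrow> F f \<in> cont_funs S"
    and contr: "\<And>f g r. f \<in> cont_funs S \<Longrightarrow> g \<in> cont_funs S \<Longrightarrow>
      osc_le S (\<lambda>x. f x - g x) r \<Longrightarrow> osc_le S (\<lambda>x. F f x - F g x) (\<kappa> * r)"
  obtains f c where "f \<in> cont_funs S" "\<And>x. x \<in> S \<Longrightarrow> F f x = f x + c"
proof -
  obtain x0 where x0: "x0 \<in> S" using S(2) by blast
  define h where "h n = (F ^^ n) (restrict (\<lambda>x. 0) S)" for n
  have hS: "h n \<in> cont_funs S" for n
  proof (induction n)
    case 0
    show ?case by (auto simp: h_def cont_funs_def restrict_def extensional_def cong: continuous_on_cong)
  qed (simp add: h_def F)
  obtain B where B: "\<And>x. x \<in> S \<Longrightarrow> \<bar>h 1 x - h 0 x\<bar> \<le> B"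
  proof -
    have "bounded_borel S (\<lambda>x. h 1 x - h 0 x)"
      using bounded_borel_cont_funs[OF S(1) hS] by blast
    then show thesis using that by (elim bounded_borel_bound) blast
  qed
  have step: "osc_le S (\<lambda>x. h (Suc n) x - h n x) (\<kappa> ^ n * (2 * B))" for n
  proof (induction n)
    case 0
    have "h 1 x - h 0 x - (h 1 x' - h 0 x') \<le> 2 * B" if "x \<in> S" "x' \<in> S" for x x'
      using B[OF that(1)] B[OF that(2)] by linarith
    then show ?case by (auto intro!: osc_leI)
  next
    case (Suc n)
    show ?case
      using contr[OF hS hS Suc] by (simp add: h_def mult.assoc)
  qed
  define d where "d n x = (h (Suc n) x - h n x) - (h (Suc n) x0 - h n x0)" for n x
  have "uniform_limit S (\<lambda>n x. \<Sum>i<n. d i x) (\<lambda>x. \<Sum>i. d i x) sequentially"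
  proof (rule Weierstrass_m_test)
    show "norm (d n x) \<le> \<kappa> ^ n * (2 * B)" if "x \<in> S" for n x
      using osc_le_abs[OF step that x0, of n] by (simp add: d_def)
    show "summable (\<lambda>n. \<kappa> ^ n * (2 * B))"
      using \<kappa> by (intro summable_mult2 summable_geometric) auto
  qed
  moreover have sum_d: "(\<Sum>i<n. d i x) = (h n x - h n x0) - (h 0 x - h 0 x0)" for n x
    by (induction n) (auto simp: d_def)
  ultimately have lim: "uniform_limit S (\<lambda>n x. (h n x - h n x0) - (h 0 x - h 0 x0)) (\<lambda>x. \<Sum>i. d i x) sequentially"
    by simp
  \<comment> \<open>The sums telescope from \<open>h 0\<close>, so its normalised value is added
    back; on \<open>S\<close>, \<open>g\<close> is the uniform limit of
    \<open>h n x - h n x0\<close>.\<close>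
  define g where "g = restrict (\<lambda>x. (\<Sum>i. d i x) + (h 0 x - h 0 x0)) S"
  have "continuous_on S (\<lambda>x. \<Sum>i. d i x)"
    using hS by (intro uniform_limit_theorem[OF _ lim] always_eventually)
      (auto simp: cont_funs_def intro!: continuous_intros)
  then have g: "g \<in> cont_funs S"
    using hS[of 0] unfolding g_def cont_funs_def
    by (auto intro!: continuous_intros)
  have close: "eventually (\<lambda>n. osc_le S (\<lambda>x. g x - h n x) e) sequentially" if "0 < e" for e
    using uniform_limitD[OF lim, of "e / 2"] that
  proof (auto elim!: eventually_mono intro!: osc_leI)
    fix n x x'
    assume "\<forall>x\<in>S. dist (h n x - h n x0 - (h 0 x - h 0 x0)) (\<Sum>i. d i x) * 2 < e"
    moreover assume x: "x \<in> S" "x' \<in> S"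
    ultimately have "\<bar>(h n x - h n x0 - (h 0 x - h 0 x0)) - (\<Sum>i. d i x)\<bar> * 2 < e"
      "\<bar>(h n x' - h n x0 - (h 0 x' - h 0 x0)) - (\<Sum>i. d i x')\<bar> * 2 < e"
      by (auto simp: dist_real_def)
    then have "(\<Sum>i. d i x) - (h n x - h n x0 - (h 0 x - h 0 x0)) \<le> e / 2"
      "(h n x' - h n x0 - (h 0 x' - h 0 x0)) - (\<Sum>i. d i x') \<le> e / 2"
      by (simp_all add: abs_if split: if_splits)
    with x show "g x - h n x - (g x' - h n x') \<le> e"
      unfolding g_def by simp
  qed
  have fix0: "F g x - g x = F g x0 - g x0" if x: "x \<in> S" for x
  proof -
    have "\<bar>(F g x - g x) - (F g x0 - g x0)\<bar> \<le> e" if e: "0 < e" for e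
    proof -
      \<comment> \<open>Both \<open>g\<close> and, by contraction, \<open>F g\<close> are compared
        with the same iterate \<open>h (Suc n) = F (h n)\<close>, so \<open>g\<close> has to be
        close to two consecutive iterates.\<close>
      have "eventually (\<lambda>n. osc_le S (\<lambda>x. g x - h n x) (e / 2) \<and> osc_le S (\<lambda>x. g x - h (Suc n) x) (e / 2)) sequentially"
        using close[of "e / 2"] e by (auto intro: eventually_conj simp: eventually_sequentially_Suc[of "\<lambda>n. osc_le S (\<lambda>x. g x - h n x) (e / 2)"])
      then obtain n where n: "osc_le S (\<lambda>x. g x - h n x) (e / 2)" "osc_le S (\<lambda>x. g x - h (Suc n) x) (e / 2)"
        by (auto dest: eventually_happens)
      have "osc_le S (\<lambda>x. F g x - F (h n) x) (\<kappa> * (e / 2))"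
        by (rule contr[OF g hS n(1)])
      then have "\<bar>(F g x - h (Suc n) x) - (F g x0 - h (Suc n) x0)\<bar> \<le> \<kappa> * (e / 2)"
        using osc_le_abs[OF _ x x0, of "\<lambda>x. F g x - F (h n) x" "\<kappa> * (e / 2)"] by (simp add: h_def)
      moreover have "\<kappa> * (e / 2) \<le> 1 * (e / 2)" using \<kappa> e by (intro mult_right_mono) auto
      ultimately show ?thesis
        using osc_le_abs[OF n(2) x x0] by linarith
    qed
    then have "\<bar>(F g x - g x) - (F g x0 - g x0)\<bar> \<le> 0" by (rule field_le_epsilon[where y = 0, simplified])
    then show ?thesis by simp
  qed
  show thesis
    using fix0 by (intro that[OF g, of "F g x0 - g x0"]) (metis add.commute diff_add_cancel)
qed

section \<open>Schroedinger systems\<close>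

locale marginals = M0: carried \<mu>0 S0 + M1: carried \<mu>1 S1
  for \<mu>0 :: "'a::euclidean_space measure" and S0 :: "'a set"
    and \<mu>1 :: "'b::euclidean_space measure" and S1 :: "'b set"

sublocale marginals \<subseteq> pair_prob_space \<mu>0 \<mu>1 ..

section \<open>Couplings: carriers and densities on the product\<close>

lemma (in marginals) carried_couplings:
  assumes "\<pi> \<in> couplings \<mu>0 \<mu>1"
  shows "carried \<pi> (S0 \<times> S1)"
proof -
  have p: "prob_space \<pi>" "sets \<pi> = sets borel" "distr \<pi> borel fst = \<mu>0" "distr \<pi> borel snd = \<mu>1"
    using assms by (auto simp: couplings_def borel_prob_def)
  have [measurable_cong]: "sets \<pi> = sets (borel \<Otimes>\<^sub>M borel)"
    by (subst borel_prod) (rule p(2))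
  have f: "fst \<in> measurable \<pi> borel" and s: "snd \<in> measurable \<pi> borel"
    by measurable
  have S: "S0 \<in> sets borel" "S1 \<in> sets borel"
    using M0.compact_carrier M1.compact_carrier by (auto simp: borel_compact)
  have "AE z in \<pi>. fst z \<in> S0"
    using M0.AE_carrier AE_distr_iff[OF f, of "\<lambda>x. x \<in> S0"] S unfolding p(3) by simp
  moreover have "AE z in \<pi>. snd z \<in> S1"
    using M1.AE_carrier AE_distr_iff[OF s, of "\<lambda>x. x \<in> S1"] S unfolding p(4) by simp
  ultimately have "AE z in \<pi>. z \<in> S0 \<times> S1"
    by eventually_elim (auto simp: mem_Times_iff)
  then show ?thesis
    using p M0.compact_carrier M1.compact_carrier
    by (intro carried.intro carried_axioms.intro compact_Times) auto
qed

lemma (in marginals) sets_pair: "sets (\<mu>0 \<Otimes>\<^sub>M \<mu>1) = sets borel"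
  using sets_pair_measure_cong[OF M0.sets_eq M1.sets_eq] unfolding borel_prod .

lemma (in marginals) density_coupling:
  fixes \<rho> :: "'a \<times> 'b \<Rightarrow> ennreal"
  assumes \<rho>: "\<rho> \<in> borel_measurable borel"
    and 1: "\<And>x. (\<integral>\<^sup>+y. \<rho> (x, y) \<partial>\<mu>1) = 1" and 0: "\<And>y. (\<integral>\<^sup>+x. \<rho> (x, y) \<partial>\<mu>0) = 1"
  shows "density (\<mu>0 \<Otimes>\<^sub>M \<mu>1) \<rho> \<in> couplings \<mu>0 \<mu>1"
proof -
  let ?\<pi> = "density (\<mu>0 \<Otimes>\<^sub>M \<mu>1) \<rho>"
  have \<rho>' [measurable]: "\<rho> \<in> borel_measurable (\<mu>0 \<Otimes>\<^sub>M \<mu>1)"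
    using \<rho> sets_pair by (simp cong: measurable_cong_sets)
  have [measurable]: "fst \<in> measurable (\<mu>0 \<Otimes>\<^sub>M \<mu>1) borel" "snd \<in> measurable (\<mu>0 \<Otimes>\<^sub>M \<mu>1) borel"
    using M0.sets_eq M1.sets_eq measurable_fst[of \<mu>0 \<mu>1] measurable_snd[of \<mu>0 \<mu>1]
    by (simp_all cong: measurable_cong_sets)
  have m: "fst \<in> measurable ?\<pi> borel" "snd \<in> measurable ?\<pi> borel"
    by simp_all
  have fst: "distr ?\<pi> borel fst = \<mu>0"
  proof (rule measure_eqI)
    fix A assume "A \<in> sets (distr ?\<pi> borel fst)"
    then have A: "A \<in> sets borel" by simp
    then have A': "A \<in> sets \<mu>0" by (simp add: M0.sets_eq)
    have "emeasure (distr ?\<pi> borel fst) A = emeasure ?\<pi> (fst -` A \<inter> space (\<mu>0 \<Otimes>\<^sub>M \<mu>1))"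
      using emeasure_distr[OF m(1) A] by simp
    also have "\<dots> = (\<integral>\<^sup>+z. \<rho> z * indicator (fst -` A \<inter> space (\<mu>0 \<Otimes>\<^sub>M \<mu>1)) z \<partial>(\<mu>0 \<Otimes>\<^sub>M \<mu>1))"
      using measurable_sets[OF m(1) A] by (intro emeasure_density \<rho>') simp
    also have "\<dots> = (\<integral>\<^sup>+z. \<rho> z * indicator A (fst z) \<partial>(\<mu>0 \<Otimes>\<^sub>M \<mu>1))"
      by (intro nn_integral_cong) (auto split: split_indicator)
    also have "\<dots> = (\<integral>\<^sup>+x. \<integral>\<^sup>+y. \<rho> (x, y) * indicator A x \<partial>\<mu>1 \<partial>\<mu>0)"
      using A' by (subst M1.nn_integral_fst[symmetric]) (auto simp: split_beta')
    also have "\<dots> = (\<integral>\<^sup>+x. indicator A x \<partial>\<mu>0)"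
      by (intro nn_integral_cong) (simp add: nn_integral_multc 1)
    finally show "emeasure (distr ?\<pi> borel fst) A = emeasure \<mu>0 A" using A' by simp
  qed (simp add: M0.sets_eq)
  have snd: "distr ?\<pi> borel snd = \<mu>1"
  proof (rule measure_eqI)
    fix A assume "A \<in> sets (distr ?\<pi> borel snd)"
    then have A: "A \<in> sets borel" by simp
    then have A': "A \<in> sets \<mu>1" by (simp add: M1.sets_eq)
    then have [measurable]: "A \<in> sets \<mu>1" by (simp add: M1.sets_eq)
    have "emeasure (distr ?\<pi> borel snd) A = emeasure ?\<pi> (snd -` A \<inter> space (\<mu>0 \<Otimes>\<^sub>M \<mu>1))"
      using emeasure_distr[OF m(2) A] by simp
    also have "\<dots> = (\<integral>\<^sup>+z. \<rho> z * indicator (snd -` A \<inter> space (\<mu>0 \<Otimes>\<^sub>M \<mu>1)) z \<partial>(\<mu>0 \<Otimes>\<^sub>M \<mu>1))"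
      using measurable_sets[OF m(2) A] by (intro emeasure_density \<rho>') simp
    also have "\<dots> = (\<integral>\<^sup>+z. \<rho> z * indicator A (snd z) \<partial>(\<mu>0 \<Otimes>\<^sub>M \<mu>1))"
      by (intro nn_integral_cong) (auto split: split_indicator)
    also have "\<dots> = (\<integral>\<^sup>+y. \<integral>\<^sup>+x. \<rho> (x, y) * indicator A y \<partial>\<mu>0 \<partial>\<mu>1)"
      using A' by (subst nn_integral_snd[symmetric]) (auto simp: split_beta')
    also have "\<dots> = (\<integral>\<^sup>+x. indicator A x \<partial>\<mu>1)"
      by (intro nn_integral_cong) (simp add: nn_integral_multc 0)
    finally show "emeasure (distr ?\<pi> borel snd) A = emeasure \<mu>1 A" using A' by simp
  qed (simp add: M1.sets_eq)
  have "emeasure (distr ?\<pi> borel fst) UNIV = 1"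
    unfolding fst using M0.emeasure_space_1 sets_eq_imp_space_eq[OF M0.sets_eq] by simp
  then have "emeasure ?\<pi> (space ?\<pi>) = 1"
    using emeasure_distr[OF m(1), of UNIV] by simp
  then show ?thesis
    using fst snd sets_pair by (auto simp: couplings_def borel_prob_def intro!: prob_spaceI)
qed

lemma (in marginals) product_coupling: "\<mu>0 \<Otimes>\<^sub>M \<mu>1 \<in> couplings \<mu>0 \<mu>1"
  using density_coupling[of "\<lambda>_. 1"] M0.emeasure_space_1 M1.emeasure_space_1 by (simp add: density_1)

sublocale marginals \<subseteq> P: carried "\<mu>0 \<Otimes>\<^sub>M \<mu>1" "S0 \<times> S1"
  by (rule carried_couplings[OF product_coupling])

context marginals
begin

lemma iterated_integrals:
  assumes "bounded_borel (S0 \<times> S1) (\<lambda>(x, y). f x y)"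
  shows "(\<integral>x. \<integral>y. f x y \<partial>\<mu>1 \<partial>\<mu>0) = (\<integral>(x, y). f x y \<partial>(\<mu>0 \<Otimes>\<^sub>M \<mu>1))"
    and "(\<integral>y. \<integral>x. f x y \<partial>\<mu>0 \<partial>\<mu>1) = (\<integral>(x, y). f x y \<partial>(\<mu>0 \<Otimes>\<^sub>M \<mu>1))"
    and "(\<lambda>x. \<integral>y. f x y \<partial>\<mu>1) \<in> borel_measurable borel"
    and "(\<lambda>y. \<integral>x. f x y \<partial>\<mu>0) \<in> borel_measurable borel"
proof -
  have i: "integrable (\<mu>0 \<Otimes>\<^sub>M \<mu>1) (\<lambda>(x, y). f x y)" by (rule P.integrableI[OF assms])
  show "(\<integral>x. \<integral>y. f x y \<partial>\<mu>1 \<partial>\<mu>0) = (\<integral>(x, y). f x y \<partial>(\<mu>0 \<Otimes>\<^sub>M \<mu>1))"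
    "(\<integral>y. \<integral>x. f x y \<partial>\<mu>0 \<partial>\<mu>1) = (\<integral>(x, y). f x y \<partial>(\<mu>0 \<Otimes>\<^sub>M \<mu>1))"
    using integral_fst'[OF i] integral_snd[OF i] by simp_all
  have m: "(\<lambda>(x, y). f x y) \<in> borel_measurable (\<mu>0 \<Otimes>\<^sub>M \<mu>1)"
    by (rule borel_measurable_integrable[OF i])
  show "(\<lambda>x. \<integral>y. f x y \<partial>\<mu>1) \<in> borel_measurable borel"
    using M1.borel_measurable_lebesgue_integral[OF m] by (simp add: M0.measurable_eq)
  have "(\<lambda>(y, x). f x y) \<in> borel_measurable (\<mu>1 \<Otimes>\<^sub>M \<mu>0)"
    using measurable_pair_swap[OF m] by (simp add: case_prod_beta)
  then show "(\<lambda>y. \<integral>x. f x y \<partial>\<mu>0) \<in> borel_measurable borel"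
    using M0.borel_measurable_lebesgue_integral[of "\<lambda>y x. f x y" \<mu>1] by (simp add: M1.measurable_eq)
qed

lemma kernel_bounds:
  fixes K :: "'a \<Rightarrow> 'b \<Rightarrow> real"
  assumes "continuous_on UNIV (\<lambda>(x, y). K x y)" "\<And>x y. 0 < K x y"
  obtains m L where "0 < m" "m \<le> L"
    "\<And>x y. x \<in> S0 \<Longrightarrow> y \<in> S1 \<Longrightarrow> m \<le> K x y" "\<And>x y. x \<in> S0 \<Longrightarrow> y \<in> S1 \<Longrightarrow> K x y \<le> L"
proof -
  have c: "continuous_on (S0 \<times> S1) (\<lambda>(x, y). K x y)"
    using assms(1) by (rule continuous_on_subset) simp
  have n: "S0 \<times> S1 \<noteq> {}" using P.nonempty .
  obtain z where z: "z \<in> S0 \<times> S1" "\<forall>w\<in>S0 \<times> S1. (case z of (x, y) \<Rightarrow> K x y) \<le> (case w of (x, y) \<Rightarrow> K x y)"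
    using continuous_attains_inf[OF P.compact_carrier n c] by blast
  obtain z' where z': "z' \<in> S0 \<times> S1" "\<forall>w\<in>S0 \<times> S1. (case w of (x, y) \<Rightarrow> K x y) \<le> (case z' of (x, y) \<Rightarrow> K x y)"
    using continuous_attains_sup[OF P.compact_carrier n c] by blast
  show thesis
    by (rule that[of "case z of (x, y) \<Rightarrow> K x y" "case z' of (x, y) \<Rightarrow> K x y"])
      (use z z' assms(2) in \<open>auto split: prod.splits\<close>)
qed

lemma continuous_flip:
  "continuous_on UNIV (\<lambda>(x, y). K x y) \<Longrightarrow> continuous_on UNIV (\<lambda>(y, x). K x y)"
proof -
  assume K: "continuous_on UNIV (\<lambda>(x, y). K x y)"
  have "continuous_on UNIV (\<lambda>z. case prod.swap z of (x, y) \<Rightarrow> K x y)"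
    by (rule continuous_on_compose2[OF K]) (auto intro!: continuous_on_swap)
  then show ?thesis by (simp add: case_prod_beta)
qed

text \<open>Alternating normalisation (Sinkhorn iteration): \<open>T0\<close> solves the second
  equation for \<open>g\<close> given \<open>f\<close>, \<open>T1\<close> the first for
  \<open>f\<close> given \<open>g\<close>, and each shrinks oscillations by \<open>\<kappa>\<close>.
  The fixed point lives on \<open>S0\<close> and is exact only up to a constant; one more
  application of \<open>T1\<close> extends it continuously to the whole space.\<close>

lemma schroedinger_exists:
  fixes K :: "'a \<Rightarrow> 'b \<Rightarrow> real"
  assumes K: "continuous_on UNIV (\<lambda>(x, y). K x y)" and Kpos: "\<And>x y. 0 < K x y"
  obtains f g where "continuous_on UNIV f" "continuous_on UNIV g"
    "\<And>x. (\<integral>y. exp (f x + g y) * K x y \<partial>\<mu>1) = 1"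
    "\<And>y. (\<integral>x. exp (f x + g y) * K x y \<partial>\<mu>0) = 1"
proof -
  note K' = continuous_flip[OF K]
  have bK0: "bounded_borel S0 (\<lambda>x. K x y)" for y
    using bounded_borel_continuous[OF M0.compact_carrier continuous_on_slices(1)[OF K]] .
  have bK1: "bounded_borel S1 (\<lambda>y. K x y)" for x
    using bounded_borel_continuous[OF M1.compact_carrier continuous_on_slices(2)[OF K]] .
  obtain m L where m: "0 < m" "m \<le> L" "\<And>x y. x \<in> S0 \<Longrightarrow> y \<in> S1 \<Longrightarrow> m \<le> K x y"
      "\<And>x y. x \<in> S0 \<Longrightarrow> y \<in> S1 \<Longrightarrow> K x y \<le> L"
    using kernel_bounds[OF K Kpos] by blast
  define \<kappa> where "\<kappa> = 1 - (m / L)\<^sup>2"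
  have \<kappa>: "0 \<le> \<kappa>" "\<kappa> < 1" using m(1,2) by (auto simp: \<kappa>_def power_le_one)
  define T0 where "T0 f y = - ln (\<integral>x. exp (f x) * K x y \<partial>\<mu>0)" for f y
  define T1 where "T1 g x = - ln (\<integral>y. exp (g y) * K x y \<partial>\<mu>1)" for g x
  have pos0: "0 < (\<integral>x. exp (f x) * K x y \<partial>\<mu>0)" if f: "bounded_borel S0 f" for f y
  proof -
    have b: "bounded_borel S0 (\<lambda>x. exp (f x) * K x y)" by (intro bounded_borel_intros f bK0)
    have "(\<integral>x. exp (f x) * K x y \<partial>\<mu>0) \<noteq> 0"
    proof
      assume "(\<integral>x. exp (f x) * K x y \<partial>\<mu>0) = 0"
      then have "AE x in \<mu>0. exp (f x) * K x y = 0"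
        using integral_nonneg_eq_0_iff_AE[OF M0.integrableI[OF b]] Kpos by (simp add: less_imp_le)
      then have "AE x in \<mu>0. False"
        using Kpos by (auto simp: less_le) 
      then show False using M0.AE_False by blast
    qed
    moreover have "0 \<le> (\<integral>x. exp (f x) * K x y \<partial>\<mu>0)"
      using Kpos by (intro integral_nonneg_AE AE_I2) (auto intro: less_imp_le)
    ultimately show ?thesis by simp
  qed
  have pos1: "0 < (\<integral>y. exp (g y) * K x y \<partial>\<mu>1)" if g: "bounded_borel S1 g" for g x
  proof -
    have b: "bounded_borel S1 (\<lambda>y. exp (g y) * K x y)" by (intro bounded_borel_intros g bK1)
    have "(\<integral>y. exp (g y) * K x y \<partial>\<mu>1) \<noteq> 0"
    proof
      assume "(\<integral>y. exp (g y) * K x y \<partial>\<mu>1) = 0"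
      then have "AE y in \<mu>1. exp (g y) * K x y = 0"
        using integral_nonneg_eq_0_iff_AE[OF M1.integrableI[OF b]] Kpos by (simp add: less_imp_le)
      then have "AE y in \<mu>1. False"
        using Kpos by (auto simp: less_le)
      then show False using M1.AE_False by blast
    qed
    moreover have "0 \<le> (\<integral>y. exp (g y) * K x y \<partial>\<mu>1)"
      using Kpos by (intro integral_nonneg_AE AE_I2) (auto intro: less_imp_le)
    ultimately show ?thesis by simp
  qed
  have cT0: "continuous_on UNIV (T0 f)" if f: "bounded_borel S0 f" for f
    unfolding T0_def using pos0[OF f] M0.continuous_integral[OF bounded_borel_exp[OF f] K]
    by (intro continuous_on_minus continuous_on_ln) (auto simp: less_le)
  have cT1: "continuous_on UNIV (T1 g)" if g: "bounded_borel S1 g" for g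
    unfolding T1_def using pos1[OF g] M1.continuous_integral[OF bounded_borel_exp[OF g] K']
    by (intro continuous_on_minus continuous_on_ln) (auto simp: less_le)
  have bT0: "bounded_borel S1 (T0 f)" if f: "bounded_borel S0 f" for f
    by (intro bounded_borel_continuous M1.compact_carrier cT0 f)
  have bT1: "bounded_borel S0 (T1 f)" if f: "bounded_borel S1 f" for f
    by (intro bounded_borel_continuous M0.compact_carrier cT1 f)
  have bcf: "bounded_borel S0 f" if "f \<in> cont_funs S0" for f
    using bounded_borel_cont_funs[OF M0.compact_carrier that] .
  define F where "F f = restrict (T1 (T0 f)) S0" for f
  obtain f c where f: "f \<in> cont_funs S0" and c: "\<And>x. x \<in> S0 \<Longrightarrow> F f x = f x + c"
  proof (rule osc_fixpoint[of S0 "\<kappa> * \<kappa>" F, rotated 6])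
    show "compact S0" "S0 \<noteq> {}" by (rule M0.compact_carrier M0.nonempty)+
    show "0 \<le> \<kappa> * \<kappa>" "\<kappa> * \<kappa> < 1"
      using \<kappa> mult_strict_mono[of \<kappa> 1 \<kappa> 1] by auto
    show "F f \<in> cont_funs S0" if "f \<in> cont_funs S0" for f
    proof -
      have "continuous_on S0 (T1 (T0 f))"
        using cT1[OF bT0[OF bcf[OF that]]] by (rule continuous_on_subset) simp
      then show ?thesis by (simp add: F_def cont_funs_def)
    qed
    show "osc_le S0 (\<lambda>x. F f x - F g x) (\<kappa> * \<kappa> * r)"
      if f: "f \<in> cont_funs S0" and g: "g \<in> cont_funs S0" and r: "osc_le S0 (\<lambda>x. f x - g x) r" for f g r
    proof -
      \<comment> \<open>The minus signs in \<open>T0\<close> and \<open>T1\<close> swap the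
        arguments; oscillation bounds are invariant under a change of sign, so the order is restored
        afterwards.\<close>
      have "osc_le S1 (\<lambda>y. T0 g y - T0 f y) (\<kappa> * r)"
        using M0.ln_integral_kernel_contraction[of S1 K m L f g r] bK0 m(1,3,4) bcf f g r
        by (simp add: T0_def \<kappa>_def osc_le_def algebra_simps)
      then have *: "osc_le S1 (\<lambda>y. T0 f y - T0 g y) (\<kappa> * r)"
        by (auto simp: osc_le_def algebra_simps)
      have "osc_le S0 (\<lambda>y. T1 (T0 g) y - T1 (T0 f) y) (\<kappa> * (\<kappa> * r))"
        using M1.ln_integral_kernel_contraction[of S0 "\<lambda>y x. K x y" m L "T0 f" "T0 g" "\<kappa> * r"] bK1 m(1,3,4)
          bT0[OF bcf[OF f]] bT0[OF bcf[OF g]] *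
        by (simp add: T1_def \<kappa>_def osc_le_def algebra_simps)
      then show ?thesis
        by (auto simp: osc_le_def F_def algebra_simps)
    qed
  qed blast+
  define g where "g = T0 f"
  \<comment> \<open>\<open>f'\<close> equals \<open>f + c\<close> on \<open>S0\<close>, is
    continuous everywhere and solves the first equation at every \<open>x\<close>; the second then
    holds up to the factor \<open>exp c\<close>.\<close>
  define f' where "f' = T1 g"
  have bf: "bounded_borel S0 f" and bg: "bounded_borel S1 g" and bf': "bounded_borel S0 f'"
    by (simp_all add: g_def f'_def bcf f bT0 bT1)
  have e1: "(\<integral>y. exp (f' x + g y) * K x y \<partial>\<mu>1) = 1" for x
  proof -
    have "(\<integral>y. exp (f' x + g y) * K x y \<partial>\<mu>1) = exp (f' x) * (\<integral>y. exp (g y) * K x y \<partial>\<mu>1)"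
      by (simp add: exp_add mult.assoc)
    also have "\<dots> = 1"
      using pos1[OF bg, of x] by (simp add: f'_def T1_def exp_minus)
    finally show ?thesis .
  qed
  have e0: "(\<integral>x. exp (f x + g y) * K x y \<partial>\<mu>0) = 1" for y
  proof -
    have "(\<integral>x. exp (f x + g y) * K x y \<partial>\<mu>0) = exp (g y) * (\<integral>x. exp (f x) * K x y \<partial>\<mu>0)"
      by (simp add: exp_add mult.assoc mult.left_commute[of _ "exp (g y)"])
    also have "\<dots> = 1"
      using pos0[OF bf, of y] by (simp add: g_def T0_def exp_minus)
    finally show ?thesis .
  qed
  have e0': "(\<integral>x. exp (f' x + g y) * K x y \<partial>\<mu>0) = exp c" for y
  proof -
    have "(\<integral>x. exp (f' x + g y) * K x y \<partial>\<mu>0) = (\<integral>x. exp c * (exp (f x + g y) * K x y) \<partial>\<mu>0)"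
    proof (rule M0.integral_cong_carrier)
      show "exp (f' x + g y) * K x y = exp c * (exp (f x + g y) * K x y)" if "x \<in> S0" for x
        using c[OF that] that by (simp add: F_def f'_def g_def exp_add)
      show "(\<lambda>x. exp (f' x + g y) * K x y) \<in> borel_measurable borel"
        "(\<lambda>x. exp c * (exp (f x + g y) * K x y)) \<in> borel_measurable borel"
        by (rule bounded_borel_measurable[of S0], intro bounded_borel_intros bf bf' bK0)+
    qed
    then show ?thesis by (simp add: e0)
  qed
  \<comment> \<open>The total mass of the density is 1 when \<open>y\<close> is integrated first and
    \<open>exp c\<close> when \<open>x\<close> is, so \<open>exp c = 1\<close>.\<close>
  have "bounded_borel (S0 \<times> S1) (\<lambda>z. exp (f' (fst z) + g (snd z)) * (case z of (x, y) \<Rightarrow> K x y))"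
    by (intro bounded_borel_intros bounded_borel_fst bounded_borel_snd bf' bg
        bounded_borel_continuous P.compact_carrier K)
  then have "bounded_borel (S0 \<times> S1) (\<lambda>(x, y). exp (f' x + g y) * K x y)"
    by (simp add: case_prod_unfold)
  from iterated_integrals(1,2)[OF this] have "exp c = 1"
    by (simp add: e1 e0' M0.prob_space M1.prob_space)
  with e0' have e0'': "(\<integral>x. exp (f' x + g y) * K x y \<partial>\<mu>0) = 1" for y by simp
  show thesis
    using e1 e0'' cT0[OF bf] cT1[OF bg] by (intro that[of f' g]) (auto simp: f'_def g_def)
qed

end

section \<open>Entropic optimal transport for a continuous cost\<close>

text \<open>The Bregman gap of \<open>t ln t\<close>: after factoring out \<open>d\<close> it is
  \<open>ln t \<le> t - 1\<close> at \<open>t = r / d\<close>, with equality only at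
  \<open>t = 1\<close>. For \<open>d = 0\<close> the gap is \<open>r\<close>.\<close>

lemma mult_ln_diff_ge:
  fixes d r :: real
  assumes "0 \<le> d" "0 < r"
  shows "0 \<le> d * (ln d - ln r) - d + r"
    and "d * (ln d - ln r) - d + r = 0 \<Longrightarrow> d = r"
proof -
  have *: "d * (ln d - ln r) - d + r = d * ((r / d - 1) - ln (r / d))" if "0 < d"
    using that assms by (simp add: ln_div field_simps)
  show "0 \<le> d * (ln d - ln r) - d + r"
    using * assms ln_le_minus_one[of "r / d"] by (cases "d = 0") auto
  show "d = r" if eq: "d * (ln d - ln r) - d + r = 0"
  proof (cases "d = 0")
    case False
    then have "ln (r / d) = r / d - 1" "0 < r / d"
      using * eq assms by auto
    then have "r / d = 1" by (intro ln_eq_minus_one)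
    then show ?thesis using False by simp
  qed (use eq assms in auto)
qed

text \<open>Cost and potentials are parameters, so that the problems for \<open>c\<close> and for
  \<open>c - b\<close> can be two instances of the locale inside one proof.\<close>

locale eot = marginals \<mu>0 S0 \<mu>1 S1
  for \<mu>0 :: "'a::euclidean_space measure" and S0
    and \<mu>1 :: "'b::euclidean_space measure" and S1 +
  fixes \<epsilon> :: real and c :: "'a \<Rightarrow> 'b \<Rightarrow> real" and \<phi>0 :: "'a \<Rightarrow> real" and \<phi>1 :: "'b \<Rightarrow> real"
  assumes eps: "0 < \<epsilon>"
    and cont_c: "continuous_on UNIV (\<lambda>(x, y). c x y)"
    and cont_\<phi>0: "continuous_on UNIV \<phi>0" and cont_\<phi>1: "continuous_on UNIV \<phi>1"
    and schroedinger1: "(\<integral>y. exp ((\<phi>0 x + \<phi>1 y - c x y) / \<epsilon>) \<partial>\<mu>1) = 1"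
    and schroedinger0: "(\<integral>x. exp ((\<phi>0 x + \<phi>1 y - c x y) / \<epsilon>) \<partial>\<mu>0) = 1"
begin

definition \<rho> :: "'a \<Rightarrow> 'b \<Rightarrow> real" where
  "\<rho> x y = exp ((\<phi>0 x + \<phi>1 y - c x y) / \<epsilon>)"

definition \<pi> :: "('a \<times> 'b) measure" where
  "\<pi> = density (\<mu>0 \<Otimes>\<^sub>M \<mu>1) (\<lambda>z. ennreal (\<rho> (fst z) (snd z)))"

text \<open>The dual objective also has a penalty, \<epsilon> times (1 - mass of
  \<open>\<rho>\<close>), which vanishes at these potentials; this number turns out to be the
  optimal value.\<close>

definition dual_value :: real where
  "dual_value = (\<integral>x. \<phi>0 x \<partial>\<mu>0) + (\<integral>y. \<phi>1 y \<partial>\<mu>1)"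

lemma rho_pos: "0 < \<rho> x y"
  by (simp add: \<rho>_def)

lemma ln_rho: "ln (\<rho> x y) = (\<phi>0 x + \<phi>1 y - c x y) / \<epsilon>"
  by (simp add: \<rho>_def)

lemma integral_rho [simp]: "(\<integral>y. \<rho> x y \<partial>\<mu>1) = 1" "(\<integral>x. \<rho> x y \<partial>\<mu>0) = 1"
  using schroedinger1 schroedinger0 by (simp_all add: \<rho>_def)

lemma cont_rho: "continuous_on UNIV (\<lambda>(x, y). \<rho> x y)"
  unfolding \<rho>_def case_prod_unfold using eps cont_c[unfolded case_prod_unfold]
  by (auto intro!: continuous_intros continuous_on_compose2[OF cont_\<phi>0] continuous_on_compose2[OF cont_\<phi>1])

lemma bounded_rho: "bounded_borel (S0 \<times> S1) (\<lambda>z. \<rho> (fst z) (snd z))"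
  using bounded_borel_continuous[OF P.compact_carrier cont_rho] by (simp add: case_prod_unfold)

lemma bounded_c: "bounded_borel (S0 \<times> S1) (\<lambda>z. c (fst z) (snd z))"
  using bounded_borel_continuous[OF P.compact_carrier cont_c] by (simp add: case_prod_unfold)

lemma bounded_\<phi>: "bounded_borel S0 \<phi>0" "bounded_borel S1 \<phi>1"
  using bounded_borel_continuous M0.compact_carrier M1.compact_carrier cont_\<phi>0 cont_\<phi>1 by auto

lemma bounded_rho0: "bounded_borel S0 (\<lambda>x. \<rho> x y)"
  using bounded_borel_continuous[OF M0.compact_carrier continuous_on_slices(1)[OF cont_rho]] .

lemma bounded_rho1: "bounded_borel S1 (\<lambda>y. \<rho> x y)"
  using bounded_borel_continuous[OF M1.compact_carrier continuous_on_slices(2)[OF cont_rho]] .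

lemma measurable_rho: "(\<lambda>z. \<rho> (fst z) (snd z)) \<in> borel_measurable (\<mu>0 \<Otimes>\<^sub>M \<mu>1)"
  using bounded_borel_measurable[OF bounded_rho] by (simp add: P.measurable_eq)

lemma pi_coupling: "\<pi> \<in> couplings \<mu>0 \<mu>1"
  unfolding \<pi>_def
proof (rule density_coupling)
  show "(\<lambda>z. ennreal (\<rho> (fst z) (snd z))) \<in> borel_measurable borel"
    using bounded_borel_measurable[OF bounded_rho] by measurable
  show "(\<integral>\<^sup>+ y. ennreal (\<rho> (fst (x, y)) (snd (x, y))) \<partial>\<mu>1) = 1" for x
    using nn_integral_eq_integral[OF M1.integrableI[OF bounded_rho1[of x]]] rho_pos
    by (simp add: less_imp_le)
  show "(\<integral>\<^sup>+ x. ennreal (\<rho> (fst (x, y)) (snd (x, y))) \<partial>\<mu>0) = 1" for y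
    using nn_integral_eq_integral[OF M0.integrableI[OF bounded_rho0[of y]]] rho_pos
    by (simp add: less_imp_le)
qed

sublocale PI: carried \<pi> "S0 \<times> S1"
  by (rule carried_couplings[OF pi_coupling])

lemma integral_pi:
  fixes f :: "'a \<times> 'b \<Rightarrow> real"
  assumes "bounded_borel (S0 \<times> S1) f"
  shows "(\<integral>z. f z \<partial>\<pi>) = (\<integral>z. f z * \<rho> (fst z) (snd z) \<partial>(\<mu>0 \<Otimes>\<^sub>M \<mu>1))"
  unfolding \<pi>_def
  using assms measurable_rho rho_pos
  by (subst integral_density)
    (auto simp: P.measurable_eq bounded_borel_def less_imp_le mult.commute)

lemma integral_fst_coupling:
  assumes "\<pi>' \<in> couplings \<mu>0 \<mu>1" "f \<in> borel_measurable borel"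
  shows "(\<integral>z. f (fst z) \<partial>\<pi>') = (\<integral>x. f x \<partial>\<mu>0 :: real)"
proof -
  have "\<mu>0 = distr \<pi>' borel fst" and s: "sets \<pi>' = sets (borel \<Otimes>\<^sub>M borel)"
    using assms(1) unfolding borel_prod by (auto simp: couplings_def borel_prob_def)
  moreover have "fst \<in> measurable \<pi>' borel"
    using s by (simp cong: measurable_cong_sets)
  ultimately show ?thesis using assms(2) by (simp add: integral_distr)
qed

lemma integral_snd_coupling:
  assumes "\<pi>' \<in> couplings \<mu>0 \<mu>1" "f \<in> borel_measurable borel"
  shows "(\<integral>z. f (snd z) \<partial>\<pi>') = (\<integral>x. f x \<partial>\<mu>1 :: real)"
proof -
  have "\<mu>1 = distr \<pi>' borel snd" and s: "sets \<pi>' = sets (borel \<Otimes>\<^sub>M borel)"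
    using assms(1) unfolding borel_prod by (auto simp: couplings_def borel_prob_def)
  moreover have "snd \<in> measurable \<pi>' borel"
    using s by (simp cong: measurable_cong_sets)
  ultimately show ?thesis using assms(2) by (simp add: integral_distr)
qed

lemma bounded_ln_rho: "bounded_borel (S0 \<times> S1) (\<lambda>z. ln (\<rho> (fst z) (snd z)))"
  unfolding ln_rho
  by (intro bounded_borel_intros bounded_borel_fst bounded_borel_snd bounded_c bounded_\<phi>)

text \<open>Up to the cost, \<open>ln \<rho>\<close> is a sum of functions of one variable, and
  these have the same integral under every coupling. This makes \<open>dual_value\<close> a bound
  for all of them at once.\<close>

lemma integral_ln_rho:
  assumes "\<pi>' \<in> couplings \<mu>0 \<mu>1"
  shows "(\<integral>z. ln (\<rho> (fst z) (snd z)) \<partial>\<pi>') = (dual_value - (\<integral>z. c (fst z) (snd z) \<partial>\<pi>')) / \<epsilon>"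
proof -
  interpret \<pi>': carried \<pi>' "S0 \<times> S1" by (rule carried_couplings[OF assms])
  note i = \<pi>'.integrableI[OF bounded_borel_fst[OF bounded_\<phi>(1)]]
    \<pi>'.integrableI[OF bounded_borel_snd[OF bounded_\<phi>(2)]] \<pi>'.integrableI[OF bounded_c]
  show ?thesis
    unfolding ln_rho dual_value_def using i assms bounded_\<phi>
    by (simp add: integral_fst_coupling integral_snd_coupling bounded_borel_measurable)
qed

lemma pi_ac: "absolutely_continuous (\<mu>0 \<Otimes>\<^sub>M \<mu>1) \<pi>"
  unfolding \<pi>_def using measurable_rho by (intro absolutely_continuousI_density) auto

lemma entropy_density_AE:
  assumes "D \<in> borel_measurable (\<mu>0 \<Otimes>\<^sub>M \<mu>1)" "\<And>z. 0 \<le> D z"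
    and "density (\<mu>0 \<Otimes>\<^sub>M \<mu>1) (\<lambda>z. ennreal (D z)) = \<pi>'"
  shows "AE z in \<mu>0 \<Otimes>\<^sub>M \<mu>1. entropy_density (exp 1) (\<mu>0 \<Otimes>\<^sub>M \<mu>1) \<pi>' z = ln (D z)"
proof -
  have "AE z in \<mu>0 \<Otimes>\<^sub>M \<mu>1. ennreal (D z) = RN_deriv (\<mu>0 \<Otimes>\<^sub>M \<mu>1) \<pi>' z"
    using assms by (intro P.RN_deriv_unique) auto
  then show ?thesis
    by eventually_elim (use assms(2) in \<open>auto simp: entropy_density_def log_def simp flip: ennreal_eq_0_iff, metis enn2real_ennreal\<close>)
qed

lemma AE_ac:
  assumes "absolutely_continuous (\<mu>0 \<Otimes>\<^sub>M \<mu>1) \<pi>'" "AE z in \<mu>0 \<Otimes>\<^sub>M \<mu>1. Q z"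
    "sets \<pi>' = sets (\<mu>0 \<Otimes>\<^sub>M \<mu>1)"
  shows "AE z in \<pi>'. Q z"
  using absolutely_continuous_AE[OF assms(3,1,2)] .

lemma KL_pi: "KL \<pi> (\<mu>0 \<Otimes>\<^sub>M \<mu>1) = ereal ((dual_value - (\<integral>z. c (fst z) (snd z) \<partial>\<pi>)) / \<epsilon>)"
proof -
  have ae: "AE z in \<pi>. entropy_density (exp 1) (\<mu>0 \<Otimes>\<^sub>M \<mu>1) \<pi> z = ln (\<rho> (fst z) (snd z))"
    by (intro AE_ac[OF pi_ac] entropy_density_AE measurable_rho less_imp_le rho_pos)
      (simp_all add: \<pi>_def)
  have s: "sets \<pi> = sets (\<mu>0 \<Otimes>\<^sub>M \<mu>1)" by (simp add: \<pi>_def)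
  have m: "entropy_density (exp 1) (\<mu>0 \<Otimes>\<^sub>M \<mu>1) \<pi> \<in> borel_measurable \<pi>"
    using s by (auto intro: measurable_entropy_density simp: entropy_density_def comp_def cong: measurable_cong_sets)
  have m': "(\<lambda>z. ln (\<rho> (fst z) (snd z))) \<in> borel_measurable \<pi>"
    using bounded_borel_measurable[OF bounded_ln_rho] by (simp add: PI.measurable_eq)
  have "integrable \<pi> (entropy_density (exp 1) (\<mu>0 \<Otimes>\<^sub>M \<mu>1) \<pi>)"
    using PI.integrableI[OF bounded_ln_rho] integrable_cong_AE[OF m m' ae] by simp
  moreover have "KL_divergence (exp 1) (\<mu>0 \<Otimes>\<^sub>M \<mu>1) \<pi> = (\<integral>z. ln (\<rho> (fst z) (snd z)) \<partial>\<pi>)"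
    unfolding KL_divergence_def by (rule integral_cong_AE[OF m m' ae])
  ultimately show ?thesis
    by (simp add: KL_def pi_ac integral_ln_rho[OF pi_coupling])
qed

text \<open>The objective exceeds \<open>dual_value\<close> by \<epsilon> times the divergence of
  \<open>\<pi>'\<close> from \<open>\<pi>\<close>, which is nonnegative and zero only for
  \<open>\<pi>' = \<pi>\<close>. That divergence appears as the integral of \<open>H\<close> against
  the product measure.\<close>

lemma objective_lower_bound:
  assumes \<pi>': "\<pi>' \<in> couplings \<mu>0 \<mu>1" and k: "KL \<pi>' (\<mu>0 \<Otimes>\<^sub>M \<mu>1) = ereal k"
  shows "dual_value \<le> (\<integral>z. c (fst z) (snd z) \<partial>\<pi>') + \<epsilon> * k"
    and "dual_value = (\<integral>z. c (fst z) (snd z) \<partial>\<pi>') + \<epsilon> * k \<Longrightarrow> \<pi>' = \<pi>"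
proof -
  let ?P = "\<mu>0 \<Otimes>\<^sub>M \<mu>1"
  let ?r = "\<lambda>z. \<rho> (fst z) (snd z)"
  interpret \<pi>': carried \<pi>' "S0 \<times> S1" by (rule carried_couplings[OF \<pi>'])
  have s: "sets \<pi>' = sets ?P"
    using \<pi>' by (simp add: couplings_def borel_prob_def sets_pair)
  have ac: "absolutely_continuous ?P \<pi>'" and ie: "integrable \<pi>' (entropy_density (exp 1) ?P \<pi>')"
    and kd: "k = (\<integral>z. entropy_density (exp 1) ?P \<pi>' z \<partial>\<pi>')"
    using k by (auto simp: KL_def KL_divergence_def split: if_splits)
  obtain D where D: "D \<in> borel_measurable ?P" "AE z in ?P. RN_deriv ?P \<pi>' z = ennreal (D z)" "\<And>z. 0 \<le> D z"
    using P.real_RN_deriv[OF \<pi>'.finite_measure_axioms ac s] by blast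
  have dens: "density ?P (\<lambda>z. ennreal (D z)) = \<pi>'"
  proof -
    have "density ?P (RN_deriv ?P \<pi>') = density ?P (\<lambda>z. ennreal (D z))"
      using D by (intro density_cong) auto
    then show ?thesis using P.density_RN_deriv[OF ac s] by simp
  qed
  have ae: "AE z in \<pi>'. entropy_density (exp 1) ?P \<pi>' z = ln (D z)"
    by (rule AE_ac[OF ac entropy_density_AE[OF D(1,3) dens] s])
  have mD: "D \<in> borel_measurable \<pi>'" using D(1) s by (simp cong: measurable_cong_sets)
  have lD: "integrable \<pi>' (\<lambda>z. ln (D z))" and kD: "k = (\<integral>z. ln (D z) \<partial>\<pi>')"
    using ie ae integrable_cong_AE[OF _ _ ae] integral_cong_AE[OF _ _ ae] mD kd
    by (auto simp: borel_measurable_integrable)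
  have il: "integrable \<pi>' (\<lambda>z. ln (D z) - ln (?r z))"
    using lD \<pi>'.integrableI[OF bounded_ln_rho] by simp
  have gap: "(\<integral>z. ln (D z) - ln (?r z) \<partial>\<pi>') = k - (dual_value - (\<integral>z. c (fst z) (snd z) \<partial>\<pi>')) / \<epsilon>"
    using lD \<pi>'.integrableI[OF bounded_ln_rho] kD by (simp add: integral_ln_rho[OF \<pi>'])
  have ml: "(\<lambda>z. ln (D z) - ln (?r z)) \<in> borel_measurable ?P"
    using D(1) measurable_rho by measurable
  have i1: "integrable ?P (\<lambda>z. D z * (ln (D z) - ln (?r z)))"
    using il D(1,3) ml unfolding dens[symmetric] by (subst (asm) integrable_density) auto
  have e1: "(\<integral>z. D z * (ln (D z) - ln (?r z)) \<partial>?P) = (\<integral>z. ln (D z) - ln (?r z) \<partial>\<pi>')"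
    using D(1,3) ml unfolding dens[symmetric] by (subst integral_density) auto
  have i2: "integrable ?P D"
  proof -
    have "integrable \<pi>' (\<lambda>z. 1::real)" by simp
    then show ?thesis using D(1,3) unfolding dens[symmetric] by (subst (asm) integrable_density) auto
  qed
  have e2: "(\<integral>z. D z \<partial>?P) = 1"
  proof -
    have "(\<integral>z. 1 \<partial>\<pi>') = (1::real)" using \<pi>'.prob_space by simp
    then show ?thesis using D(1,3) unfolding dens[symmetric] by (subst (asm) integral_density) auto
  qed
  have i3: "integrable ?P ?r" by (rule P.integrableI[OF bounded_rho])
  have e3: "(\<integral>z. ?r z \<partial>?P) = 1"
    using integral_pi[of "\<lambda>_. 1"] PI.prob_space by simp
  \<comment> \<open>\<open>D\<close> and \<open>\<rho>\<close> both have mass 1, so the terms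
    \<open>- D + \<rho>\<close> leave the integral unchanged and make the integrand nonnegative
    pointwise.\<close>
  define H where "H z = D z * (ln (D z) - ln (?r z)) - D z + ?r z" for z
  have iH: "integrable ?P H" unfolding H_def using i1 i2 i3 by simp
  have eH: "(\<integral>z. H z \<partial>?P) = k - (dual_value - (\<integral>z. c (fst z) (snd z) \<partial>\<pi>')) / \<epsilon>"
    unfolding H_def using i1 i2 i3 e1 e2 e3 gap by simp
  have H0: "0 \<le> H z" for z
    unfolding H_def by (rule mult_ln_diff_ge(1)[OF D(3) rho_pos])
  then have "0 \<le> (\<integral>z. H z \<partial>?P)" by simp
  then show "dual_value \<le> (\<integral>z. c (fst z) (snd z) \<partial>\<pi>') + \<epsilon> * k"
    using eps by (simp add: eH pos_divide_le_eq mult.commute diff_le_eq add.commute)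
  show "\<pi>' = \<pi>" if "dual_value = (\<integral>z. c (fst z) (snd z) \<partial>\<pi>') + \<epsilon> * k"
  proof -
    have "(\<integral>z. H z \<partial>?P) = 0" using that eps by (simp add: eH)
    then have "AE z in ?P. H z = 0"
      using integral_nonneg_eq_0_iff_AE[OF iH] H0 by simp
    moreover have "D z = ?r z" if "H z = 0" for z
      using that unfolding H_def by (rule mult_ln_diff_ge(2)[OF D(3) rho_pos])
    ultimately have "AE z in ?P. ennreal (D z) = ennreal (?r z)"
      by auto
    then have "density ?P (\<lambda>z. ennreal (D z)) = \<pi>"
      unfolding \<pi>_def using D(1) measurable_rho by (intro density_cong) auto
    then show ?thesis using dens by simp
  qed
qed

end

section \<open>The linearised system and perturbation estimates\<close>

text \<open>The least bound is the oscillation itself; it is used where an estimate of an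
  oscillation has to be fed back into itself.\<close>

lemma least_osc_le:
  assumes "osc_le S u r0" "S \<noteq> {}"
  obtains r where "osc_le S u r" "\<And>r'. osc_le S u r' \<Longrightarrow> r \<le> r'"
proof
  let ?D = "\<lambda>z. u (fst z) - u (snd z)"
  have n: "S \<times> S \<noteq> {}" using assms(2) by auto
  have b: "bdd_above (?D ` (S \<times> S))"
    using assms(1) by (intro bdd_aboveI2[of _ _ r0]) (auto simp: osc_le_def)
  show "osc_le S u (SUP z\<in>S \<times> S. ?D z)"
    using cSUP_upper[OF _ b] by (force intro: osc_leI)
  show "(SUP z\<in>S \<times> S. ?D z) \<le> r'" if "osc_le S u r'" for r'
    using that by (intro cSUP_least n) (auto simp: osc_le_def)
qed

text \<open>\<open>N0\<close> and \<open>N1\<close> stand for (log-exponential) averages of \<open>u0\<close> and \<open>u1\<close>: an approximate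
  solution of the system \<open>u0 = - N1\<close>, \<open>u1 = - N0\<close> is small because averaging contracts oscillations.\<close>

lemma osc_pair_bound:
  fixes u0 N1 :: "'a \<Rightarrow> real" and u1 N0 :: "'b \<Rightarrow> real"
  assumes ne: "S0 \<noteq> {}" "S1 \<noteq> {}"
    and r: "osc_le S0 u0 ra" "osc_le S1 u1 rb"
    and \<delta>: "0 < \<delta>"
    and N1: "\<And>r. osc_le S1 u1 r \<Longrightarrow> osc_le S0 N1 ((1 - \<delta>) * r)"
    and N0: "\<And>r. osc_le S0 u0 r \<Longrightarrow> osc_le S1 N0 ((1 - \<delta>) * r)"
    and close: "\<And>r x y. osc_le S1 u1 r \<Longrightarrow> x \<in> S0 \<Longrightarrow> y \<in> S1 \<Longrightarrow> \<bar>N1 x - u1 y\<bar> \<le> r"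
    and e1: "\<And>x. x \<in> S0 \<Longrightarrow> \<bar>u0 x + N1 x\<bar> \<le> \<beta>"
    and e0: "\<And>y. y \<in> S1 \<Longrightarrow> \<bar>u1 y + N0 y\<bar> \<le> \<beta>"
    and xy: "x \<in> S0" "y \<in> S1"
  shows "\<bar>u0 x + u1 y\<bar> \<le> (1 + 4 / \<delta>) * \<beta>"
proof -
  obtain r0 where r0: "osc_le S0 u0 r0" "\<And>r'. osc_le S0 u0 r' \<Longrightarrow> r0 \<le> r'"
    using least_osc_le[OF r(1) ne(1)] by blast
  obtain r1 where r1: "osc_le S1 u1 r1" "\<And>r'. osc_le S1 u1 r' \<Longrightarrow> r1 \<le> r'"
    using least_osc_le[OF r(2) ne(2)] by blast
  \<comment> \<open>Only for the least bounds does contraction give inequalities between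
    \<open>r0\<close> and \<open>r1\<close> themselves. Each oscillation picks up
    \<open>2 * \<beta>\<close>, so adding the two inequalities produces the 4 in
    \<open>4 / \<delta>\<close>.\<close>
  have "r0 \<le> (1 - \<delta>) * r1 + 2 * \<beta>"
  proof (intro r0(2) osc_leI)
    fix x x' assume "x \<in> S0" "x' \<in> S0"
    then show "u0 x - u0 x' \<le> (1 - \<delta>) * r1 + 2 * \<beta>"
      using e1[of x] e1[of x'] osc_leD[OF N1[OF r1(1)], of x' x] by linarith
  qed
  moreover have "r1 \<le> (1 - \<delta>) * r0 + 2 * \<beta>"
  proof (intro r1(2) osc_leI)
    fix x x' assume "x \<in> S1" "x' \<in> S1"
    then show "u1 x - u1 x' \<le> (1 - \<delta>) * r0 + 2 * \<beta>"
      using e0[of x] e0[of x'] osc_leD[OF N0[OF r0(1)], of x' x] by linarith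
  qed
  ultimately have "\<delta> * (r0 + r1) \<le> 4 * \<beta>" by (simp add: algebra_simps)
  moreover have "0 \<le> r0" using osc_le_nonneg[OF r0(1) ne(1)] .
  then have "\<delta> * r1 \<le> \<delta> * (r0 + r1)" using \<delta> by simp
  ultimately have "r1 \<le> 4 * \<beta> / \<delta>" using \<delta> by (simp add: field_simps)
  then have "\<bar>u0 x + u1 y\<bar> \<le> \<beta> + 4 * \<beta> / \<delta>"
    using e1[OF xy(1)] close[OF r1(1) xy] by linarith
  then show ?thesis by (simp add: algebra_simps)
qed

lemma abs_exp_minus_one_minus_le: "\<bar>exp x - 1 - x\<bar> \<le> x\<^sup>2 * exp \<bar>x\<bar>" for x :: real
proof -
  obtain t where t: "\<bar>t\<bar> \<le> \<bar>x\<bar>" "exp x = (\<Sum>m<2. x ^ m / fact m) + exp t / fact 2 * x ^ 2"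
    using Maclaurin_exp_le[of x 2] by blast
  then have "\<bar>exp x - 1 - x\<bar> = exp t / 2 * x\<^sup>2"
    by (simp add: numeral_2_eq_2 abs_mult)
  also have "\<dots> \<le> exp \<bar>x\<bar> * x\<^sup>2"
  proof (intro mult_right_mono)
    have "exp t \<le> exp \<bar>x\<bar>" using t(1) by simp
    then show "exp t / 2 \<le> exp \<bar>x\<bar>" using exp_gt_zero[of t] by linarith
  qed simp
  finally show ?thesis by (simp add: mult.commute)
qed

lemma bounded_borel_osc:
  assumes "bounded_borel S u"
  obtains r where "osc_le S u r"
proof -
  obtain B where B: "\<And>x. x \<in> S \<Longrightarrow> \<bar>u x\<bar> \<le> B" using assms by (elim bounded_borel_bound) blast
  have "osc_le S u (2 * B)"
  proof (rule osc_leI)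
    fix x x' assume "x \<in> S" "x' \<in> S"
    then show "u x - u x' \<le> 2 * B" using B[of x] B[of x'] by linarith
  qed
  then show thesis by (rule that)
qed

lemma (in carried) average_close:
  assumes q: "bounded_borel S q" "(\<integral>x. q x \<partial>M) = 1" "\<And>x. x \<in> S \<Longrightarrow> 0 \<le> q x"
    and u: "bounded_borel S u" "\<And>x. x \<in> S \<Longrightarrow> \<bar>u x - a\<bar> \<le> r"
  shows "\<bar>(\<integral>x. u x * q x \<partial>M) - a\<bar> \<le> r"
proof -
  have l: "a - r \<le> u x" and b: "u x \<le> a + r" if "x \<in> S" for x using u(2)[OF that] by linarith+
  have "a - r \<le> (\<integral>x. u x * q x \<partial>M)"
    using average_lower[OF q(1,2) q(1,2) _ u(1) l, of 0] q(3) by simp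
  moreover have "(\<integral>x. u x * q x \<partial>M) \<le> a + r"
    by (rule average_upper[OF q u(1) b])
  ultimately show ?thesis by linarith
qed

lemma (in carried) ln_average_close:
  assumes q: "bounded_borel S q" "(\<integral>x. q x \<partial>M) = 1" "\<And>x. x \<in> S \<Longrightarrow> 0 \<le> q x"
    and u: "bounded_borel S u" "\<And>x. x \<in> S \<Longrightarrow> \<bar>u x - a\<bar> \<le> r"
  shows "0 < (\<integral>x. exp (u x) * q x \<partial>M)" "\<bar>ln (\<integral>x. exp (u x) * q x \<partial>M) - a\<bar> \<le> r"
proof -
  have l: "exp (a - r) \<le> exp (u x)" and b: "exp (u x) \<le> exp (a + r)" if "x \<in> S" for x
    using u(2)[OF that] by (simp_all add: abs_le_iff)
  note eu = bounded_borel_exp[OF u(1)]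
  have *: "exp (a - r) \<le> (\<integral>x. exp (u x) * q x \<partial>M)"
    using average_lower[OF q(1,2) q(1,2) _ eu l, of 0] q(3) by simp
  then show pos: "0 < (\<integral>x. exp (u x) * q x \<partial>M)"
    using exp_gt_zero less_le_trans by blast
  have "(\<integral>x. exp (u x) * q x \<partial>M) \<le> exp (a + r)"
    by (rule average_upper[OF q eu b])
  then have "ln (\<integral>x. exp (u x) * q x \<partial>M) \<le> a + r"
    using pos by (metis exp_gt_zero ln_exp ln_le_cancel_iff)
  moreover have "a - r \<le> ln (\<integral>x. exp (u x) * q x \<partial>M)"
    using pos * by (metis exp_gt_zero ln_exp ln_le_cancel_iff)
  ultimately show "\<bar>ln (\<integral>x. exp (u x) * q x \<partial>M) - a\<bar> \<le> r" by linarith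
qed

text \<open>Normalising \<open>exp u * q\<close> to a density \<open>p\<close> splits the equation
  into \<open>exp (a + ln Z)\<close> times the \<open>p\<close>-average of \<open>exp d\<close>, and
  the logarithm of that average has absolute value at most \<open>\<beta>\<close>.\<close>

lemma (in carried) ln_average_perturb:
  assumes q: "bounded_borel S q" "(\<integral>x. q x \<partial>M) = 1" "\<And>x. x \<in> S \<Longrightarrow> 0 \<le> q x"
    and u: "bounded_borel S u" and d: "bounded_borel S d" "\<And>x. x \<in> S \<Longrightarrow> \<bar>d x\<bar> \<le> \<beta>"
    and 1: "(\<integral>x. exp (a + u x + d x) * q x \<partial>M) = 1"
  shows "\<bar>a + ln (\<integral>x. exp (u x) * q x \<partial>M)\<bar> \<le> \<beta>"
proof -
  obtain B where B: "\<And>x. x \<in> S \<Longrightarrow> \<bar>u x\<bar> \<le> B" using u by (elim bounded_borel_bound) blast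
  define Z where "Z = (\<integral>x. exp (u x) * q x \<partial>M)"
  have Z: "0 < Z"
    unfolding Z_def using B by (intro ln_average_close(1)[OF q u, of 0 B]) simp_all
  define p where "p x = exp (u x) * q x / Z" for x
  have p: "bounded_borel S p" "(\<integral>x. p x \<partial>M) = 1" "\<And>x. x \<in> S \<Longrightarrow> 0 \<le> p x"
    using Z q(3) unfolding p_def by (auto intro!: bounded_borel_divide bounded_borel_mult bounded_borel_exp u q simp: Z_def[symmetric])
  have "exp (a + u x + d x) * q x = exp (a + ln Z) * (exp (d x) * p x)" for x
    using Z by (simp add: p_def exp_add)
  then have "exp (a + ln Z) * (\<integral>x. exp (d x) * p x \<partial>M) = 1"
    using 1 by simp
  moreover have I: "0 < (\<integral>x. exp (d x) * p x \<partial>M)" "\<bar>ln (\<integral>x. exp (d x) * p x \<partial>M) - 0\<bar> \<le> \<beta>"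
    using d(2) by (intro ln_average_close[OF p d(1), of 0 \<beta>]; simp)+
  ultimately have "ln (exp (a + ln Z) * (\<integral>x. exp (d x) * p x \<partial>M)) = 0" by simp
  then have "a + ln Z + ln (\<integral>x. exp (d x) * p x \<partial>M) = 0"
    using I(1) by (simp add: ln_mult)
  then show ?thesis using I(2) by (simp add: Z_def)
qed

context eot
begin

text \<open>The Schroedinger system linearised for a change of cost from \<open>c\<close> to
  \<open>c - b\<close>, scaled so that the logarithmic density changes to first order by
  \<open>- (g0 + g1 - b) / \<epsilon>\<close>. Equivalently, \<open>g0 + g1\<close> is the L2
  projection of \<open>b\<close> under \<open>\<pi>\<close> onto sums of one-variable
  functions.\<close>

definition lin_system :: "('a \<Rightarrow> 'b \<Rightarrow> real) \<Rightarrow> ('a \<Rightarrow> real) \<Rightarrow> ('b \<Rightarrow> real) \<Rightarrow> bool" where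
  "lin_system b g0 g1 \<longleftrightarrow> g0 \<in> cont_funs S0 \<and> g1 \<in> cont_funs S1 \<and>
     (\<forall>x\<in>S0. (\<integral>y. (g0 x + g1 y - b x y) * \<rho> x y \<partial>\<mu>1) = 0) \<and>
     (\<forall>y\<in>S1. (\<integral>x. (g0 x + g1 y - b x y) * \<rho> x y \<partial>\<mu>0) = 0)"

lemma rho_ratio:
  obtains \<delta> where "0 < \<delta>" "\<delta> \<le> 1"
    "\<And>x x' y. x \<in> S0 \<Longrightarrow> x' \<in> S0 \<Longrightarrow> y \<in> S1 \<Longrightarrow> \<delta> * \<rho> x y \<le> \<rho> x' y"
    "\<And>x y y'. x \<in> S0 \<Longrightarrow> y \<in> S1 \<Longrightarrow> y' \<in> S1 \<Longrightarrow> \<delta> * \<rho> x y \<le> \<rho> x y'"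
proof -
  obtain m L where m: "0 < m" "m \<le> L" "\<And>x y. x \<in> S0 \<Longrightarrow> y \<in> S1 \<Longrightarrow> m \<le> \<rho> x y"
      "\<And>x y. x \<in> S0 \<Longrightarrow> y \<in> S1 \<Longrightarrow> \<rho> x y \<le> L"
    using kernel_bounds[OF cont_rho rho_pos] by blast
  have *: "m / L * \<rho> x y \<le> m" if "x \<in> S0" "y \<in> S1" for x y
  proof -
    have "m / L * \<rho> x y \<le> m / L * L" using m(1,2) m(4)[OF that] by (intro mult_left_mono) auto
    also have "\<dots> = m" using m(1,2) by simp
    finally show ?thesis .
  qed
  show thesis
    using m(1,2) order_trans[OF * m(3)] by (intro that[of "m / L"]) auto
qed

lemma mean_contraction1:
  assumes "\<delta> \<le> 1" "\<And>x x' y. x \<in> S0 \<Longrightarrow> x' \<in> S0 \<Longrightarrow> y \<in> S1 \<Longrightarrow> \<delta> * \<rho> x y \<le> \<rho> x' y"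
    and "bounded_borel S1 u" "osc_le S1 u r"
  shows "osc_le S0 (\<lambda>x. \<integral>y. u y * \<rho> x y \<partial>\<mu>1) ((1 - \<delta>) * r)"
  using assms
  by (intro osc_leI, intro M1.average_contraction bounded_rho1) (auto intro: less_imp_le[OF rho_pos])

lemma mean_contraction0:
  assumes "\<delta> \<le> 1" "\<And>x y y'. x \<in> S0 \<Longrightarrow> y \<in> S1 \<Longrightarrow> y' \<in> S1 \<Longrightarrow> \<delta> * \<rho> x y \<le> \<rho> x y'"
    and "bounded_borel S0 u" "osc_le S0 u r"
  shows "osc_le S1 (\<lambda>y. \<integral>x. u x * \<rho> x y \<partial>\<mu>0) ((1 - \<delta>) * r)"
  using assms
  by (intro osc_leI, intro M0.average_contraction bounded_rho0) (auto intro: less_imp_le[OF rho_pos])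

lemma bounded_slices:
  fixes b :: "'a \<Rightarrow> 'b \<Rightarrow> real"
  assumes "continuous_on UNIV (\<lambda>(x, y). b x y)"
  shows "bounded_borel S0 (\<lambda>x. b x y)" "bounded_borel S1 (\<lambda>y. b x y)"
    "bounded_borel (S0 \<times> S1) (\<lambda>z. b (fst z) (snd z))"
  using bounded_borel_continuous[OF M0.compact_carrier continuous_on_slices(1)[OF assms]]
    bounded_borel_continuous[OF M1.compact_carrier continuous_on_slices(2)[OF assms]]
    bounded_borel_continuous[OF P.compact_carrier assms]
  by (simp_all add: case_prod_unfold)

lemma bounded_pair_sum:
  assumes "bounded_borel S0 u0" "bounded_borel S1 u1"
  shows "bounded_borel (S0 \<times> S1) (\<lambda>z. u0 (fst z) + u1 (snd z))"
  using assms by (intro bounded_borel_add bounded_borel_fst bounded_borel_snd)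

lemma iterated_pi:
  assumes "bounded_borel (S0 \<times> S1) (\<lambda>z. f (fst z) (snd z))"
  shows "(\<integral>z. f (fst z) (snd z) \<partial>\<pi>) = (\<integral>x. \<integral>y. f x y * \<rho> x y \<partial>\<mu>1 \<partial>\<mu>0)"
    and "(\<integral>z. f (fst z) (snd z) \<partial>\<pi>) = (\<integral>y. \<integral>x. f x y * \<rho> x y \<partial>\<mu>0 \<partial>\<mu>1)"
proof -
  have "bounded_borel (S0 \<times> S1) (\<lambda>(x, y). f x y * \<rho> x y)"
    using bounded_borel_mult[OF assms bounded_rho] by (simp add: case_prod_unfold)
  from iterated_integrals(1,2)[OF this]
  show "(\<integral>z. f (fst z) (snd z) \<partial>\<pi>) = (\<integral>x. \<integral>y. f x y * \<rho> x y \<partial>\<mu>1 \<partial>\<mu>0)"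
    "(\<integral>z. f (fst z) (snd z) \<partial>\<pi>) = (\<integral>y. \<integral>x. f x y * \<rho> x y \<partial>\<mu>0 \<partial>\<mu>1)"
    by (simp_all add: integral_pi[OF assms] case_prod_unfold)
qed

text \<open>The alternation of \<open>schroedinger_exists\<close> with averages in place of
  logarithmic averages. Integrating the residual in both orders yields \<open>k = 0\<close>, and
  restricting \<open>T0 f\<close> to \<open>S1\<close> puts it into \<open>cont_funs\<close> without
  changing any integral.\<close>

lemma lin_system_exists:
  fixes b :: "'a \<Rightarrow> 'b \<Rightarrow> real"
  assumes b: "continuous_on UNIV (\<lambda>(x, y). b x y)"
  obtains g0 g1 where "lin_system b g0 g1"
proof -
  obtain \<delta> where \<delta>: "0 < \<delta>" "\<delta> \<le> 1"
    "\<And>x x' y. x \<in> S0 \<Longrightarrow> x' \<in> S0 \<Longrightarrow> y \<in> S1 \<Longrightarrow> \<delta> * \<rho> x y \<le> \<rho> x' y"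
    "\<And>x y y'. x \<in> S0 \<Longrightarrow> y \<in> S1 \<Longrightarrow> y' \<in> S1 \<Longrightarrow> \<delta> * \<rho> x y \<le> \<rho> x y'"
    using rho_ratio by metis
  define \<kappa> where "\<kappa> = 1 - \<delta>"
  have \<kappa>: "0 \<le> \<kappa>" "\<kappa> < 1" using \<delta>(1,2) by (auto simp: \<kappa>_def)
  have cb: "continuous_on UNIV (\<lambda>(x, y). b x y * \<rho> x y)"
    using continuous_on_mult[OF b cont_rho] by (simp add: case_prod_unfold)
  define T0 where "T0 f y = (\<integral>x. b x y * \<rho> x y \<partial>\<mu>0) - (\<integral>x. f x * \<rho> x y \<partial>\<mu>0)" for f y
  define T1 where "T1 g x = (\<integral>y. b x y * \<rho> x y \<partial>\<mu>1) - (\<integral>y. g y * \<rho> x y \<partial>\<mu>1)" for g x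
  have cT0: "continuous_on UNIV (T0 f)" if f: "bounded_borel S0 f" for f
    using M0.continuous_integral[OF bounded_borel_const[of S0 1] cb] M0.continuous_integral[OF f cont_rho]
    unfolding T0_def by (intro continuous_on_diff) simp_all
  have cT1: "continuous_on UNIV (T1 g)" if g: "bounded_borel S1 g" for g
    using M1.continuous_integral[OF bounded_borel_const[of S1 1] continuous_flip[OF cb]]
      M1.continuous_integral[OF g continuous_flip[OF cont_rho]]
    unfolding T1_def by (intro continuous_on_diff) simp_all
  have bT0: "bounded_borel S1 (T0 f)" if f: "bounded_borel S0 f" for f
    by (intro bounded_borel_continuous M1.compact_carrier cT0 f)
  have bT1: "bounded_borel S0 (T1 f)" if f: "bounded_borel S1 f" for f
    by (intro bounded_borel_continuous M0.compact_carrier cT1 f)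
  have bcf: "bounded_borel S0 f" if "f \<in> cont_funs S0" for f
    using bounded_borel_cont_funs[OF M0.compact_carrier that] .
  have dT0: "T0 f y - T0 g y = (\<integral>x. (g x - f x) * \<rho> x y \<partial>\<mu>0)"
    if "bounded_borel S0 f" "bounded_borel S0 g" for f g y
    using M0.integrableI[OF bounded_borel_mult[OF that(1) bounded_rho0]]
      M0.integrableI[OF bounded_borel_mult[OF that(2) bounded_rho0]]
    by (simp add: T0_def left_diff_distrib)
  have dT1: "T1 f x - T1 g x = (\<integral>y. (g y - f y) * \<rho> x y \<partial>\<mu>1)"
    if "bounded_borel S1 f" "bounded_borel S1 g" for f g x
    using M1.integrableI[OF bounded_borel_mult[OF that(1) bounded_rho1]]
      M1.integrableI[OF bounded_borel_mult[OF that(2) bounded_rho1]]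
    by (simp add: T1_def left_diff_distrib)
  define F where "F f = restrict (T1 (T0 f)) S0" for f
  obtain f k where f: "f \<in> cont_funs S0" and k: "\<And>x. x \<in> S0 \<Longrightarrow> F f x = f x + k"
  proof (rule osc_fixpoint[of S0 "\<kappa> * \<kappa>" F, rotated 6])
    show "compact S0" "S0 \<noteq> {}" by (rule M0.compact_carrier M0.nonempty)+
    show "0 \<le> \<kappa> * \<kappa>" "\<kappa> * \<kappa> < 1"
      using \<kappa> mult_strict_mono[of \<kappa> 1 \<kappa> 1] by auto
    show "F f \<in> cont_funs S0" if "f \<in> cont_funs S0" for f
    proof -
      have "continuous_on S0 (T1 (T0 f))"
        using cT1[OF bT0[OF bcf[OF that]]] by (rule continuous_on_subset) simp
      then show ?thesis by (simp add: F_def cont_funs_def)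
    qed
    show "osc_le S0 (\<lambda>x. F f x - F g x) (\<kappa> * \<kappa> * r)"
      if f: "f \<in> cont_funs S0" and g: "g \<in> cont_funs S0" and r: "osc_le S0 (\<lambda>x. f x - g x) r" for f g r
    proof -
      note bf = bcf[OF f] and bg = bcf[OF g]
      have "osc_le S1 (\<lambda>y. T0 g y - T0 f y) (\<kappa> * r)"
        unfolding dT0[OF bg bf] \<kappa>_def
        by (intro mean_contraction0 \<delta> bounded_borel_diff bf bg r)
      then have "osc_le S0 (\<lambda>x. T1 (T0 f) x - T1 (T0 g) x) (\<kappa> * (\<kappa> * r))"
        unfolding dT1[OF bT0[OF bf] bT0[OF bg]] \<kappa>_def
        by (intro mean_contraction1 \<delta> bounded_borel_diff bT0 bf bg)
      then show ?thesis by (auto simp: osc_le_def F_def algebra_simps)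
    qed
  qed blast+
  note bf = bcf[OF f] and bg = bT0[OF bcf[OF f]]
  have sum1: "(\<integral>y. (f x + T0 f y - b x y) * \<rho> x y \<partial>\<mu>1) = f x - T1 (T0 f) x" for x
    using M1.integrableI[OF bounded_borel_mult[OF bg bounded_rho1[of x]]]
      M1.integrableI[OF bounded_borel_mult[OF bounded_slices(2)[OF b] bounded_rho1[of x]]]
      M1.integrableI[OF bounded_rho1[of x]]
    by (simp add: T1_def algebra_simps)
  have sum0: "(\<integral>x. (f x + T0 f y - b x y) * \<rho> x y \<partial>\<mu>0) = 0" for y
    using M0.integrableI[OF bounded_borel_mult[OF bf bounded_rho0[of y]]]
      M0.integrableI[OF bounded_borel_mult[OF bounded_slices(1)[OF b] bounded_rho0[of y]]]
      M0.integrableI[OF bounded_rho0[of y]]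
    by (simp add: T0_def algebra_simps)
  have "bounded_borel (S0 \<times> S1) (\<lambda>z. f (fst z) + T0 f (snd z) - b (fst z) (snd z))"
    by (intro bounded_borel_diff bounded_pair_sum bf bg bounded_slices b)
  from iterated_pi[OF this] have "(\<integral>x. f x - T1 (T0 f) x \<partial>\<mu>0) = 0"
    by (simp add: sum1 sum0)
  moreover have "(\<integral>x. f x - T1 (T0 f) x \<partial>\<mu>0) = (\<integral>x. - k \<partial>\<mu>0)"
  proof (rule M0.integral_cong_carrier)
    show "f x - T1 (T0 f) x = - k" if "x \<in> S0" for x
      using k[OF that] that by (simp add: F_def)
    show "(\<lambda>x. f x - T1 (T0 f) x) \<in> borel_measurable borel"
      by (rule bounded_borel_measurable[of S0]) (intro bounded_borel_diff bf bT1 bg)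
  qed simp
  ultimately have k0: "k = 0" by (simp add: M0.prob_space)
  have fix1: "T1 (T0 f) x = f x" if "x \<in> S0" for x
    using k[OF that] that by (simp add: F_def k0)
  have "continuous_on S1 (T0 f)" using cT0[OF bf] by (rule continuous_on_subset) simp
  then have g: "restrict (T0 f) S1 \<in> cont_funs S1" by (simp add: cont_funs_def)
  have "lin_system b f (restrict (T0 f) S1)"
    unfolding lin_system_def
  proof (intro conjI ballI f g)
    fix x assume x: "x \<in> S0"
    have "(\<integral>y. (f x + restrict (T0 f) S1 y - b x y) * \<rho> x y \<partial>\<mu>1) = (\<integral>y. (f x + T0 f y - b x y) * \<rho> x y \<partial>\<mu>1)"
    proof (rule M1.integral_cong_carrier)
      show "(\<lambda>y. (f x + restrict (T0 f) S1 y - b x y) * \<rho> x y) \<in> borel_measurable borel"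
        "(\<lambda>y. (f x + T0 f y - b x y) * \<rho> x y) \<in> borel_measurable borel"
        by (rule bounded_borel_measurable[of S1], intro bounded_borel_intros bg bounded_rho1
            bounded_slices b bounded_borel_cont_funs[OF M1.compact_carrier g])+
    qed simp
    then show "(\<integral>y. (f x + restrict (T0 f) S1 y - b x y) * \<rho> x y \<partial>\<mu>1) = 0"
      using fix1[OF x] by (simp add: sum1)
  next
    fix y assume "y \<in> S1"
    then show "(\<integral>x. (f x + restrict (T0 f) S1 y - b x y) * \<rho> x y \<partial>\<mu>0) = 0"
      by (simp add: sum0)
  qed
  then show thesis by (rule that)
qed

lemma lin_system_bounded:
  assumes "lin_system b g0 g1"
  shows "bounded_borel S0 g0" "bounded_borel S1 g1"
  using assms bounded_borel_cont_funs M0.compact_carrier M1.compact_carrier by (auto simp: lin_system_def)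

text \<open>The residual has zero conditional mean given \<open>x\<close> and given
  \<open>y\<close>, and a factor depending on one variable comes out of the inner integral.\<close>

lemma lin_system_orthogonal:
  fixes b :: "'a \<Rightarrow> 'b \<Rightarrow> real"
  assumes b: "continuous_on UNIV (\<lambda>(x, y). b x y)" and h: "lin_system b g0 g1"
    and u: "bounded_borel S0 u0" "bounded_borel S1 u1"
  shows "(\<integral>z. (u0 (fst z) + u1 (snd z)) * (g0 (fst z) + g1 (snd z) - b (fst z) (snd z)) \<partial>\<pi>) = 0"
proof -
  let ?k = "\<lambda>x y. g0 x + g1 y - b x y"
  have bk: "bounded_borel (S0 \<times> S1) (\<lambda>z. ?k (fst z) (snd z))"
    by (intro bounded_borel_diff bounded_pair_sum lin_system_bounded[OF h] bounded_slices b)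
  have b0: "bounded_borel (S0 \<times> S1) (\<lambda>z. u0 (fst z) * ?k (fst z) (snd z))"
    and b1: "bounded_borel (S0 \<times> S1) (\<lambda>z. u1 (snd z) * ?k (fst z) (snd z))"
    by (intro bounded_borel_mult bk bounded_borel_fst bounded_borel_snd u)+
  have "(\<integral>z. u0 (fst z) * ?k (fst z) (snd z) \<partial>\<pi>) = (\<integral>x. 0 \<partial>\<mu>0)"
    unfolding iterated_pi(1)[OF b0]
  proof (rule M0.integral_cong_carrier)
    show "(\<integral>y. u0 x * ?k x y * \<rho> x y \<partial>\<mu>1) = 0" if "x \<in> S0" for x
      using h that by (simp add: lin_system_def mult.assoc)
    show "(\<lambda>x. \<integral>y. u0 x * ?k x y * \<rho> x y \<partial>\<mu>1) \<in> borel_measurable borel"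
      using bounded_borel_mult[OF b0 bounded_rho]
      by (intro iterated_integrals(3)) (simp add: case_prod_unfold)
  qed simp
  moreover have "(\<integral>z. u1 (snd z) * ?k (fst z) (snd z) \<partial>\<pi>) = (\<integral>y. 0 \<partial>\<mu>1)"
    unfolding iterated_pi(2)[OF b1]
  proof (rule M1.integral_cong_carrier)
    show "(\<integral>x. u1 y * ?k x y * \<rho> x y \<partial>\<mu>0) = 0" if "y \<in> S1" for y
      using h that by (simp add: lin_system_def mult.assoc)
    show "(\<lambda>y. \<integral>x. u1 y * ?k x y * \<rho> x y \<partial>\<mu>0) \<in> borel_measurable borel"
      using bounded_borel_mult[OF b1 bounded_rho]
      by (intro iterated_integrals(4)) (simp add: case_prod_unfold)
  qed simp
  ultimately show ?thesis
    using PI.integrableI[OF b0] PI.integrableI[OF b1] by (simp add: distrib_right)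
qed

text \<open>The two marginal averages of \<open>u0 + u1\<close> are \<open>u0 + N1\<close> and
  \<open>u1 + N0\<close>, with \<open>N1\<close> and \<open>N0\<close> plain averages in
  \<open>osc_pair_bound\<close>.\<close>

lemma linear_stability:
  assumes \<delta>: "0 < \<delta>" "\<delta> \<le> 1"
    "\<And>x x' y. x \<in> S0 \<Longrightarrow> x' \<in> S0 \<Longrightarrow> y \<in> S1 \<Longrightarrow> \<delta> * \<rho> x y \<le> \<rho> x' y"
    "\<And>x y y'. x \<in> S0 \<Longrightarrow> y \<in> S1 \<Longrightarrow> y' \<in> S1 \<Longrightarrow> \<delta> * \<rho> x y \<le> \<rho> x y'"
    and u: "bounded_borel S0 u0" "bounded_borel S1 u1"
    and e1: "\<And>x. x \<in> S0 \<Longrightarrow> \<bar>\<integral>y. (u0 x + u1 y) * \<rho> x y \<partial>\<mu>1\<bar> \<le> \<eta>"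
    and e0: "\<And>y. y \<in> S1 \<Longrightarrow> \<bar>\<integral>x. (u0 x + u1 y) * \<rho> x y \<partial>\<mu>0\<bar> \<le> \<eta>"
    and xy: "x \<in> S0" "y \<in> S1"
  shows "\<bar>u0 x + u1 y\<bar> \<le> (1 + 4 / \<delta>) * \<eta>"
proof -
  obtain ra where ra: "osc_le S0 u0 ra" using bounded_borel_osc[OF u(1)] .
  obtain rb where rb: "osc_le S1 u1 rb" using bounded_borel_osc[OF u(2)] .
  have s1: "(\<integral>y. (u0 x + u1 y) * \<rho> x y \<partial>\<mu>1) = u0 x + (\<integral>y. u1 y * \<rho> x y \<partial>\<mu>1)" for x
    using M1.integrableI[OF bounded_borel_mult[OF u(2) bounded_rho1]] M1.integrableI[OF bounded_rho1]
    by (simp add: distrib_right)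
  have s0: "(\<integral>x. (u0 x + u1 y) * \<rho> x y \<partial>\<mu>0) = u1 y + (\<integral>x. u0 x * \<rho> x y \<partial>\<mu>0)" for y
    using M0.integrableI[OF bounded_borel_mult[OF u(1) bounded_rho0]] M0.integrableI[OF bounded_rho0]
    by (simp add: distrib_right)
  show ?thesis
  proof (rule osc_pair_bound[OF M0.nonempty M1.nonempty ra rb \<delta>(1)])
    show "osc_le S0 (\<lambda>x. \<integral>y. u1 y * \<rho> x y \<partial>\<mu>1) ((1 - \<delta>) * r)" if "osc_le S1 u1 r" for r
      by (intro mean_contraction1 \<delta> u that)
    show "osc_le S1 (\<lambda>y. \<integral>x. u0 x * \<rho> x y \<partial>\<mu>0) ((1 - \<delta>) * r)" if "osc_le S0 u0 r" for r
      by (intro mean_contraction0 \<delta> u that)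
    show "\<bar>(\<integral>y. u1 y * \<rho> x y \<partial>\<mu>1) - u1 y\<bar> \<le> r" if "osc_le S1 u1 r" "x \<in> S0" "y \<in> S1" for r x y
      using osc_le_abs[OF that(1) _ that(3)]
      by (intro M1.average_close bounded_rho1 u) (auto intro: less_imp_le[OF rho_pos])
    show "\<bar>u0 x + (\<integral>y. u1 y * \<rho> x y \<partial>\<mu>1)\<bar> \<le> \<eta>" if "x \<in> S0" for x
      using e1[OF that] by (simp add: s1)
    show "\<bar>u1 y + (\<integral>x. u0 x * \<rho> x y \<partial>\<mu>0)\<bar> \<le> \<eta>" if "y \<in> S1" for y
      using e0[OF that] by (simp add: s0)
  qed (use xy in auto)
qed

text \<open>\<open>\<rho>\<close> and its tilt by \<open>exp (u0 + u1 + d)\<close> are both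
  normalised, so logarithmic averages take the role of \<open>N1\<close> and \<open>N0\<close> in
  \<open>osc_pair_bound\<close>; the perturbation \<open>d\<close> enters only through the error
  \<open>\<beta>\<close>.\<close>

lemma nonlinear_stability:
  assumes \<delta>: "0 < \<delta>" "\<delta> \<le> 1"
    "\<And>x x' y. x \<in> S0 \<Longrightarrow> x' \<in> S0 \<Longrightarrow> y \<in> S1 \<Longrightarrow> \<delta> * \<rho> x y \<le> \<rho> x' y"
    "\<And>x y y'. x \<in> S0 \<Longrightarrow> y \<in> S1 \<Longrightarrow> y' \<in> S1 \<Longrightarrow> \<delta> * \<rho> x y \<le> \<rho> x y'"
    and u: "bounded_borel S0 u0" "bounded_borel S1 u1"
    and d: "continuous_on UNIV (\<lambda>(x, y). d x y)" "\<And>x y. x \<in> S0 \<Longrightarrow> y \<in> S1 \<Longrightarrow> \<bar>d x y\<bar> \<le> \<beta>"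
    and e1: "\<And>x. x \<in> S0 \<Longrightarrow> (\<integral>y. exp (u0 x + u1 y + d x y) * \<rho> x y \<partial>\<mu>1) = 1"
    and e0: "\<And>y. y \<in> S1 \<Longrightarrow> (\<integral>x. exp (u0 x + u1 y + d x y) * \<rho> x y \<partial>\<mu>0) = 1"
    and xy: "x \<in> S0" "y \<in> S1"
  shows "\<bar>u0 x + u1 y\<bar> \<le> (1 + 4 / \<delta>) * \<beta>"
proof -
  obtain ra where ra: "osc_le S0 u0 ra" using bounded_borel_osc[OF u(1)] .
  obtain rb where rb: "osc_le S1 u1 rb" using bounded_borel_osc[OF u(2)] .
  note nn = less_imp_le[OF rho_pos]
  show ?thesis
  proof (rule osc_pair_bound[OF M0.nonempty M1.nonempty ra rb \<delta>(1)])
    show "osc_le S0 (\<lambda>x. ln (\<integral>y. exp (u1 y) * \<rho> x y \<partial>\<mu>1)) ((1 - \<delta>) * r)" if "osc_le S1 u1 r" for r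
      using \<delta> by (intro osc_leI, intro M1.ln_average_contraction bounded_rho1 u that integral_rho nn) auto
    show "osc_le S1 (\<lambda>y. ln (\<integral>x. exp (u0 x) * \<rho> x y \<partial>\<mu>0)) ((1 - \<delta>) * r)" if "osc_le S0 u0 r" for r
      using \<delta> by (intro osc_leI, intro M0.ln_average_contraction bounded_rho0 u that integral_rho nn) auto
    show "\<bar>ln (\<integral>y. exp (u1 y) * \<rho> x y \<partial>\<mu>1) - u1 y\<bar> \<le> r" if "osc_le S1 u1 r" "x \<in> S0" "y \<in> S1" for r x y
      using osc_le_abs[OF that(1) _ that(3)]
      by (intro M1.ln_average_close(2) bounded_rho1 u integral_rho nn)
    show "\<bar>u0 x + ln (\<integral>y. exp (u1 y) * \<rho> x y \<partial>\<mu>1)\<bar> \<le> \<beta>" if "x \<in> S0" for x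
      using that d(2)
      by (intro M1.ln_average_perturb[where d = "\<lambda>y. d x y"] bounded_rho1 integral_rho nn u bounded_slices d(1) e1) auto
    show "\<bar>u1 y + ln (\<integral>x. exp (u0 x) * \<rho> x y \<partial>\<mu>0)\<bar> \<le> \<beta>" if "y \<in> S1" for y
      using that d(2) e0[OF that]
      by (intro M0.ln_average_perturb[where d = "\<lambda>x. d x y"] bounded_rho0 integral_rho nn u bounded_slices d(1)) (auto simp: add.commute)
  qed (use xy in auto)
qed

end

text \<open>With \<open>\<Delta>\<close> the logarithmic density of the new plan against the old and
  \<open>k = g0 + g1 - b\<close>, this says that \<open>exp \<Delta> = 1 - k / \<epsilon>\<close> up
  to order \<open>\<beta>^2\<close>, tested with \<open>f\<close>. \<open>K\<close> depends only on
  the unperturbed problem.\<close>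

lemma (in eot) derivative_estimate:
  obtains K where "0 \<le> K"
    "\<And>b \<phi>0' \<phi>1' g0 g1 \<beta> f F. eot \<mu>0 S0 \<mu>1 S1 \<epsilon> (\<lambda>x y. c x y - b x y) \<phi>0' \<phi>1' \<Longrightarrow>
      (\<And>x y. x \<in> S0 \<Longrightarrow> y \<in> S1 \<Longrightarrow> \<bar>b x y\<bar> \<le> \<beta>) \<Longrightarrow> \<beta> \<le> 1 \<Longrightarrow> lin_system b g0 g1 \<Longrightarrow>
      bounded_borel (S0 \<times> S1) f \<Longrightarrow> (\<And>z. z \<in> S0 \<times> S1 \<Longrightarrow> \<bar>f z\<bar> \<le> F) \<Longrightarrow>
      \<bar>(\<integral>z. f z \<partial>eot.\<pi> \<mu>0 \<mu>1 \<epsilon> (\<lambda>x y. c x y - b x y) \<phi>0' \<phi>1') - (\<integral>z. f z \<partial>\<pi>)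
        + (\<integral>z. f z * (g0 (fst z) + g1 (snd z) - b (fst z) (snd z)) \<partial>\<pi>) / \<epsilon>\<bar> \<le> K * \<beta>\<^sup>2 * F"
proof -
  obtain \<delta> where \<delta>: "0 < \<delta>" "\<delta> \<le> 1"
    "\<And>x x' y. x \<in> S0 \<Longrightarrow> x' \<in> S0 \<Longrightarrow> y \<in> S1 \<Longrightarrow> \<delta> * \<rho> x y \<le> \<rho> x' y"
    "\<And>x y y'. x \<in> S0 \<Longrightarrow> y \<in> S1 \<Longrightarrow> y' \<in> S1 \<Longrightarrow> \<delta> * \<rho> x y \<le> \<rho> x y'"
    using rho_ratio by metis
  \<comment> \<open>\<open>N\<close> is the stability constant of both systems,
    \<open>L * \<beta>\<close> will bound \<open>\<Delta>\<close>, and \<open>Q * \<beta>^2\<close>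
    the Taylor remainder \<open>exp \<Delta> - 1 - \<Delta>\<close>; the factor \<open>exp L\<close>
    uses \<open>\<beta> \<le> 1\<close>.\<close>
  define N where "N = 1 + 4 / \<delta>"
  have N: "0 < N" using \<delta>(1) by (auto simp: N_def add_pos_pos)
  define L where "L = (N + 1) / \<epsilon>"
  have L: "0 < L" using N eps by (auto simp: L_def)
  define Q where "Q = L\<^sup>2 * exp L"
  have Q: "0 \<le> Q" by (simp add: Q_def)
  show thesis
  proof (rule that[of "Q + N * Q"])
    show "0 \<le> Q + N * Q" using Q N by simp
  next
    fix b \<phi>0' \<phi>1' g0 g1 \<beta> F and f :: "'a \<times> 'b \<Rightarrow> real"
    assume E': "eot \<mu>0 S0 \<mu>1 S1 \<epsilon> (\<lambda>x y. c x y - b x y) \<phi>0' \<phi>1'"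
      and \<beta>: "\<And>x y. x \<in> S0 \<Longrightarrow> y \<in> S1 \<Longrightarrow> \<bar>b x y\<bar> \<le> \<beta>" "\<beta> \<le> 1"
      and g: "lin_system b g0 g1"
      and f: "bounded_borel (S0 \<times> S1) f" "\<And>z. z \<in> S0 \<times> S1 \<Longrightarrow> \<bar>f z\<bar> \<le> F"
    interpret E': eot \<mu>0 S0 \<mu>1 S1 \<epsilon> "\<lambda>x y. c x y - b x y" \<phi>0' \<phi>1' by (rule E')
    obtain x0 y0 where xy0: "x0 \<in> S0" "y0 \<in> S1" using M0.nonempty M1.nonempty by blast
    have \<beta>0: "0 \<le> \<beta>" using \<beta>(1)[OF xy0] by linarith
    have F0: "0 \<le> F" using f(2)[of "(x0, y0)"] xy0 by force
    have cb: "continuous_on UNIV (\<lambda>(x, y). b x y)"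
      using continuous_on_diff[OF cont_c E'.cont_c] by (simp add: case_prod_unfold)
    define u0 where "u0 x = (\<phi>0' x - \<phi>0 x) / \<epsilon>" for x
    define u1 where "u1 y = (\<phi>1' y - \<phi>1 y) / \<epsilon>" for y
    define \<Delta> where "\<Delta> x y = u0 x + u1 y + b x y / \<epsilon>" for x y
    have bu: "bounded_borel S0 u0" "bounded_borel S1 u1"
      unfolding u0_def u1_def
      by (intro bounded_borel_divide bounded_borel_diff bounded_\<phi> E'.bounded_\<phi>)+
    have rho': "E'.\<rho> x y = exp (\<Delta> x y) * \<rho> x y" for x y
      unfolding \<rho>_def E'.\<rho>_def \<Delta>_def u0_def u1_def exp_add[symmetric] exp_inj_iff
      using eps by (simp add: field_simps)
    have cd: "continuous_on UNIV (\<lambda>(x, y). b x y / \<epsilon>)"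
      using continuous_on_divide[OF cb continuous_on_const[of _ \<epsilon>]] eps by (simp add: case_prod_unfold)
    have b\<Delta>: "bounded_borel (S0 \<times> S1) (\<lambda>z. \<Delta> (fst z) (snd z))"
      unfolding \<Delta>_def by (intro bounded_borel_add bounded_pair_sum bu bounded_slices(3)[OF cd] bounded_borel_fst bounded_borel_snd)
    have b\<Delta>0: "bounded_borel S0 (\<lambda>x. \<Delta> x y)" for y
      unfolding \<Delta>_def by (intro bounded_borel_add bounded_borel_const bu bounded_slices(1)[OF cd])
    have b\<Delta>1: "bounded_borel S1 (\<lambda>y. \<Delta> x y)" for x
      unfolding \<Delta>_def by (intro bounded_borel_add bounded_borel_const bu bounded_slices(2)[OF cd])
    have \<Delta>L: "\<bar>\<Delta> x y\<bar> \<le> L * \<beta>" if xy: "x \<in> S0" "y \<in> S1" for x y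
    proof -
      have d: "\<bar>b x y / \<epsilon>\<bar> \<le> \<beta> / \<epsilon>" if "x \<in> S0" "y \<in> S1" for x y
        using \<beta>(1)[OF that] eps by (simp add: divide_right_mono)
      have "\<bar>u0 x + u1 y\<bar> \<le> (1 + 4 / \<delta>) * (\<beta> / \<epsilon>)"
        by (rule nonlinear_stability[OF \<delta> bu cd d])
          (use E'.integral_rho xy in \<open>simp_all add: rho' \<Delta>_def[symmetric]\<close>)
      moreover have "L * \<beta> = (1 + 4 / \<delta>) * (\<beta> / \<epsilon>) + \<beta> / \<epsilon>"
        by (simp add: L_def N_def add_divide_distrib algebra_simps)
      ultimately show ?thesis using d[OF xy] unfolding \<Delta>_def by linarith
    qed
    have exp\<Delta>: "\<bar>exp (\<Delta> x y) - 1 - \<Delta> x y\<bar> \<le> Q * \<beta>\<^sup>2" if xy: "x \<in> S0" "y \<in> S1" for x y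
    proof -
      have "\<bar>exp (\<Delta> x y) - 1 - \<Delta> x y\<bar> \<le> \<bar>\<Delta> x y\<bar>\<^sup>2 * exp \<bar>\<Delta> x y\<bar>"
        using abs_exp_minus_one_minus_le[of "\<Delta> x y"] by simp
      also have "\<dots> \<le> (L * \<beta>)\<^sup>2 * exp L"
      proof (intro mult_mono power_mono)
        have "L * \<beta> \<le> L * 1" using \<beta>(2) L by (intro mult_left_mono) auto
        then show "exp \<bar>\<Delta> x y\<bar> \<le> exp L" using \<Delta>L[OF xy] by simp
      qed (use \<Delta>L[OF xy] in auto)
      finally show ?thesis by (simp add: Q_def power_mult_distrib mult_ac)
    qed
    have bR0: "bounded_borel S0 (\<lambda>x. exp (\<Delta> x y) - 1 - \<Delta> x y)" for y
      by (intro bounded_borel_intros b\<Delta>0)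
    have bR1: "bounded_borel S1 (\<lambda>y. exp (\<Delta> x y) - 1 - \<Delta> x y)" for x
      by (intro bounded_borel_intros b\<Delta>1)
    \<comment> \<open>\<open>w0 + w1\<close> is the error of the first-order formula for
      \<open>\<Delta>\<close>. The terms in \<open>b\<close> cancel, so it is again a sum of
      one-variable functions and linear stability applies to it.\<close>
    define w0 where "w0 x = u0 x + g0 x / \<epsilon>" for x
    define w1 where "w1 y = u1 y + g1 y / \<epsilon>" for y
    have bw: "bounded_borel S0 w0" "bounded_borel S1 w1"
      unfolding w0_def w1_def
      by (intro bounded_borel_add bounded_borel_divide bu lin_system_bounded[OF g])+
    have w: "w0 x + w1 y = \<Delta> x y + (g0 x + g1 y - b x y) / \<epsilon>" for x y
      by (simp add: w0_def w1_def \<Delta>_def add_divide_distrib diff_divide_distrib)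
    \<comment> \<open>Integrated against either marginal, the first bracket vanishes because both
      densities are normalised, and the last term by \<open>lin_system\<close>; only the Taylor
      remainder is left.\<close>
    have w_split: "(w0 x + w1 y) * \<rho> x y = (E'.\<rho> x y - \<rho> x y) - (exp (\<Delta> x y) - 1 - \<Delta> x y) * \<rho> x y
        + (g0 x + g1 y - b x y) * \<rho> x y / \<epsilon>" for x y
      by (simp add: w rho' algebra_simps)
    have k0: "bounded_borel S0 (\<lambda>x. (g0 x + g1 y - b x y) * \<rho> x y)" for y
      by (intro bounded_borel_intros lin_system_bounded[OF g] bounded_slices(1)[OF cb] bounded_rho0)
    have k1: "bounded_borel S1 (\<lambda>y. (g0 x + g1 y - b x y) * \<rho> x y)" for x
      by (intro bounded_borel_intros lin_system_bounded[OF g] bounded_slices(2)[OF cb] bounded_rho1)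
    have w_small: "\<bar>w0 x + w1 y\<bar> \<le> N * (Q * \<beta>\<^sup>2)" if xy: "x \<in> S0" "y \<in> S1" for x y
      unfolding N_def
    proof (rule linear_stability[OF \<delta> bw _ _ xy])
      fix x assume x: "x \<in> S0"
      have "(\<integral>y. (w0 x + w1 y) * \<rho> x y \<partial>\<mu>1) = - (\<integral>y. (exp (\<Delta> x y) - 1 - \<Delta> x y) * \<rho> x y \<partial>\<mu>1)"
        unfolding w_split
        using M1.integrableI[OF bounded_borel_mult[OF bR1[of x] bounded_rho1[of x]]] M1.integrableI[OF k1[of x]]
          M1.integrableI[OF bounded_rho1[of x]] M1.integrableI[OF E'.bounded_rho1[of x]] g x
        by (simp add: lin_system_def)
      moreover have "\<bar>(\<integral>y. (exp (\<Delta> x y) - 1 - \<Delta> x y) * \<rho> x y \<partial>\<mu>1) - 0\<bar> \<le> Q * \<beta>\<^sup>2"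
        by (rule M1.average_close[OF bounded_rho1 integral_rho(1) _ bR1])
          (use exp\<Delta> x in \<open>auto intro: less_imp_le[OF rho_pos]\<close>)
      ultimately show "\<bar>\<integral>y. (w0 x + w1 y) * \<rho> x y \<partial>\<mu>1\<bar> \<le> Q * \<beta>\<^sup>2" by simp
    next
      fix y assume y: "y \<in> S1"
      have "(\<integral>x. (w0 x + w1 y) * \<rho> x y \<partial>\<mu>0) = - (\<integral>x. (exp (\<Delta> x y) - 1 - \<Delta> x y) * \<rho> x y \<partial>\<mu>0)"
        unfolding w_split
        using M0.integrableI[OF bounded_borel_mult[OF bR0[of y] bounded_rho0[of y]]] M0.integrableI[OF k0[of y]]
          M0.integrableI[OF bounded_rho0[of y]] M0.integrableI[OF E'.bounded_rho0[of y]] g y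
        by (simp add: lin_system_def)
      moreover have "\<bar>(\<integral>x. (exp (\<Delta> x y) - 1 - \<Delta> x y) * \<rho> x y \<partial>\<mu>0) - 0\<bar> \<le> Q * \<beta>\<^sup>2"
        by (rule M0.average_close[OF bounded_rho0 integral_rho(2) _ bR0])
          (use exp\<Delta> y in \<open>auto intro: less_imp_le[OF rho_pos]\<close>)
      ultimately show "\<bar>\<integral>x. (w0 x + w1 y) * \<rho> x y \<partial>\<mu>0\<bar> \<le> Q * \<beta>\<^sup>2" by simp
    qed
    let ?k = "\<lambda>z. g0 (fst z) + g1 (snd z) - b (fst z) (snd z)"
    let ?e = "\<lambda>z. exp (\<Delta> (fst z) (snd z))"
    have be: "bounded_borel (S0 \<times> S1) ?e" by (intro bounded_borel_exp b\<Delta>)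
    have bk: "bounded_borel (S0 \<times> S1) ?k"
      by (intro bounded_borel_diff bounded_pair_sum lin_system_bounded[OF g] bounded_slices(3)[OF cb])
    have "(\<integral>z. f z \<partial>E'.\<pi>) = (\<integral>z. f z * ?e z * \<rho> (fst z) (snd z) \<partial>(\<mu>0 \<Otimes>\<^sub>M \<mu>1))"
      by (simp add: E'.integral_pi[OF f(1)] rho' mult.assoc)
    also have "\<dots> = (\<integral>z. f z * ?e z \<partial>\<pi>)"
      by (rule integral_pi[symmetric]) (intro bounded_borel_mult f be)
    finally have "(\<integral>z. f z \<partial>E'.\<pi>) - (\<integral>z. f z \<partial>\<pi>) + (\<integral>z. f z * ?k z \<partial>\<pi>) / \<epsilon>
        = (\<integral>z. f z * ?e z - f z + f z * ?k z / \<epsilon> \<partial>\<pi>)"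
      using PI.integrableI[OF bounded_borel_mult[OF f(1) be]] PI.integrableI[OF f(1)]
        PI.integrableI[OF bounded_borel_mult[OF f(1) bk]] by simp
    also have "\<bar>\<dots>\<bar> \<le> F * ((Q + N * Q) * \<beta>\<^sup>2)"
    proof (rule PI.integral_abs_le)
      fix z assume z: "z \<in> S0 \<times> S1"
      then have xy: "fst z \<in> S0" "snd z \<in> S1" by auto
      have "f z * ?e z - f z + f z * ?k z / \<epsilon>
          = f z * ((?e z - 1 - \<Delta> (fst z) (snd z)) + (w0 (fst z) + w1 (snd z)))"
        by (simp add: w algebra_simps)
      moreover have "\<bar>(?e z - 1 - \<Delta> (fst z) (snd z)) + (w0 (fst z) + w1 (snd z))\<bar> \<le> (Q + N * Q) * \<beta>\<^sup>2"
        unfolding distrib_right mult.assoc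
        by (rule order_trans[OF abs_triangle_ineq add_mono[OF exp\<Delta>[OF xy] w_small[OF xy]]])
      ultimately show "\<bar>f z * ?e z - f z + f z * ?k z / \<epsilon>\<bar> \<le> F * ((Q + N * Q) * \<beta>\<^sup>2)"
        using f(2)[OF z] F0 by (simp only: abs_mult) (intro mult_mono; simp)
    next
      show "(\<lambda>z. f z * ?e z - f z + f z * ?k z / \<epsilon>) \<in> borel_measurable borel"
        by (rule bounded_borel_measurable[of "S0 \<times> S1"]) (intro bounded_borel_intros f be bk)
    qed
    finally show "\<bar>(\<integral>z. f z \<partial>E'.\<pi>) - (\<integral>z. f z \<partial>\<pi>) + (\<integral>z. f z * ?k z \<partial>\<pi>) / \<epsilon>\<bar> \<le> (Q + N * Q) * \<beta>\<^sup>2 * F"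
      by (simp only: mult.commute[of F])
  qed
qed

section \<open>Extremal eigenvalues of symmetric bilinear forms\<close>

text \<open>Eigenvectors of a symmetric matrix for distinct eigenvalues are orthogonal, and a
  pairwise orthogonal set is finite. Finiteness is what gives \<open>Min\<close> and
  \<open>Max\<close> of the eigenvalues their meaning.\<close>

lemma finite_eigenvalues:
  fixes H :: "real^'k^'k"
  assumes sym: "\<And>v w. v \<bullet> (H *v w) = (H *v v) \<bullet> w"
  shows "finite (eigenvalues H)"
proof -
  define e where "e l = (SOME v. v \<noteq> 0 \<and> H *v v = l *\<^sub>R v)" for l
  have e: "e l \<noteq> 0" "H *v e l = l *\<^sub>R e l" if "l \<in> eigenvalues H" for l
  proof -
    have "\<exists>v. v \<noteq> 0 \<and> H *v v = l *\<^sub>R v" using that by (simp add: eigenvalues_def)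
    then have "e l \<noteq> 0 \<and> H *v e l = l *\<^sub>R e l" unfolding e_def by (rule someI_ex)
    then show "e l \<noteq> 0" "H *v e l = l *\<^sub>R e l" by auto
  qed
  have orth: "e l \<bullet> e l' = 0" if "l \<in> eigenvalues H" "l' \<in> eigenvalues H" "l \<noteq> l'" for l l'
  proof -
    have "l' * (e l \<bullet> e l') = l * (e l \<bullet> e l')"
      using sym[of "e l" "e l'"] e(2)[OF that(1)] e(2)[OF that(2)] by simp
    then show ?thesis using that(3) by simp
  qed
  have "inj_on e (eigenvalues H)"
    using orth e(1) by (intro inj_onI) (metis inner_eq_zero_iff)
  moreover have "pairwise orthogonal (e ` eigenvalues H)"
    using orth by (auto simp: pairwise_def orthogonal_def)
  then have "finite (e ` eigenvalues H)" by (rule pairwise_orthogonal_imp_finite)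
  ultimately show ?thesis using finite_image_iff by blast
qed

text \<open>First-order optimality on the unit sphere: \<open>w \<mapsto> w \<bullet> H w - l (w \<bullet> w)\<close> is nonnegative and
  vanishes at the minimiser \<open>v\<close>, so its derivative \<open>2 (H v - l v)\<close> there is zero.\<close>

lemma minimal_eigenvector:
  fixes H :: "real^'k^'k"
  assumes sym: "\<And>v w. v \<bullet> (H *v w) = (H *v v) \<bullet> w"
  obtains v l where "norm v = 1" "H *v v = l *\<^sub>R v" "\<And>w. norm w = 1 \<Longrightarrow> l \<le> w \<bullet> (H *v w)"
proof -
  have "continuous_on (sphere (0 :: real^'k) 1) (\<lambda>v. v \<bullet> (H *v v))"
    by (intro continuous_intros linear_continuous_on_compose matrix_vector_mul_linear)
  moreover have "sphere (0 :: real^'k) 1 \<noteq> {}" by (simp add: sphere_eq_empty)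
  ultimately have "\<exists>v\<in>sphere 0 1. \<forall>w\<in>sphere 0 1. v \<bullet> (H *v v) \<le> w \<bullet> (H *v w)"
    by (intro continuous_attains_inf compact_sphere)
  then obtain v where v: "norm v = 1" "\<And>w. norm w = 1 \<Longrightarrow> v \<bullet> (H *v v) \<le> w \<bullet> (H *v w)"
    by auto
  define l where "l = v \<bullet> (H *v v)"
  define z where "z = H *v v - l *\<^sub>R v"
  define q where "q w = w \<bullet> (H *v w) - l * (w \<bullet> w)" for w
  have q0: "0 \<le> q w" for w
  proof (cases "w = 0")
    case False
    have "l \<le> (w /\<^sub>R norm w) \<bullet> (H *v (w /\<^sub>R norm w))"
      unfolding l_def by (rule v(2)) (use False in simp)
    also have "\<dots> = (w \<bullet> (H *v w)) / (norm w)\<^sup>2"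
      by (simp add: matrix_vector_mult_scaleR power2_eq_square divide_inverse mult_ac)
    finally show ?thesis
      using False by (simp add: q_def power2_norm_eq_inner[symmetric] field_simps)
  qed (simp add: q_def)
  have "v \<bullet> v = 1" using v(1) by (simp add: norm_eq_1)
  have qv: "q (v + t *\<^sub>R z) = 2 * t * (z \<bullet> z) + t\<^sup>2 * q z" for t
  proof -
    have "z \<bullet> (H *v v - l *\<^sub>R v) = z \<bullet> z" by (simp add: z_def)
    then have zHv: "z \<bullet> (H *v v) = z \<bullet> z + l * (z \<bullet> v)" by (simp add: inner_diff_right)
    then have "v \<bullet> (H *v z) = z \<bullet> z + l * (z \<bullet> v)"
      using sym[of v z] inner_commute[of "H *v v" z] by simp
    then show ?thesis
      using \<open>v \<bullet> v = 1\<close> zHv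
      by (simp add: q_def matrix_vector_right_distrib matrix_vector_mult_scaleR inner_add_left inner_add_right
          l_def[symmetric] inner_commute[of v z] power2_eq_square algebra_simps)
  qed
  have "z \<bullet> z = 0"
  proof (rule ccontr)
    assume "z \<bullet> z \<noteq> 0"
    then have zz: "0 < z \<bullet> z" by simp
    \<comment> \<open>A negative step for which \<open>q (v + t z) = t (2 z.z + t q z)\<close> has a
      positive bracket and so is negative. The \<open>+ 1\<close> keeps the denominator positive
      when \<open>q z = 0\<close>.\<close>
    define t where "t = - (z \<bullet> z) / (q z + 1)"
    have p: "0 < q z + 1" using q0[of z] by simp
    then have "t < 0" using zz by (simp add: t_def)
    have "t * q z = - (z \<bullet> z) - t" using p by (simp add: t_def field_simps)
    then have "0 < 2 * (z \<bullet> z) + t * q z" using zz \<open>t < 0\<close> by linarith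
    then have "t * (2 * (z \<bullet> z) + t * q z) < 0" using \<open>t < 0\<close> by (simp add: mult_neg_pos)
    then show False using q0[of "v + t *\<^sub>R z"] unfolding qv by (simp add: power2_eq_square algebra_simps)
  qed
  then have "H *v v = l *\<^sub>R v" by (simp add: z_def)
  then show thesis using v by (intro that[of v l]) (auto simp: l_def)
qed

text \<open>The identification behind \<open>form_matrix\<close>. It is a linear isometry onto, so
  unit vectors and unit matrices correspond.\<close>

definition mat_of :: "real^('m \<times> 'n) \<Rightarrow> real^'n^'m" where
  "mat_of v = (\<chi> i j. v $ (i, j))"

lemma mat_of_sum:
  fixes v :: "real^('m::finite \<times> 'n::finite)"
  shows "mat_of v = (\<Sum>p\<in>UNIV. (v $ p) *\<^sub>R unit_mat p)"
proof -
  have "(\<Sum>p\<in>UNIV. (v $ p) *\<^sub>R (unit_mat p :: real^'n^'m)) $ i $ j = v $ (i, j)" for i j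
  proof -
    have "(\<Sum>p\<in>UNIV. (v $ p) *\<^sub>R (unit_mat p :: real^'n^'m)) $ i $ j
        = (\<Sum>p\<in>UNIV. if p = (i, j) then v $ (i, j) else 0)"
      unfolding sum_component by (intro sum.cong) (auto simp: unit_mat_def axis_def)
    then show ?thesis by simp
  qed
  then show ?thesis by (simp add: mat_of_def vec_eq_iff)
qed

lemma norm_mat_of: "norm (mat_of v) = norm v"
proof -
  have "mat_of v \<bullet> mat_of v = v \<bullet> v"
    by (simp add: inner_vec_def mat_of_def sum.cartesian_product UNIV_Times_UNIV[symmetric] case_prod_unfold
        del: UNIV_Times_UNIV)
  then show ?thesis by (simp add: norm_eq_sqrt_inner)
qed

lemma surj_mat_of: "surj mat_of"
proof
  show "UNIV \<subseteq> range (mat_of :: _ \<Rightarrow> real^'n^'m)"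
  proof
    fix C :: "real^'n^'m"
    have "C = mat_of (\<chi> p. C $ fst p $ snd p)" by (simp add: mat_of_def vec_eq_iff)
    then show "C \<in> range mat_of" by blast
  qed
qed simp

lemma inner_form_matrix:
  fixes Q :: "real^'n^'m \<Rightarrow> real^'n^'m \<Rightarrow> real"
  assumes "\<And>C. linear (\<lambda>B. Q B C)" "\<And>B. linear (Q B)"
  shows "v \<bullet> (form_matrix Q *v w) = Q (mat_of v) (mat_of w)"
proof -
  have "Q (mat_of v) (mat_of w) = (\<Sum>p\<in>UNIV. v $ p * (\<Sum>q\<in>UNIV. w $ q * Q (unit_mat p) (unit_mat q)))"
    unfolding mat_of_sum[of v] linear_sum[OF assms(1)] linear_cmul[OF assms(1)]
    unfolding mat_of_sum[of w] linear_sum[OF assms(2)] linear_cmul[OF assms(2)]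
    by (simp add: linear_sum[OF assms(2)] linear_cmul[OF assms(2)])
  also have "\<dots> = v \<bullet> (form_matrix Q *v w)"
    by (simp add: inner_vec_def matrix_vector_mult_def form_matrix_def mult.commute)
  finally show ?thesis by simp
qed

text \<open>Every eigenvalue is the value of the form at a normalised eigenvector. The smallest is
  moreover compared with all unit matrices, since its formula is an infimum; for the largest a
  representing matrix suffices, because the Hessian form will be bounded by 64 on all unit
  matrices.\<close>

lemma extremal_eigenvalues:
  fixes Q :: "real^'n^'m \<Rightarrow> real^'n^'m \<Rightarrow> real"
  assumes lin: "\<And>C. linear (\<lambda>B. Q B C)" "\<And>B. linear (Q B)" and sym: "\<And>B C. Q B C = Q C B"
  shows "\<exists>C. norm C = 1 \<and> lambda_min Q = Q C C"
    and "\<And>C. norm C = 1 \<Longrightarrow> lambda_min Q \<le> Q C C"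
    and "\<exists>C. norm C = 1 \<and> lambda_max Q = Q C C"
proof -
  let ?H = "form_matrix Q"
  note H = inner_form_matrix[OF lin]
  have symH: "v \<bullet> (?H *v w) = (?H *v v) \<bullet> w" for v w
    using H[of v w] H[of w v] sym by (simp add: inner_commute)
  note fin = finite_eigenvalues[OF symH]
  have attained: "\<exists>C. norm C = 1 \<and> l = Q C C" if l: "l \<in> eigenvalues ?H" for l
  proof -
    obtain v where v: "v \<noteq> 0" "?H *v v = l *\<^sub>R v" using l by (auto simp: eigenvalues_def)
    define w where "w = v /\<^sub>R norm v"
    have "?H *v w = l *\<^sub>R w" using v(2) by (simp add: w_def matrix_vector_mult_scaleR)
    moreover have w: "norm w = 1" using v(1) by (simp add: w_def)
    ultimately have "Q (mat_of w) (mat_of w) = l"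
      using H[of w w] by (simp add: norm_eq_1)
    then show ?thesis using w norm_mat_of by metis
  qed
  obtain v l where v: "norm v = 1" "?H *v v = l *\<^sub>R v" "\<And>w. norm w = 1 \<Longrightarrow> l \<le> w \<bullet> (?H *v w)"
    using minimal_eigenvector[OF symH] by blast
  have "v \<noteq> 0" using v(1) by auto
  then have l: "l \<in> eigenvalues ?H" using v(2) by (auto simp: eigenvalues_def)
  then have ne: "eigenvalues ?H \<noteq> {}" by blast
  show "\<exists>C. norm C = 1 \<and> lambda_min Q = Q C C" "\<exists>C. norm C = 1 \<and> lambda_max Q = Q C C"
    unfolding lambda_min_def lambda_max_def by (intro attained Min_in Max_in fin ne)+
  show "lambda_min Q \<le> Q C C" if "norm C = 1" for C
  proof -
    obtain w where w: "C = mat_of w" using surj_mat_of by blast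
    have "lambda_min Q \<le> l" unfolding lambda_min_def using fin l by (rule Min_le)
    also have "l \<le> Q C C" using v(3)[of w] that by (simp add: H w norm_mat_of)
    finally show ?thesis .
  qed
qed

section \<open>Derivatives of the variational objective\<close>

lemma has_derivative_quadratic_remainder:
  fixes f :: "'a::real_normed_vector \<Rightarrow> 'b::real_normed_vector"
  assumes "bounded_linear f'" "0 < r" "0 \<le> K"
    and "\<And>h. norm h \<le> r \<Longrightarrow> norm (f (x + h) - f x - f' h) \<le> K * (norm h)\<^sup>2"
  shows "(f has_derivative f') (at x)"
  unfolding has_derivative_at
proof
  show "((\<lambda>h. norm (f (x + h) - f x - f' h) / norm h) \<longlongrightarrow> 0) (at 0)"
  proof (rule Lim_null_comparison)
    show "\<forall>\<^sub>F h in at 0. norm (norm (f (x + h) - f x - f' h) / norm h) \<le> K * norm h"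
      unfolding eventually_at
    proof (intro exI[of _ r] conjI ballI impI)
      fix h :: 'a assume h: "h \<noteq> 0 \<and> dist h 0 < r"
      then have "norm (f (x + h) - f x - f' h) / norm h \<le> K * (norm h)\<^sup>2 / norm h"
        using assms(4)[of h] by (intro divide_right_mono) auto
      then show "norm (norm (f (x + h) - f x - f' h) / norm h) \<le> K * norm h"
        using h by (simp add: power2_eq_square)
    qed (rule assms)
    show "((\<lambda>h. K * norm h) \<longlongrightarrow> 0) (at 0)"
      by (intro tendsto_mult_right_zero tendsto_norm_zero tendsto_ident_at)
  qed
qed (rule assms)

section \<open>The bilinear part of the cost: continuity and Frobenius bounds\<close>

lemma continuous_bilin: "continuous_on UNIV (\<lambda>(x, y). bilin C x y)"
  unfolding bilin_def case_prod_unfold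
  using continuous_on_compose2[OF matrix_vector_mult_linear_continuous_on[of UNIV C] continuous_on_snd[OF continuous_on_id]]
  by (intro continuous_on_inner continuous_on_fst continuous_on_id) simp_all

lemma continuous_cost:
  fixes A :: "real^'n^'m"
  shows "continuous_on UNIV (\<lambda>(x, y). cost A x y)"
proof -
  have "continuous_on UNIV (\<lambda>z :: (real^'m) \<times> (real^'n). - 4 * (norm (fst z))\<^sup>2 * (norm (snd z))\<^sup>2)"
    by (intro continuous_intros)
  from continuous_on_diff[OF this continuous_on_mult_left[OF continuous_bilin[unfolded case_prod_unfold], of 32]]
  show ?thesis by (simp add: cost_def case_prod_unfold)
qed

lemma bilin_sum: "bilin C x y = (\<Sum>i\<in>UNIV. \<Sum>j\<in>UNIV. C $ i $ j * (x $ i * y $ j))"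
  by (simp add: bilin_def inner_vec_def matrix_vector_mult_def sum_distrib_left mult_ac)

lemma bilin_add: "bilin (B + C) x y = bilin B x y + bilin C x y"
  by (simp add: bilin_def matrix_vector_mult_add_rdistrib inner_add_right)

lemma bilin_scaleR: "bilin (r *\<^sub>R C) x y = r * bilin C x y"
  by (simp add: bilin_sum sum_distrib_left mult_ac)

lemma cost_add: "cost (A + C) x y = cost A x y - 32 * bilin C x y"
  by (simp add: cost_def bilin_add)

lemma norm_matrix_vector_le: "norm (C *v y) \<le> norm C * norm y" for C :: "real^'n^'m"
proof -
  have "\<bar>(C *v y) $ i\<bar> \<le> norm (C $ i) * norm y" for i
    using Cauchy_Schwarz_ineq2[of "C $ i" y] by (simp add: matrix_vector_mul_component)
  then have "norm (C *v y) \<le> L2_set (\<lambda>i. norm (C $ i) * norm y) UNIV"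
    unfolding norm_vec_def[of "C *v y"] by (intro L2_set_mono) auto
  also have "\<dots> = norm C * norm y"
    by (simp add: norm_vec_def[of C] L2_set_left_distrib)
  finally show ?thesis .
qed

lemma abs_bilin_le: "\<bar>bilin C x y\<bar> \<le> norm C * (norm x * norm y)"
proof -
  have "\<bar>bilin C x y\<bar> \<le> norm x * norm (C *v y)"
    unfolding bilin_def by (rule Cauchy_Schwarz_ineq2)
  also have "\<dots> \<le> norm x * (norm C * norm y)"
    by (intro mult_left_mono norm_matrix_vector_le) auto
  finally show ?thesis by (simp add: mult_ac)
qed

lemma bounded_borel_bilin:
  "compact S \<Longrightarrow> bounded_borel S (\<lambda>z. bilin C (fst z) (snd z))"
  using bounded_borel_continuous[OF _ continuous_bilin] by (simp add: case_prod_unfold)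

text \<open>The mean of \<open>w x y^T\<close>, that is, the Frobenius representative of the
  functional sending \<open>B\<close> to the integral of \<open>bilin B * w\<close>.\<close>

definition bilin_moment :: "((real^'m) \<times> (real^'n)) measure \<Rightarrow> ((real^'m) \<times> (real^'n) \<Rightarrow> real) \<Rightarrow> real^'n^'m" where
  "bilin_moment \<pi> w = (\<chi> i j. \<integral>z. fst z $ i * snd z $ j * w z \<partial>\<pi>)"

lemma inner_bilin_moment:
  fixes \<pi> :: "((real^'m) \<times> (real^'n)) measure"
  assumes "carried \<pi> S" "bounded_borel S w"
  shows "B \<bullet> bilin_moment \<pi> w = (\<integral>z. bilin B (fst z) (snd z) * w z \<partial>\<pi>)"
proof -
  interpret carried \<pi> S by fact
  have "continuous_on UNIV (\<lambda>z :: (real^'m) \<times> (real^'n). fst z $ i * snd z $ j)" for i j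
    by (intro continuous_intros)
  then have i: "integrable \<pi> (\<lambda>z. fst z $ i * snd z $ j * w z)" for i j
    by (intro integrableI bounded_borel_mult assms bounded_borel_continuous compact_carrier)
  have "B \<bullet> bilin_moment \<pi> w = (\<Sum>i\<in>UNIV. \<Sum>j\<in>UNIV. B $ i $ j * (\<integral>z. fst z $ i * snd z $ j * w z \<partial>\<pi>))"
    by (simp add: inner_vec_def bilin_moment_def)
  also have "\<dots> = (\<integral>z. (\<Sum>i\<in>UNIV. \<Sum>j\<in>UNIV. B $ i $ j * (fst z $ i * snd z $ j * w z)) \<partial>\<pi>)"
    using i by simp
  also have "\<dots> = (\<integral>z. bilin B (fst z) (snd z) * w z \<partial>\<pi>)"
    by (simp add: bilin_sum sum_distrib_right mult.assoc)
  finally show ?thesis .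
qed

section \<open>The problem with cost \<open>cost A\<close>: optimal plan, value and
  supergradient\<close>

locale compact_eot = marginals \<mu>0 "spt \<mu>0" \<mu>1 "spt \<mu>1"
  for \<mu>0 :: "(real^'m) measure" and \<mu>1 :: "(real^'n) measure" +
  fixes \<epsilon> :: real
  assumes eps: "0 < \<epsilon>"
begin

text \<open>The same choice term as in \<open>rho\<close>, so that the density of the locale
  \<open>eot\<close> coincides with \<open>rho\<close> by unfolding.\<close>

definition potential :: "real^'n^'m \<Rightarrow> (real^'m \<Rightarrow> real) \<times> (real^'n \<Rightarrow> real)" where
  "potential A = (SOME \<phi>. eot_potentials \<mu>0 \<mu>1 \<epsilon> A \<phi>)"

lemma eot_potentials_potential: "eot_potentials \<mu>0 \<mu>1 \<epsilon> A (potential A)"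
proof -
  have "continuous_on UNIV (\<lambda>(x, y). exp (- cost A x y / \<epsilon>))"
    using continuous_on_exp[OF continuous_on_divide[OF continuous_on_minus[OF continuous_cost[of A]] continuous_on_const[of _ \<epsilon>]]]
      eps by (simp add: case_prod_unfold)
  then obtain f g where fg: "continuous_on UNIV f" "continuous_on UNIV g"
    "\<And>x. (\<integral>y. exp (f x + g y) * exp (- cost A x y / \<epsilon>) \<partial>\<mu>1) = 1"
    "\<And>y. (\<integral>x. exp (f x + g y) * exp (- cost A x y / \<epsilon>) \<partial>\<mu>0) = 1"
    by (rule schroedinger_exists) auto
  have "exp (f x + g y) * exp (- cost A x y / \<epsilon>) = eot_dens \<epsilon> A (\<lambda>x. \<epsilon> * f x, \<lambda>y. \<epsilon> * g y) x y" for x y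
    using eps by (simp add: eot_dens_def exp_add[symmetric] field_simps)
  then have "eot_potentials \<mu>0 \<mu>1 \<epsilon> A (\<lambda>x. \<epsilon> * f x, \<lambda>y. \<epsilon> * g y)"
    using fg by (auto simp: eot_potentials_def intro!: continuous_intros)
  then show ?thesis unfolding potential_def by (rule someI)
qed

lemma eot_potential: "eot \<mu>0 (spt \<mu>0) \<mu>1 (spt \<mu>1) \<epsilon> (cost A) (fst (potential A)) (snd (potential A))"
  using eot_potentials_potential[of A] eps continuous_cost
  by unfold_locales (auto simp: eot_potentials_def eot_dens_def)

definition opt_plan :: "real^'n^'m \<Rightarrow> ((real^'m) \<times> (real^'n)) measure" where
  "opt_plan A = eot.\<pi> \<mu>0 \<mu>1 \<epsilon> (cost A) (fst (potential A)) (snd (potential A))"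

definition ot_value :: "real^'n^'m \<Rightarrow> real" where
  "ot_value A = eot.dual_value \<mu>0 \<mu>1 (fst (potential A)) (snd (potential A))"

lemma opt_plan_coupling: "opt_plan A \<in> couplings \<mu>0 \<mu>1"
  unfolding opt_plan_def by (rule eot.pi_coupling[OF eot_potential])

lemma carried_opt_plan: "carried (opt_plan A) (spt \<mu>0 \<times> spt \<mu>1)"
  by (rule carried_couplings[OF opt_plan_coupling])

lemma KL_opt_plan: "KL (opt_plan A) (\<mu>0 \<Otimes>\<^sub>M \<mu>1) = ereal ((ot_value A - (\<integral>z. cost A (fst z) (snd z) \<partial>opt_plan A)) / \<epsilon>)"
  unfolding opt_plan_def ot_value_def by (rule eot.KL_pi[OF eot_potential])

lemma objective_opt_plan: "eot_objective \<mu>0 \<mu>1 \<epsilon> A (opt_plan A) = ereal (ot_value A)"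
  using eps by (simp add: eot_objective_def KL_opt_plan case_prod_unfold)

text \<open>An infinite divergence makes the objective infinite, as \<epsilon> > 0 and the cost
  integral is real; otherwise the dual bound applies. The equality case is the uniqueness that the
  description operator in \<open>opt_coupling\<close> requires.\<close>

lemma objective_ge:
  assumes \<pi>': "\<pi>' \<in> couplings \<mu>0 \<mu>1"
  shows "ereal (ot_value A) \<le> eot_objective \<mu>0 \<mu>1 \<epsilon> A \<pi>'"
    and "eot_objective \<mu>0 \<mu>1 \<epsilon> A \<pi>' = ereal (ot_value A) \<Longrightarrow> \<pi>' = opt_plan A"
proof -
  have "KL \<pi>' (\<mu>0 \<Otimes>\<^sub>M \<mu>1) = \<infinity> \<or> (\<exists>k. KL \<pi>' (\<mu>0 \<Otimes>\<^sub>M \<mu>1) = ereal k)"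
    by (auto simp: KL_def)
  then consider (inf) "KL \<pi>' (\<mu>0 \<Otimes>\<^sub>M \<mu>1) = \<infinity>" | (fin) k where "KL \<pi>' (\<mu>0 \<Otimes>\<^sub>M \<mu>1) = ereal k"
    by blast
  then have "ereal (ot_value A) \<le> eot_objective \<mu>0 \<mu>1 \<epsilon> A \<pi>' \<and>
    (eot_objective \<mu>0 \<mu>1 \<epsilon> A \<pi>' = ereal (ot_value A) \<longrightarrow> \<pi>' = opt_plan A)"
  proof cases
    case inf
    then show ?thesis using eps by (simp add: eot_objective_def)
  next
    case fin
    then show ?thesis
      using eot.objective_lower_bound[OF eot_potential \<pi>' fin, of A]
      by (auto simp: eot_objective_def case_prod_unfold opt_plan_def ot_value_def)
  qed
  then show "ereal (ot_value A) \<le> eot_objective \<mu>0 \<mu>1 \<epsilon> A \<pi>'"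
    "eot_objective \<mu>0 \<mu>1 \<epsilon> A \<pi>' = ereal (ot_value A) \<Longrightarrow> \<pi>' = opt_plan A" by blast+
qed

lemma OT_eq: "OT \<mu>0 \<mu>1 \<epsilon> A = ereal (ot_value A)"
  unfolding OT_def
proof (rule antisym)
  show "(INF \<pi>\<in>couplings \<mu>0 \<mu>1. eot_objective \<mu>0 \<mu>1 \<epsilon> A \<pi>) \<le> ereal (ot_value A)"
    using INF_lower[OF opt_plan_coupling, of "eot_objective \<mu>0 \<mu>1 \<epsilon> A" A] by (simp add: objective_opt_plan)
qed (intro INF_greatest objective_ge)

lemma opt_coupling_eq: "opt_coupling \<mu>0 \<mu>1 \<epsilon> A = opt_plan A"
  unfolding opt_coupling_def OT_eq
  by (rule the_equality) (auto simp: opt_plan_coupling objective_opt_plan objective_ge(2))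

lemma Phi_eq: "Phi \<mu>0 \<mu>1 \<epsilon> A = 32 * (norm A)\<^sup>2 + ot_value A"
  by (simp add: Phi_def OT_eq)

text \<open>\<open>- 32\<close> times this matrix is the gradient of
  \<open>ot_value\<close>.\<close>

definition cross_moment :: "real^'n^'m \<Rightarrow> real^'n^'m" where
  "cross_moment A = bilin_moment (opt_plan A) (\<lambda>_. 1)"

lemma bounded_bilin: "bounded_borel (spt \<mu>0 \<times> spt \<mu>1) (\<lambda>z. bilin C (fst z) (snd z))"
  by (rule bounded_borel_bilin[OF P.compact_carrier])

lemma inner_cross_moment: "B \<bullet> cross_moment A = (\<integral>z. bilin B (fst z) (snd z) \<partial>opt_plan A)"
  unfolding cross_moment_def using inner_bilin_moment[OF carried_opt_plan bounded_borel_const] by simp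

text \<open>Testing the optimality of \<open>A'\<close> with the optimal coupling of \<open>A\<close>.\<close>

lemma ot_value_supergradient: "ot_value A' \<le> ot_value A - 32 * ((A' - A) \<bullet> cross_moment A)"
proof -
  interpret \<pi>: carried "opt_plan A" "spt \<mu>0 \<times> spt \<mu>1" by (rule carried_opt_plan)
  interpret E: eot \<mu>0 "spt \<mu>0" \<mu>1 "spt \<mu>1" \<epsilon> "cost A" "fst (potential A)" "snd (potential A)" by (rule eot_potential)
  have "cost A' x y = cost A x y - 32 * bilin (A' - A) x y" for x y
    using cost_add[of A "A' - A" x y] by simp
  then have "(\<integral>z. cost A' (fst z) (snd z) \<partial>opt_plan A)
      = (\<integral>z. cost A (fst z) (snd z) \<partial>opt_plan A) - 32 * ((A' - A) \<bullet> cross_moment A)"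
    using \<pi>.integrableI[OF E.bounded_c] \<pi>.integrableI[OF bounded_bilin] by (simp add: inner_cross_moment)
  moreover have "ot_value A' \<le> (\<integral>z. cost A' (fst z) (snd z) \<partial>opt_plan A) + (ot_value A - (\<integral>z. cost A (fst z) (snd z) \<partial>opt_plan A))"
    using objective_ge(1)[OF opt_plan_coupling[of A], of A'] eps
    by (simp add: eot_objective_def KL_opt_plan case_prod_unfold)
  ultimately show ?thesis by simp
qed

section \<open>Residuals and the derivatives of the cross moment and of \<open>Phi\<close>\<close>

definition residual :: "real^'n^'m \<Rightarrow> real^'n^'m \<Rightarrow> (real^'m) \<times> (real^'n) \<Rightarrow> real" where
  "residual A C z = h0 \<mu>0 \<mu>1 \<epsilon> A C (fst z) + h1 \<mu>0 \<mu>1 \<epsilon> A C (snd z) - 32 * bilin C (fst z) (snd z)"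

lemma continuous_bilin32: "continuous_on UNIV (\<lambda>(x, y). 32 * bilin C x y)"
  using continuous_on_mult_left[OF continuous_bilin[of C], of 32] by (simp add: case_prod_unfold)

lemma rho_eq: "rho \<mu>0 \<mu>1 \<epsilon> A = eot.\<rho> \<epsilon> (cost A) (fst (potential A)) (snd (potential A))"
  using eot.\<rho>_def[OF eot_potential, of A]
  by (simp add: fun_eq_iff rho_def potential_def[symmetric] eot_dens_def)

lemma h_lin_system:
  "eot.lin_system \<mu>0 (spt \<mu>0) \<mu>1 (spt \<mu>1) \<epsilon> (cost A) (fst (potential A)) (snd (potential A))
    (\<lambda>x y. 32 * bilin C x y) (h0 \<mu>0 \<mu>1 \<epsilon> A C) (h1 \<mu>0 \<mu>1 \<epsilon> A C)"
proof -
  interpret E: eot \<mu>0 "spt \<mu>0" \<mu>1 "spt \<mu>1" \<epsilon> "cost A" "fst (potential A)" "snd (potential A)" by (rule eot_potential)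
  have eq: "h_system \<mu>0 \<mu>1 \<epsilon> A C h \<longleftrightarrow> E.lin_system (\<lambda>x y. 32 * bilin C x y) (fst h) (snd h)" for h
    by (simp add: h_system_def E.lin_system_def rho_eq)
  obtain g0 g1 where "E.lin_system (\<lambda>x y. 32 * bilin C x y) g0 g1"
    using E.lin_system_exists[OF continuous_bilin32] .
  then have "h_system \<mu>0 \<mu>1 \<epsilon> A C (g0, g1)" by (simp add: eq)
  then have "h_system \<mu>0 \<mu>1 \<epsilon> A C (h_pair \<mu>0 \<mu>1 \<epsilon> A C)"
    unfolding h_pair_def by (rule someI)
  then show ?thesis by (simp add: eq h0_def h1_def)
qed

lemma bounded_h: "bounded_borel (spt \<mu>0) (h0 \<mu>0 \<mu>1 \<epsilon> A C)" "bounded_borel (spt \<mu>1) (h1 \<mu>0 \<mu>1 \<epsilon> A C)"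
  by (rule eot.lin_system_bounded[OF eot_potential h_lin_system])+

lemma bounded_h_sum:
  "bounded_borel (spt \<mu>0 \<times> spt \<mu>1) (\<lambda>z. h0 \<mu>0 \<mu>1 \<epsilon> A C (fst z) + h1 \<mu>0 \<mu>1 \<epsilon> A C (snd z))"
  by (intro bounded_borel_add bounded_borel_fst bounded_borel_snd bounded_h)

lemma bounded_residual: "bounded_borel (spt \<mu>0 \<times> spt \<mu>1) (residual A C)"
  unfolding residual_def[abs_def] by (intro bounded_borel_diff bounded_borel_mult bounded_borel_const bounded_h_sum bounded_bilin)

lemma residual_orthogonal:
  assumes "bounded_borel (spt \<mu>0) u0" "bounded_borel (spt \<mu>1) u1"
  shows "(\<integral>z. (u0 (fst z) + u1 (snd z)) * residual A C z \<partial>opt_plan A) = 0"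
  using eot.lin_system_orthogonal[OF eot_potential continuous_bilin32 h_lin_system assms, of A C]
  by (simp add: residual_def opt_plan_def)

definition residual_form :: "real^'n^'m \<Rightarrow> real^'n^'m \<Rightarrow> real^'n^'m \<Rightarrow> real" where
  "residual_form A B C = (\<integral>z. residual A B z * residual A C z \<partial>opt_plan A)"

lemma residual_form_sym: "residual_form A B C = residual_form A C B"
  by (simp add: residual_form_def mult.commute)

text \<open>The residual of \<open>C\<close> is orthogonal to the sum \<open>h0 + h1\<close> for
  \<open>B\<close>, which leaves only the part \<open>- 32 * bilin B\<close>. The result is visibly
  linear in \<open>B\<close>, although the pair of h-functions is chosen anew for each
  matrix.\<close>

lemma residual_form_bilin: "residual_form A B C = - 32 * (\<integral>z. bilin B (fst z) (snd z) * residual A C z \<partial>opt_plan A)"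
proof -
  interpret \<pi>: carried "opt_plan A" "spt \<mu>0 \<times> spt \<mu>1" by (rule carried_opt_plan)
  have "residual_form A B C = (\<integral>z. (h0 \<mu>0 \<mu>1 \<epsilon> A B (fst z) + h1 \<mu>0 \<mu>1 \<epsilon> A B (snd z)) * residual A C z
      - 32 * (bilin B (fst z) (snd z) * residual A C z) \<partial>opt_plan A)"
    unfolding residual_form_def by (simp add: residual_def[of A B] left_diff_distrib mult.assoc)
  also have "\<dots> = 0 - 32 * (\<integral>z. bilin B (fst z) (snd z) * residual A C z \<partial>opt_plan A)"
    using \<pi>.integrableI[OF bounded_borel_mult[OF bounded_h_sum bounded_residual]]
      \<pi>.integrableI[OF bounded_borel_mult[OF bounded_bilin bounded_residual]]
    by (simp add: residual_orthogonal[OF bounded_h])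
  finally show ?thesis by simp
qed

text \<open>To first order the plan changes by the density
  \<open>- residual A C / \<epsilon>\<close> relative to itself; this is the mean of
  \<open>x y^T\<close> under that change.\<close>

definition cross_moment_deriv :: "real^'n^'m \<Rightarrow> real^'n^'m \<Rightarrow> real^'n^'m" where
  "cross_moment_deriv A C = - (1 / \<epsilon>) *\<^sub>R bilin_moment (opt_plan A) (residual A C)"

lemma inner_cross_moment_deriv: "B \<bullet> cross_moment_deriv A C = residual_form A B C / (32 * \<epsilon>)"
  by (simp add: cross_moment_deriv_def inner_bilin_moment[OF carried_opt_plan bounded_residual] residual_form_bilin)

text \<open>Symmetry of \<open>residual_form\<close> moves the direction from the residual to the
  factor \<open>bilin\<close> in \<open>residual_form_bilin\<close>, where additivity and
  homogeneity are plain; testing with all \<open>D\<close> returns to matrices.\<close>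

lemma linear_cross_moment_deriv: "linear (cross_moment_deriv A)"
proof (rule linearI)
  fix B C and r :: real
  interpret \<pi>: carried "opt_plan A" "spt \<mu>0 \<times> spt \<mu>1" by (rule carried_opt_plan)
  have add: "residual_form A (B + C) D = residual_form A B D + residual_form A C D" for D
    using \<pi>.integrableI[OF bounded_borel_mult[OF bounded_bilin bounded_residual]]
    by (simp add: residual_form_bilin bilin_add distrib_right)
  have scale: "residual_form A (r *\<^sub>R C) D = r * residual_form A C D" for D
    by (simp add: residual_form_bilin bilin_scaleR mult.assoc)
  have "D \<bullet> cross_moment_deriv A (B + C) = D \<bullet> (cross_moment_deriv A B + cross_moment_deriv A C)" for D
    unfolding inner_add_right inner_cross_moment_deriv residual_form_sym[of A D] add by (simp add: add_divide_distrib)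
  then show "cross_moment_deriv A (B + C) = cross_moment_deriv A B + cross_moment_deriv A C" using vector_eq_ldot by blast
  have "D \<bullet> cross_moment_deriv A (r *\<^sub>R C) = D \<bullet> (r *\<^sub>R cross_moment_deriv A C)" for D
    unfolding inner_scaleR_right inner_cross_moment_deriv residual_form_sym[of A D] scale by simp
  then show "cross_moment_deriv A (r *\<^sub>R C) = r *\<^sub>R cross_moment_deriv A C" using vector_eq_ldot by blast
qed

text \<open>\<open>derivative_estimate\<close> controls integrals of scalar functions. Testing with
  \<open>32 * bilin v\<close>, where \<open>v\<close> is the remainder matrix itself, gives
  \<open>32 |v|^2 \<le> K (R |C|)^2 R |v|\<close>, and one factor \<open>|v|\<close>
  cancels.\<close>

lemma cross_moment_quadratic_remainder:
  obtains r K where "0 < r" "0 \<le> K"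
    "\<And>C. norm C \<le> r \<Longrightarrow> norm (cross_moment (A + C) - cross_moment A - cross_moment_deriv A C) \<le> K * (norm C)\<^sup>2"
proof -
  interpret E: eot \<mu>0 "spt \<mu>0" \<mu>1 "spt \<mu>1" \<epsilon> "cost A" "fst (potential A)" "snd (potential A)" by (rule eot_potential)
  interpret \<pi>: carried "opt_plan A" "spt \<mu>0 \<times> spt \<mu>1" by (rule carried_opt_plan)
  obtain R0 where R0: "0 < R0" "\<And>x. x \<in> spt \<mu>0 \<Longrightarrow> norm x \<le> R0"
    using compact_imp_bounded[OF M0.compact_carrier] bounded_pos by blast
  obtain R1 where R1: "0 < R1" "\<And>x. x \<in> spt \<mu>1 \<Longrightarrow> norm x \<le> R1"
    using compact_imp_bounded[OF M1.compact_carrier] bounded_pos by blast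
  \<comment> \<open>\<open>R |C|\<close> bounds the change \<open>32 * bilin C\<close> of the cost
    on the carriers and serves as \<beta>; the radius \<open>1 / R\<close> below ensures that it is
    at most 1. In \<open>R ^ 3\<close> two powers come from the square of \<beta> and one from the
    test function.\<close>
  define R where "R = 32 * (R0 * R1)"
  have R: "0 < R" using R0(1) R1(1) by (simp add: R_def)
  have bR: "\<bar>32 * bilin C x y\<bar> \<le> R * norm C" if "x \<in> spt \<mu>0" "y \<in> spt \<mu>1" for C x y
  proof -
    have "\<bar>bilin C x y\<bar> \<le> norm C * (norm x * norm y)" by (rule abs_bilin_le)
    also have "\<dots> \<le> norm C * (R0 * R1)"
      using R0 R1 that by (intro mult_left_mono mult_mono) (auto intro: less_imp_le)
    finally show ?thesis by (simp add: R_def abs_mult mult_ac)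
  qed
  obtain K where K: "0 \<le> K"
    "\<And>b \<phi>0' \<phi>1' g0 g1 \<beta> f F. eot \<mu>0 (spt \<mu>0) \<mu>1 (spt \<mu>1) \<epsilon> (\<lambda>x y. cost A x y - b x y) \<phi>0' \<phi>1' \<Longrightarrow>
      (\<And>x y. x \<in> spt \<mu>0 \<Longrightarrow> y \<in> spt \<mu>1 \<Longrightarrow> \<bar>b x y\<bar> \<le> \<beta>) \<Longrightarrow> \<beta> \<le> 1 \<Longrightarrow> E.lin_system b g0 g1 \<Longrightarrow>
      bounded_borel (spt \<mu>0 \<times> spt \<mu>1) f \<Longrightarrow> (\<And>z. z \<in> spt \<mu>0 \<times> spt \<mu>1 \<Longrightarrow> \<bar>f z\<bar> \<le> F) \<Longrightarrow>
      \<bar>(\<integral>z. f z \<partial>eot.\<pi> \<mu>0 \<mu>1 \<epsilon> (\<lambda>x y. cost A x y - b x y) \<phi>0' \<phi>1') - (\<integral>z. f z \<partial>E.\<pi>)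
        + (\<integral>z. f z * (g0 (fst z) + g1 (snd z) - b (fst z) (snd z)) \<partial>E.\<pi>) / \<epsilon>\<bar> \<le> K * \<beta>\<^sup>2 * F"
    using E.derivative_estimate by blast
  show thesis
  proof (rule that[of "1 / R" "K * R ^ 3"])
    fix C :: "real^'n^'m" assume C: "norm C \<le> 1 / R"
    define v where "v = cross_moment (A + C) - cross_moment A - cross_moment_deriv A C"
    have c: "cost (A + C) = (\<lambda>x y. cost A x y - 32 * bilin C x y)"
      by (simp add: fun_eq_iff cost_add)
    have "\<bar>(\<integral>z. 32 * bilin v (fst z) (snd z) \<partial>opt_plan (A + C)) - (\<integral>z. 32 * bilin v (fst z) (snd z) \<partial>E.\<pi>)
        + (\<integral>z. 32 * bilin v (fst z) (snd z) * (h0 \<mu>0 \<mu>1 \<epsilon> A C (fst z) + h1 \<mu>0 \<mu>1 \<epsilon> A C (snd z)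
          - 32 * bilin C (fst z) (snd z)) \<partial>E.\<pi>) / \<epsilon>\<bar> \<le> K * (R * norm C)\<^sup>2 * (R * norm v)"
      unfolding opt_plan_def c
    proof (rule K(2))
      show "R * norm C \<le> 1" using C R by (simp add: field_simps)
      show "bounded_borel (spt \<mu>0 \<times> spt \<mu>1) (\<lambda>z. 32 * bilin v (fst z) (snd z))"
        by (intro bounded_borel_mult bounded_borel_const bounded_bilin)
      show "eot \<mu>0 (spt \<mu>0) \<mu>1 (spt \<mu>1) \<epsilon> (\<lambda>x y. cost A x y - 32 * bilin C x y) (fst (potential (A + C))) (snd (potential (A + C)))"
        using eot_potential[of "A + C"] by (simp add: c)
    qed (use bR h_lin_system in auto)
    also have "(\<integral>z. 32 * bilin v (fst z) (snd z) * (h0 \<mu>0 \<mu>1 \<epsilon> A C (fst z) + h1 \<mu>0 \<mu>1 \<epsilon> A C (snd z)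
          - 32 * bilin C (fst z) (snd z)) \<partial>E.\<pi>) = - residual_form A v C"
      by (simp add: residual_form_bilin residual_def opt_plan_def mult.assoc)
    also have "(\<integral>z. 32 * bilin v (fst z) (snd z) \<partial>opt_plan (A + C)) - (\<integral>z. 32 * bilin v (fst z) (snd z) \<partial>E.\<pi>) + - residual_form A v C / \<epsilon>
        = 32 * (v \<bullet> v)"
      by (simp add: v_def[of] inner_diff_right inner_cross_moment[symmetric] inner_cross_moment_deriv opt_plan_def[symmetric])
    finally have "32 * (norm v * norm v) \<le> K * (R * norm C)\<^sup>2 * (R * norm v)"
      by (simp add: dot_square_norm power2_eq_square)
    moreover have "norm v * norm v \<le> 32 * (norm v * norm v)" by simp
    moreover have "K * (R * norm C)\<^sup>2 * (R * norm v) = (K * R ^ 3 * (norm C)\<^sup>2) * norm v"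
      by (simp add: power_mult_distrib power2_eq_square power3_eq_cube mult_ac)
    ultimately have *: "norm v * norm v \<le> (K * R ^ 3 * (norm C)\<^sup>2) * norm v" by linarith
    have "0 \<le> K * R ^ 3 * (norm C)\<^sup>2" using K(1) R by simp
    then show "norm (cross_moment (A + C) - cross_moment A - cross_moment_deriv A C) \<le> K * R ^ 3 * (norm C)\<^sup>2"
      using * by (cases "norm v = 0") (auto simp: v_def[symmetric] mult_le_cancel_right)
  qed (use R K in auto)
qed

lemma cross_moment_derivative: "(cross_moment has_derivative cross_moment_deriv A) (at A)"
proof -
  obtain r K where "0 < r" "0 \<le> K"
    "\<And>C. norm C \<le> r \<Longrightarrow> norm (cross_moment (A + C) - cross_moment A - cross_moment_deriv A C) \<le> K * (norm C)\<^sup>2"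
    using cross_moment_quadratic_remainder[of A] by metis
  then show ?thesis
    using linear_cross_moment_deriv by (intro has_derivative_quadratic_remainder) (auto simp: linear_linear)
qed

text \<open>Envelope argument: the supergradient inequalities based at \<open>A\<close> and at
  \<open>A + C\<close> enclose the increment, and the gap between them is 32 times the inner product
  of \<open>C\<close> with \<open>cross_moment (A + C) - cross_moment A\<close>, which is
  quadratically small.\<close>

lemma ot_value_derivative: "(ot_value has_derivative (\<lambda>C. - 32 * (cross_moment A \<bullet> C))) (at A)"
proof -
  obtain r K where r: "0 < r" "0 \<le> K"
    and K: "\<And>C. norm C \<le> r \<Longrightarrow> norm (cross_moment (A + C) - cross_moment A - cross_moment_deriv A C) \<le> K * (norm C)\<^sup>2"
    using cross_moment_quadratic_remainder[of A] by metis
  obtain L where L: "0 < L" "\<And>C. norm (cross_moment_deriv A C) \<le> norm C * L"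
    using bounded_linear.pos_bounded linear_cross_moment_deriv linear_linear by metis
  show ?thesis
  \<comment> \<open>For \<open>norm C \<le> 1\<close> the quadratic remainder is at most
    \<open>K * norm C\<close>; with the bound \<open>L\<close> on the derivative,
    \<open>K + L\<close> is a Lipschitz constant of \<open>cross_moment\<close> at
    \<open>A\<close>.\<close>
  proof (rule has_derivative_quadratic_remainder[of _ "min r 1" "32 * (K + L)"])
    show "bounded_linear (\<lambda>C. - 32 * (cross_moment A \<bullet> C))"
      by (intro bounded_linear_const_mult bounded_linear_inner_right)
    fix C :: "real^'n^'m" assume C: "norm C \<le> min r 1"
    have "norm (cross_moment (A + C) - cross_moment A) \<le> norm (cross_moment (A + C) - cross_moment A - cross_moment_deriv A C) + norm (cross_moment_deriv A C)"
      using norm_triangle_ineq[of "cross_moment (A + C) - cross_moment A - cross_moment_deriv A C" "cross_moment_deriv A C"] by simp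
    also have "\<dots> \<le> K * (norm C)\<^sup>2 + norm C * L" using K L(2) C by (intro add_mono) auto
    also have "\<dots> \<le> K * norm C + norm C * L"
      using r C by (intro add_right_mono mult_left_mono) (auto simp: power2_eq_square intro: mult_left_le)
    finally have n: "norm (cross_moment (A + C) - cross_moment A) \<le> (K + L) * norm C" by (simp add: algebra_simps)
    have "ot_value (A + C) - ot_value A + 32 * (C \<bullet> cross_moment A) \<le> 0"
      using ot_value_supergradient[of "A + C" A] by simp
    moreover have "- 32 * (C \<bullet> (cross_moment (A + C) - cross_moment A)) \<le> ot_value (A + C) - ot_value A + 32 * (C \<bullet> cross_moment A)"
      using ot_value_supergradient[of A "A + C"] by (simp add: inner_diff_right inner_diff_left)
    moreover have "C \<bullet> (cross_moment (A + C) - cross_moment A) \<le> norm C * ((K + L) * norm C)"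
      by (rule order_trans[OF norm_cauchy_schwarz]) (intro mult_left_mono n, simp)
    ultimately have "\<bar>ot_value (A + C) - ot_value A + 32 * (C \<bullet> cross_moment A)\<bar> \<le> 32 * (norm C * ((K + L) * norm C))"
      by linarith
    then show "norm (ot_value (A + C) - ot_value A - - 32 * (cross_moment A \<bullet> C)) \<le> 32 * (K + L) * (norm C)\<^sup>2"
      by (simp add: inner_commute power2_eq_square mult_ac)
  qed (use r L in auto)
qed

lemma D1_Phi: "D1 (Phi \<mu>0 \<mu>1 \<epsilon>) A = blinfun_inner_right (64 *\<^sub>R A - 32 *\<^sub>R cross_moment A)"
proof -
  have "((\<lambda>A. 32 * (A \<bullet> A) + ot_value A) has_derivative (\<lambda>C. 32 * (A \<bullet> C + C \<bullet> A) + - 32 * (cross_moment A \<bullet> C))) (at A)"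
    by (intro derivative_intros ot_value_derivative)
  moreover have "blinfun_apply (blinfun_inner_right (64 *\<^sub>R A - 32 *\<^sub>R cross_moment A))
      = (\<lambda>C. 32 * (A \<bullet> C + C \<bullet> A) + - 32 * (cross_moment A \<bullet> C))"
    by (simp add: fun_eq_iff inner_diff_left inner_commute[of _ A])
  ultimately have "(Phi \<mu>0 \<mu>1 \<epsilon> has_derivative blinfun_apply (blinfun_inner_right (64 *\<^sub>R A - 32 *\<^sub>R cross_moment A))) (at A)"
    by (simp only: Phi_eq[abs_def] power2_norm_eq_inner)
  from frechet_derivative_at[OF this] show ?thesis
    unfolding D1_def by (metis blinfun_apply_inverse)
qed

text \<open>The map from a gradient to its functional is bounded linear, so it is enough to
  differentiate the gradient field; the 32 in front of \<open>cross_moment\<close> cancels the 32 in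
  \<open>inner_cross_moment_deriv\<close>.\<close>

lemma D2_Phi: "D2 (Phi \<mu>0 \<mu>1 \<epsilon>) A B C = 64 * (B \<bullet> C) - residual_form A B C / \<epsilon>"
proof -
  have "((\<lambda>A. 64 *\<^sub>R A - 32 *\<^sub>R cross_moment A) has_derivative (\<lambda>B. 64 *\<^sub>R B - 32 *\<^sub>R cross_moment_deriv A B)) (at A)"
    by (intro derivative_intros cross_moment_derivative)
  then have "(D1 (Phi \<mu>0 \<mu>1 \<epsilon>) has_derivative (\<lambda>B. blinfun_inner_right (64 *\<^sub>R B - 32 *\<^sub>R cross_moment_deriv A B))) (at A)"
    unfolding D1_Phi[abs_def] by (rule bounded_linear.has_derivative[OF bounded_linear_blinfun_inner_right])
  then have "frechet_derivative (D1 (Phi \<mu>0 \<mu>1 \<epsilon>)) (at A)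
      = (\<lambda>B. blinfun_inner_right (64 *\<^sub>R B - 32 *\<^sub>R cross_moment_deriv A B))"
    by (rule frechet_derivative_at[symmetric])
  then show ?thesis
    unfolding D2_def
    by (simp add: inner_diff_left inner_commute[of "cross_moment_deriv A B" C] inner_cross_moment_deriv residual_form_sym[of A C B])
qed

end

section \<open>Eigenvalues of the Hessian\<close>

text \<open>The integral of \<open>(s X - t Y)^2\<close> is a nonnegative quadratic form in
  \<open>s\<close> and \<open>t\<close>; at \<open>s = c\<close>, \<open>t = b\<close> it equals
  \<open>c (a c - b^2)\<close>, which settles the case \<open>c > 0\<close>.\<close>

lemma (in carried) Cauchy_Schwarz_integral:
  assumes X: "bounded_borel S X" and Y: "bounded_borel S Y"
  shows "(\<integral>z. X z * Y z \<partial>M)\<^sup>2 \<le> (\<integral>z. (X z)\<^sup>2 \<partial>M) * (\<integral>z. (Y z)\<^sup>2 \<partial>M)"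
proof -
  define a where "a = (\<integral>z. (X z)\<^sup>2 \<partial>M)"
  define b where "b = (\<integral>z. X z * Y z \<partial>M)"
  define c where "c = (\<integral>z. (Y z)\<^sup>2 \<partial>M)"
  have q: "0 \<le> s\<^sup>2 * a - 2 * (s * t) * b + t\<^sup>2 * c" for s t
  proof -
    have "(s * X z - t * Y z)\<^sup>2 = s\<^sup>2 * (X z)\<^sup>2 - 2 * (s * t) * (X z * Y z) + t\<^sup>2 * (Y z)\<^sup>2" for z
      by (simp add: power2_eq_square algebra_simps)
    moreover have "0 \<le> (\<integral>z. (s * X z - t * Y z)\<^sup>2 \<partial>M)"
      by (intro integral_nonneg_AE AE_I2) simp
    ultimately show ?thesis
      using integrableI[OF bounded_borel_power2[OF X]] integrableI[OF bounded_borel_power2[OF Y]]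
        integrableI[OF bounded_borel_mult[OF X Y]]
      by (simp add: a_def b_def c_def)
  qed
  have "0 \<le> c" unfolding c_def by (intro integral_nonneg_AE AE_I2) simp
  show ?thesis
  proof (cases "c = 0")
    case True
    have "b = 0"
    proof (rule ccontr)
      assume "b \<noteq> 0"
      \<comment> \<open>With \<open>c = 0\<close> and \<open>s = 1\<close> the form is
        \<open>a - 2 t b\<close>, and this \<open>t\<close> makes it -1.\<close>
      then show False using q[of 1 "(a + 1) / (2 * b)"] True by simp
    qed
    then show ?thesis using True by (simp add: a_def b_def c_def)
  next
    case False
    have "0 \<le> c * (a * c - b\<^sup>2)" using q[of c b] by (simp add: power2_eq_square algebra_simps)
    then have "0 \<le> a * c - b\<^sup>2" using False \<open>0 \<le> c\<close> by (simp add: zero_le_mult_iff)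
    then show ?thesis by (simp add: a_def b_def c_def)
  qed
qed

context compact_eot
begin

lemma linear_residual_form: "linear (residual_form A B)" "linear (\<lambda>B. residual_form A B C)"
proof -
  have l: "linear (residual_form A B)" for B
  proof -
    have "residual_form A B = (\<lambda>C. 32 * \<epsilon> * (B \<bullet> cross_moment_deriv A C))"
      using eps by (simp add: fun_eq_iff inner_cross_moment_deriv)
    moreover have "linear (\<lambda>C. 32 * \<epsilon> * (B \<bullet> cross_moment_deriv A C))"
      using linear_add[OF linear_cross_moment_deriv] linear_cmul[OF linear_cross_moment_deriv]
      by (intro linearI) (auto simp: inner_add_right distrib_left)
    ultimately show ?thesis by simp
  qed
  show "linear (residual_form A B)" by (rule l)
  show "linear (\<lambda>B. residual_form A B C)" using l[of C] by (simp add: residual_form_sym[of A _ C])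
qed

lemma D2_Phi_sym: "D2 (Phi \<mu>0 \<mu>1 \<epsilon>) A B C = D2 (Phi \<mu>0 \<mu>1 \<epsilon>) A C B"
  by (simp add: D2_Phi inner_commute residual_form_sym[of A B C])

lemma linear_D2_Phi: "linear (D2 (Phi \<mu>0 \<mu>1 \<epsilon>) A B)" "linear (\<lambda>B. D2 (Phi \<mu>0 \<mu>1 \<epsilon>) A B C)"
proof -
  have l: "linear (D2 (Phi \<mu>0 \<mu>1 \<epsilon>) A B)" for B
    unfolding D2_Phi[abs_def]
    using linear_add[OF linear_residual_form(1)] linear_cmul[OF linear_residual_form(1)]
    by (intro linearI) (auto simp: inner_add_right add_divide_distrib algebra_simps)
  show "linear (D2 (Phi \<mu>0 \<mu>1 \<epsilon>) A B)" by (rule l)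
  show "linear (\<lambda>B. D2 (Phi \<mu>0 \<mu>1 \<epsilon>) A B C)" using l[of C] by (simp add: D2_Phi_sym[of A _ C])
qed

lemma D2_Phi_unit: "norm C = 1 \<Longrightarrow> D2 (Phi \<mu>0 \<mu>1 \<epsilon>) A C C = 64 - residual_form A C C / \<epsilon>"
  by (simp add: D2_Phi norm_eq_1)

lemma residual_form_nonneg: "0 \<le> residual_form A C C"
  unfolding residual_form_def by (intro integral_nonneg_AE AE_I2) simp

text \<open>With \<open>h = h0 + h1\<close> and \<open>k\<close> the residual,
  \<open>32 * bilin = h - k\<close>, so the integrand is \<open>2 h k - k^2\<close>; the product
  \<open>h k\<close> integrates to zero.\<close>

lemma residual_form_diag:
  "(\<integral>(x, y). (h0 \<mu>0 \<mu>1 \<epsilon> A C x + h1 \<mu>0 \<mu>1 \<epsilon> A C y)\<^sup>2 - 32\<^sup>2 * (bilin C x y)\<^sup>2 \<partial>opt_plan A) = - residual_form A C C"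
proof -
  interpret \<pi>: carried "opt_plan A" "spt \<mu>0 \<times> spt \<mu>1" by (rule carried_opt_plan)
  let ?h = "\<lambda>z. h0 \<mu>0 \<mu>1 \<epsilon> A C (fst z) + h1 \<mu>0 \<mu>1 \<epsilon> A C (snd z)"
  have "(?h z)\<^sup>2 - 32\<^sup>2 * (bilin C (fst z) (snd z))\<^sup>2 = 2 * (?h z * residual A C z) - residual A C z * residual A C z" for z
    by (simp add: residual_def power2_eq_square algebra_simps)
  then show ?thesis
    using \<pi>.integrableI[OF bounded_borel_mult[OF bounded_h_sum[of A C] bounded_residual[of A C]]]
      \<pi>.integrableI[OF bounded_borel_mult[OF bounded_residual[of A C] bounded_residual[of A C]]]
    by (simp add: case_prod_unfold residual_orthogonal[OF bounded_h] residual_form_def)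
qed

lemma variance_eq:
  "prob_space.variance (opt_plan A) (\<lambda>(x, y). bilin C x y)
    = (\<integral>z. (bilin C (fst z) (snd z) - C \<bullet> cross_moment A)\<^sup>2 \<partial>opt_plan A)"
  by (simp add: case_prod_unfold inner_cross_moment)

text \<open>With \<open>m\<close> the mean of \<open>x \<bullet> C y\<close>, the identity \<open>32 (x \<bullet> C y - m) = (h0 x + h1 y - 32 m) - residual A C (x, y)\<close>
  splits the centred variable into orthogonal parts.\<close>

lemma residual_form_le_variance: "residual_form A C C \<le> 32\<^sup>2 * prob_space.variance (opt_plan A) (\<lambda>(x, y). bilin C x y)"
proof -
  interpret \<pi>: carried "opt_plan A" "spt \<mu>0 \<times> spt \<mu>1" by (rule carried_opt_plan)
  define m where "m = C \<bullet> cross_moment A"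
  let ?u = "\<lambda>z. (h0 \<mu>0 \<mu>1 \<epsilon> A C (fst z) - 32 * m) + h1 \<mu>0 \<mu>1 \<epsilon> A C (snd z)"
  have bu: "bounded_borel (spt \<mu>0) (\<lambda>x. h0 \<mu>0 \<mu>1 \<epsilon> A C x - 32 * m)"
    by (intro bounded_borel_diff bounded_borel_const bounded_h)
  have b: "bounded_borel (spt \<mu>0 \<times> spt \<mu>1) ?u"
    by (intro bounded_borel_add bounded_borel_fst[OF bu] bounded_borel_snd bounded_h)
  have eq: "32\<^sup>2 * (bilin C (fst z) (snd z) - m)\<^sup>2 = (?u z)\<^sup>2 + residual A C z * residual A C z - 2 * (?u z * residual A C z)" for z
    by (simp add: residual_def power2_eq_square algebra_simps)
  have "32\<^sup>2 * (\<integral>z. (bilin C (fst z) (snd z) - m)\<^sup>2 \<partial>opt_plan A)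
      = (\<integral>z. (?u z)\<^sup>2 + residual A C z * residual A C z - 2 * (?u z * residual A C z) \<partial>opt_plan A)"
    by (subst integral_mult_right_zero[symmetric]) (simp only: eq)
  also have "\<dots> = (\<integral>z. (?u z)\<^sup>2 \<partial>opt_plan A) + residual_form A C C - 2 * (\<integral>z. ?u z * residual A C z \<partial>opt_plan A)"
    using \<pi>.integrableI[OF bounded_borel_mult[OF b bounded_residual[of A C]]] \<pi>.integrableI[OF bounded_borel_power2[OF b]]
      \<pi>.integrableI[OF bounded_borel_mult[OF bounded_residual[of A C] bounded_residual[of A C]]]
    by (simp add: residual_form_def)
  also have "(\<integral>z. ?u z * residual A C z \<partial>opt_plan A) = 0"
    by (rule residual_orthogonal[OF bu bounded_h(2)])
  finally show ?thesis
    unfolding variance_eq m_def[symmetric] by simp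
qed

text \<open>The variance is at most the second moment, for a unit matrix \<open>bilin\<close> is at
  most \<open>|x| |y|\<close> in absolute value, and Cauchy-Schwarz separates the two
  marginals.\<close>

lemma variance_le_moments:
  assumes "norm C = 1"
  shows "prob_space.variance (opt_plan A) (\<lambda>(x, y). bilin C x y) \<le> sqrt (moment 4 \<mu>0 * moment 4 \<mu>1)"
proof -
  interpret \<pi>: carried "opt_plan A" "spt \<mu>0 \<times> spt \<mu>1" by (rule carried_opt_plan)
  interpret E: eot \<mu>0 "spt \<mu>0" \<mu>1 "spt \<mu>1" \<epsilon> "cost A" "fst (potential A)" "snd (potential A)" by (rule eot_potential)
  have n0: "bounded_borel (spt \<mu>0 \<times> spt \<mu>1) (\<lambda>z. norm (fst z))"
    and n1: "bounded_borel (spt \<mu>0 \<times> spt \<mu>1) (\<lambda>z. norm (snd z))"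
    by (intro bounded_borel_continuous P.compact_carrier continuous_intros)+
  have "prob_space.variance (opt_plan A) (\<lambda>(x, y). bilin C x y) =
      (\<integral>z. (bilin C (fst z) (snd z))\<^sup>2 \<partial>opt_plan A) - (C \<bullet> cross_moment A)\<^sup>2"
    using \<pi>.variance_eq[OF \<pi>.integrableI[OF bounded_bilin[of C]] \<pi>.integrableI[OF bounded_borel_power2[OF bounded_bilin[of C]]]]
    by (simp add: case_prod_unfold inner_cross_moment)
  also have "\<dots> \<le> (\<integral>z. (bilin C (fst z) (snd z))\<^sup>2 \<partial>opt_plan A)" by simp
  also have "\<dots> \<le> (\<integral>z. (norm (fst z))\<^sup>2 * (norm (snd z))\<^sup>2 \<partial>opt_plan A)"
  proof (rule \<pi>.integral_mono_carrier)
    show "(bilin C (fst z) (snd z))\<^sup>2 \<le> (norm (fst z))\<^sup>2 * (norm (snd z))\<^sup>2" for z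
      using abs_bilin_le[of C "fst z" "snd z"] assms
      by (simp add: power_mult_distrib[symmetric] abs_le_square_iff[symmetric])
  qed (intro bounded_borel_intros n0 n1 bounded_bilin)+
  also have "\<dots> \<le> sqrt (moment 4 \<mu>0 * moment 4 \<mu>1)"
  proof -
    let ?X = "\<lambda>z. (norm (fst z))\<^sup>2 :: real" and ?Y = "\<lambda>z. (norm (snd z))\<^sup>2 :: real"
    have bX: "bounded_borel (spt \<mu>0 \<times> spt \<mu>1) ?X" and bY: "bounded_borel (spt \<mu>0 \<times> spt \<mu>1) ?Y"
      by (intro bounded_borel_intros n0 n1)+
    have "(\<integral>z. ?X z * ?Y z \<partial>opt_plan A)\<^sup>2 \<le> (\<integral>z. (?X z)\<^sup>2 \<partial>opt_plan A) * (\<integral>z. (?Y z)\<^sup>2 \<partial>opt_plan A)"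
      by (intro \<pi>.Cauchy_Schwarz_integral bX bY)
    also have "(\<integral>z. (?X z)\<^sup>2 \<partial>opt_plan A) = moment 4 \<mu>0"
      using E.integral_fst_coupling[OF opt_plan_coupling, of "\<lambda>x. norm x ^ 4"]
      by (simp add: moment_def flip: power_mult)
    also have "(\<integral>z. (?Y z)\<^sup>2 \<partial>opt_plan A) = moment 4 \<mu>1"
      using E.integral_snd_coupling[OF opt_plan_coupling, of "\<lambda>x. norm x ^ 4"]
      by (simp add: moment_def flip: power_mult)
    finally show ?thesis by (rule real_le_rsqrt)
  qed
  finally show ?thesis .
qed

end

theorem corollary5:
  fixes \<mu>0 :: "(real^'m) measure" and \<mu>1 :: "(real^'n) measure"
    and \<epsilon> :: real and A :: "real^'n^'m"
  assumes "borel_prob \<mu>0" and "borel_prob \<mu>1"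
    and "compact (spt \<mu>0)" and "compact (spt \<mu>1)"
    and "\<epsilon> > 0"
  shows
    "lambda_min (D2 (Phi \<mu>0 \<mu>1 \<epsilon>) A) =
       64 + (1 / \<epsilon>) * (INF C\<in>{C :: real^'n^'m. norm C = 1}.
         \<integral>(x, y). (h0 \<mu>0 \<mu>1 \<epsilon> A C x + h1 \<mu>0 \<mu>1 \<epsilon> A C y)^2 - 32^2 * (bilin C x y)^2
           \<partial>opt_coupling \<mu>0 \<mu>1 \<epsilon> A)
     \<and> lambda_min (D2 (Phi \<mu>0 \<mu>1 \<epsilon>) A) \<ge>
       64 - 32^2 * (1 / \<epsilon>) * (SUP C\<in>{C :: real^'n^'m. norm C = 1}.
         prob_space.variance (opt_coupling \<mu>0 \<mu>1 \<epsilon> A) (\<lambda>(x, y). bilin C x y))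
     \<and> (SUP C\<in>{C :: real^'n^'m. norm C = 1}.
         prob_space.variance (opt_coupling \<mu>0 \<mu>1 \<epsilon> A) (\<lambda>(x, y). bilin C x y))
       \<le> sqrt (moment 4 \<mu>0 * moment 4 \<mu>1)
     \<and> lambda_max (D2 (Phi \<mu>0 \<mu>1 \<epsilon>) A) \<le> 64"
proof -
  interpret M0: carried \<mu>0 "spt \<mu>0"
    using assms AE_spt[of \<mu>0] by (intro carried.intro carried_axioms.intro) (auto simp: borel_prob_def)
  interpret M1: carried \<mu>1 "spt \<mu>1"
    using assms AE_spt[of \<mu>1] by (intro carried.intro carried_axioms.intro) (auto simp: borel_prob_def)
  interpret compact_eot \<mu>0 \<mu>1 \<epsilon>
    by unfold_locales (rule assms)
  let ?S = "{C :: real^'n^'m. norm C = 1}"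
  let ?Q = "D2 (Phi \<mu>0 \<mu>1 \<epsilon>) A"
  let ?var = "\<lambda>C. prob_space.variance (opt_plan A) (\<lambda>(x, y). bilin C x y)"
  note ext = extremal_eigenvalues[of ?Q, OF linear_D2_Phi(2,1) D2_Phi_sym]
  obtain C where C: "norm C = 1" "lambda_min ?Q = 64 - residual_form A C C / \<epsilon>"
    using ext(1) D2_Phi_unit by auto
  obtain C' where C': "norm C' = 1" "lambda_max ?Q = 64 - residual_form A C' C' / \<epsilon>"
    using ext(3) D2_Phi_unit by auto
  \<comment> \<open>Minimality of \<open>64 - residual_form / \<epsilon>\<close> at \<open>C\<close>
    is maximality of \<open>residual_form\<close>, so the infimum in the claim is attained at the
    same \<open>C\<close>.\<close>
  have le: "residual_form A B B \<le> residual_form A C C" if "norm B = 1" for B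
    using ext(2)[OF that] C(2) D2_Phi_unit[OF that, of A] eps by (simp add: divide_le_cancel)
  \<comment> \<open>The moment bound also makes the real supremum of the variances meaningful, so
    that the single variance at \<open>C\<close> lies below it.\<close>
  have bdd: "bdd_above (?var ` ?S)"
    by (intro bdd_aboveI2[of _ _ "sqrt (moment 4 \<mu>0 * moment 4 \<mu>1)"]) (simp add: variance_le_moments)
  have "(INF B\<in>?S. - residual_form A B B) = - residual_form A C C"
    using C(1) le by (intro cInf_eq_minimum) auto
  moreover have "residual_form A C C \<le> 32\<^sup>2 * (SUP B\<in>?S. ?var B)"
    using residual_form_le_variance[of A C] cSUP_upper[OF _ bdd, of C] C(1) by simp
  then have "residual_form A C C / \<epsilon> \<le> 32\<^sup>2 * (SUP B\<in>?S. ?var B) / \<epsilon>"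
    using eps by (intro divide_right_mono) auto
  moreover have "(SUP B\<in>?S. ?var B) \<le> sqrt (moment 4 \<mu>0 * moment 4 \<mu>1)"
    using C(1) by (intro cSUP_least) (auto simp: variance_le_moments)
  ultimately show ?thesis
    unfolding opt_coupling_eq residual_form_diag using C(2) C'(2) residual_form_nonneg[of A C'] eps by simp
qed

end
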